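(* Consider random sequential adsorption on the random geometric graph with $N$ points in a box of volume $N/\lambda$, as described in the context. Let $z(t)$ be the limiting fraction of explored points, $\eta(t)$ the limiting fraction of explored volume, and $T^*=\inf\{t>0:z(t)=1\}$. Then for all $t\le T^*$, $$\dot z(t)=1+(1-z(t))\,\frac{\dot\eta(t)}{1-\eta(t)}=1+\dot\eta(t)\,e^{-\int_0^t\frac{1}{1-z(s)}\,ds}.$$
   Context: Fix $d\ge1$, $\lambda>0$, $r>0$. $N$ points $X_1,\dots,X_N$ are i.i.d. uniform in a box (cube) $\mathcal{C}=\mathcal{C}_N\subset\mathbb{R}^d$ of volume $|\mathcal{C}|=N/\lambda$ (a Poisson point process $\Phi$ of intensity $\lambda$ conditioned on having $N$ points); two points are neighbours if their Euclidean distance is at most $r$. Exploration: $Z_0=0$, $E_0=\emptyset$. At step $n$, as long as unexplored points remain, a point $X_{i_n}$ is chosen uniformly at random among the unexplored points; it and all its unexplored neighbours become explored. Put $S_n=B^*(X_{i_n},r)\cap E_{n-1}^c$ and $E_n=\bigcup_{k\le n}S_k$, where $B^*(x,r)$ is the ball of radius $r$ around $x$ without its centre, so that the number $Z_n$ of explored points satisfies $Z_n=1+Z_{n-1}+\Phi(S_n)$. Once all points are explored, $Z_n=N$ and $S_n=\emptyset$. $|S|$ denotes Lebesgue volume. There exist deterministic functions $z,\eta:[0,\infty)\to[0,1]$ with $$\frac{Z_{\lfloor tN\rfloor}}{N}\to z(t),\qquad \frac1{|\mathcal{C}|}\sum_{i=1}^{\lfloor tN\rfloor}|S_i|\to\eta(t)\qquad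 (N\to\infty)$$ almost surely and in $L^1$; these are the functions in the claim. Conventions at the endpoint $t=T^*$: derivatives are one-sided and $e^{-\infty}=0$. *)

theory Defs
  imports "HOL-Probability.Probability"
begin

definition is_cube :: "'a::euclidean_space set \<Rightarrow> bool" where
  "is_cube C \<longleftrightarrow> (\<exists>a s. 0 < s \<and> C = cbox a (a + s *\<^sub>R One))"

text \<open>
  Points are identified with their indices \<open>{..<N}\<close>: \<open>x i\<close> is the location of point \<open>i\<close>, and
  \<open>j n\<close> (for \<open>n \<ge> 1\<close>) is the index chosen at step \<open>n\<close>.  Once no unexplored point remains, the
  value of \<open>j\<close> is ignored.
\<close>

fun explored :: "real \<Rightarrow> nat \<Rightarrow> (nat \<Rightarrow> 'a::euclidean_space) \<Rightarrow> (nat \<Rightarrow> nat) \<Rightarrow> nat \<Rightarrow> nat set" where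
  "explored r N x j 0 = {}"
| "explored r N x j (Suc n) =
     (if {..<N} - explored r N x j n = {} then explored r N x j n
      else explored r N x j n \<union> {j (Suc n)} \<union>
           {k \<in> {..<N} - explored r N x j n. dist (x k) (x (j (Suc n))) \<le> r})"

definition unexplored :: "real \<Rightarrow> nat \<Rightarrow> (nat \<Rightarrow> 'a::euclidean_space) \<Rightarrow> (nat \<Rightarrow> nat) \<Rightarrow> nat \<Rightarrow> nat set" where
  "unexplored r N x j n = {..<N} - explored r N x j n"

definition num_explored :: "real \<Rightarrow> nat \<Rightarrow> (nat \<Rightarrow> 'a::euclidean_space) \<Rightarrow> (nat \<Rightarrow> nat) \<Rightarrow> nat \<Rightarrow> nat" where
  "num_explored r N x j n = card (explored r N x j n)"

text \<open>
  The region \<open>S\<^sub>n\<close> newly explored at step \<open>n \<ge> 1\<close>: the punctured closed ball around the chosen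
  point, minus \<open>E\<^sub>n\<^sub>-\<^sub>1 = (\<Union>k\<in>{1..<n}. S\<^sub>k)\<close>.  It is a subset of the whole space and may
  stick out of the cube containing the points.
\<close>

fun new_region :: "real \<Rightarrow> nat \<Rightarrow> (nat \<Rightarrow> 'a::euclidean_space) \<Rightarrow> (nat \<Rightarrow> nat) \<Rightarrow> nat \<Rightarrow> 'a set" where
  "new_region r N x j n =
     (if n = 0 \<or> unexplored r N x j (n - 1) = {} then {}
      else (cball (x (j n)) r - {x (j n)}) - (\<Union>k\<in>{1..<n}. new_region r N x j k))"

declare new_region.simps [simp del]

text \<open>
  The random exploration, for all system sizes \<open>N\<close> on a common probability space.  Nothing is
  assumed about the joint law of the models for different \<open>N\<close>.  The last assumption says that,
  given the positions of all points and the first \<open>n\<close> choices, the next point is uniformly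
  distributed on the unexplored points.
\<close>

definition history ::
  "'w measure \<Rightarrow> nat \<Rightarrow> (nat \<Rightarrow> 'w \<Rightarrow> 'a::euclidean_space) \<Rightarrow> (nat \<Rightarrow> 'w \<Rightarrow> nat) \<Rightarrow> nat \<Rightarrow> 'w measure" where
  "history M N X J n =
     vimage_algebra (space M)
       (\<lambda>\<omega>. (\<lambda>i\<in>{..<N}. X i \<omega>, \<lambda>k\<in>{1..n}. J k \<omega>))
       (PiM {..<N} (\<lambda>_. borel) \<Otimes>\<^sub>M PiM {1..n} (\<lambda>_. count_space {..<N}))"

locale rsa_exploration = prob_space M
  for M :: "'w measure" +
  fixes lam r :: real
    and C :: "nat \<Rightarrow> 'a::euclidean_space set"
    and X :: "nat \<Rightarrow> nat \<Rightarrow> 'w \<Rightarrow> 'a"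
    and J :: "nat \<Rightarrow> nat \<Rightarrow> 'w \<Rightarrow> nat"
  assumes lam_pos: "0 < lam"
    and r_pos: "0 < r"
    and cube: "\<And>N. 0 < N \<Longrightarrow> is_cube (C N)"
    and volume: "\<And>N. 0 < N \<Longrightarrow> measure lborel (C N) = real N / lam"
    and points_indep: "\<And>N. 0 < N \<Longrightarrow> indep_vars (\<lambda>_. borel) (X N) {..<N}"
    and points_uniform:
      "\<And>N i. i < N \<Longrightarrow> distr M borel (X N i) = uniform_measure lborel (C N)"
    and choice_measurable:
      "\<And>N n. 0 < N \<Longrightarrow> 0 < n \<Longrightarrow> J N n \<in> measurable M (count_space {..<N})"
    and choice_uniform:
      "\<And>N n i. i < N \<Longrightarrow>
         AE \<omega> in M. unexplored r N (\<lambda>k. X N k \<omega>) (\<lambda>k. J N k \<omega>) n \<noteq> {} \<longrightarrow>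
           real_cond_exp M (history M N (X N) (J N) n)
             (indicator {\<omega>' \<in> space M. J N (Suc n) \<omega>' = i}) \<omega> =
           (if i \<in> unexplored r N (\<lambda>k. X N k \<omega>) (\<lambda>k. J N k \<omega>) n
            then 1 / real (card (unexplored r N (\<lambda>k. X N k \<omega>) (\<lambda>k. J N k \<omega>) n)) else 0)"

definition explored_fraction ::
  "real \<Rightarrow> (nat \<Rightarrow> nat \<Rightarrow> 'w \<Rightarrow> 'a::euclidean_space) \<Rightarrow> (nat \<Rightarrow> nat \<Rightarrow> 'w \<Rightarrow> nat) \<Rightarrow>
   real \<Rightarrow> nat \<Rightarrow> 'w \<Rightarrow> real" where
  "explored_fraction r X J t N \<omega> =
     real (num_explored r N (\<lambda>k. X N k \<omega>) (\<lambda>k. J N k \<omega>) (nat \<lfloor>t * real N\<rfloor>)) / real N"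

definition explored_volume_fraction ::
  "real \<Rightarrow> (nat \<Rightarrow> 'a set) \<Rightarrow> (nat \<Rightarrow> nat \<Rightarrow> 'w \<Rightarrow> 'a::euclidean_space) \<Rightarrow> (nat \<Rightarrow> nat \<Rightarrow> 'w \<Rightarrow> nat) \<Rightarrow>
   real \<Rightarrow> nat \<Rightarrow> 'w \<Rightarrow> real" where
  "explored_volume_fraction r C X J t N \<omega> =
     (\<Sum>i = 1..nat \<lfloor>t * real N\<rfloor>.
        measure lborel (new_region r N (\<lambda>k. X N k \<omega>) (\<lambda>k. J N k \<omega>) i)) / measure lborel (C N)"

definition converges_AE_L1 :: "'w measure \<Rightarrow> (nat \<Rightarrow> 'w \<Rightarrow> real) \<Rightarrow> real \<Rightarrow> bool" where
  "converges_AE_L1 M f c \<longleftrightarrow>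
     (AE \<omega> in M. (\<lambda>N. f N \<omega>) \<longlonglongrightarrow> c) \<and>
     (\<forall>N>0. integrable M (f N)) \<and>
     (\<lambda>N. \<integral>\<omega>. \<bar>f N \<omega> - c\<bar> \<partial>M) \<longlonglongrightarrow> 0"

definition T_star :: "(real \<Rightarrow> real) \<Rightarrow> real" where
  "T_star z = Inf {t. 0 < t \<and> z t = 1}"

text \<open>\<open>e\<^sup>-\<^sup>x\<close> for \<open>x \<in> [0, \<infinity>]\<close>, with \<open>e\<^sup>-\<^sup>\<infinity> = 0\<close>.\<close>

definition exp_minus :: "ennreal \<Rightarrow> real" where
  "exp_minus x = (if x = \<infinity> then 0 else exp (- enn2real x))"

end

theory Submission
  imports Defs
begin

text \<open>
  Let \<open>V\<^sub>n\<close> be the fraction of the cube not covered by the first \<open>n\<close> balls, \<open>u\<^sub>n\<close> the number of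
  unexplored points, and \<open>Q\<^sub>n\<close> the probability that two uniform points are both uncovered and within
  distance \<open>r\<close>. Replacing an unexplored point by a fresh uniform point in the uncovered part does not
  influence the exploration. Exchanging the two gives the division-free identities
  \<open>E (V\<^sub>n (V\<^sub>n - V\<^sub>n\<^sub>+\<^sub>1)) = E Q\<^sub>n\<close> and
  \<open>E (V\<^sub>n (u\<^sub>n - u\<^sub>n\<^sub>+\<^sub>1 - 1)) = E ((u\<^sub>n - 1) (V\<^sub>n - V\<^sub>n\<^sub>+\<^sub>1))\<close> on the event that
  unexplored points remain. As \<open>V\<close>, \<open>u\<close> and \<open>Q\<close> decrease along the exploration, summing over a time
  interval \<open>[s, t]\<close> and letting \<open>N\<close> tend to infinity sandwiches the increments of \<open>\<eta>\<close> and \<open>z\<close>. Since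
  \<open>N Q\<close> is Lipschitz in \<open>V\<close>, the sandwich closes as \<open>t - s\<close> tends to \<open>0\<close> and yields the derivatives. The
  bound \<open>\<eta> \<le> 1 - exp (- \<lambda> |B(0,r)|)\<close> comes from the part of the cube that is at distance more than
  \<open>r\<close> from all points. Finally \<open>\<phi> = (1 - z) / (1 - \<eta>)\<close> satisfies \<open>\<phi>' = - \<phi> / (1 - z)\<close>, which is the
  exponential form.
\<close>

section \<open>Real analysis\<close>

text \<open>Informally, given the exploration so far, the unexplored points are independent and
  uniform in the uncovered part, so the next ball removes on average
  \<open>Q\<^sub>n / V\<^sub>n\<close> of the volume. That conditional law is never formed.
  \<open>V\<^sub>n\<close> is the probability that a fresh point is uncovered, so multiplying by it
  puts a fresh point and a sample point on an equal footing, and swapping the two preserves the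
  product law. This is the origin of the factor \<open>V\<^sub>n\<close>. The hypotheses yield
  limits of \<open>V\<close> and of \<open>u / N\<close>, but not of \<open>N Q\<close>. As the
  limits are constants, bounded convergence alone turns expectations of products into products of
  limits; a lower limit stands in for \<open>N Q\<close>. The other obstacle is the end of the
  exploration. The identities concern steps at which unexplored points remain, so a sum over a time
  interval counts active steps. If \<open>z < 1\<close> holds before time \<open>t\<close>, the
  number of active steps up to time \<open>t\<close> is asymptotically \<open>t N\<close>. The
  condition says nothing about \<open>z t\<close> itself, which makes the endpoint \<open>T*\<close>
  admissible.\<close>

lemma continuous_on_lipschitz_interval:
  fixes f :: "real \<Rightarrow> real"
  assumes "\<And>s t. a \<le> s \<Longrightarrow> s \<le> t \<Longrightarrow> t \<le> b \<Longrightarrow> \<bar>f t - f s\<bar> \<le> K * (t - s)"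
  shows "continuous_on {a..b} f"
proof -
  have "\<bar>K\<bar>-lipschitz_on {a..b} f"
  proof (rule lipschitz_on_leI)
    fix x y :: real assume "x \<in> {a..b}" "y \<in> {a..b}" "x \<le> y"
    moreover have "K * (y - x) \<le> \<bar>K\<bar> * (y - x)" using \<open>x \<le> y\<close> by (intro mult_right_mono) auto
    ultimately show "dist (f x) (f y) \<le> \<bar>K\<bar> * dist x y"
      using assms[of x y] by (simp add: dist_real_def)
  qed simp
  then show ?thesis by (rule lipschitz_on_continuous_on)
qed

text \<open>The chord bounds are given for ordered pairs only. Writing the pair \<open>t\<close>,
  \<open>y\<close> as \<open>min t y\<close>, \<open>max t y\<close> lets one limit statement cover
  both sides of \<open>t\<close>, and the one-sided derivatives at \<open>a\<close> and
  \<open>b\<close> as well.\<close>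

lemma has_real_derivative_sandwich:
  fixes f :: "real \<Rightarrow> real" and lo hi :: "real \<Rightarrow> real \<Rightarrow> real"
  assumes t: "t \<in> {a..b}"
    and bounds: "\<And>x y. a \<le> x \<Longrightarrow> x < y \<Longrightarrow> y \<le> b \<Longrightarrow>
        lo x y * (y - x) \<le> f y - f x \<and> f y - f x \<le> hi x y * (y - x)"
    and lo: "((\<lambda>y. lo (min t y) (max t y)) \<longlongrightarrow> d) (at t within {a..b})"
    and hi: "((\<lambda>y. hi (min t y) (max t y)) \<longlongrightarrow> d) (at t within {a..b})"
  shows "(f has_real_derivative d) (at t within {a..b})"
  unfolding has_field_derivative_iff
proof (rule tendsto_sandwich[OF _ _ lo hi])
  have *: "lo (min t y) (max t y) \<le> (f y - f t) / (y - t) \<and>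
      (f y - f t) / (y - t) \<le> hi (min t y) (max t y)" if "y \<in> {a..b}" "y \<noteq> t" for y
  proof (cases "t < y")
    case True
    then show ?thesis using bounds[of t y] t that by (simp add: field_simps)
  next
    case False
    then have "y < t" using that by simp
    moreover have "(f y - f t) / (y - t) = (f t - f y) / (t - y)"
      using minus_divide_divide[of "f t - f y" "t - y"] by simp
    ultimately show ?thesis using bounds[of y t] t that
      by (simp add: field_simps)
  qed
  show "\<forall>\<^sub>F y in at t within {a..b}. lo (min t y) (max t y) \<le> (f y - f t) / (y - t)"
    unfolding eventually_at_filter using * by (auto intro!: always_eventually)
  show "\<forall>\<^sub>F y in at t within {a..b}. (f y - f t) / (y - t) \<le> hi (min t y) (max t y)"
    unfolding eventually_at_filter using * by (auto intro!: always_eventually)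
qed

lemma tendsto_min_max_within:
  fixes f :: "real \<Rightarrow> real"
  assumes "continuous_on {a..b} f" "t \<in> {a..b}"
  shows "((\<lambda>y. f (min t y)) \<longlongrightarrow> f t) (at t within {a..b})"
    and "((\<lambda>y. f (max t y)) \<longlongrightarrow> f t) (at t within {a..b})"
proof -
  have m: "((\<lambda>y. min t y) \<longlongrightarrow> t) (at t within {a..b})" "((\<lambda>y. max t y) \<longlongrightarrow> t) (at t within {a..b})"
    using tendsto_min[OF tendsto_const tendsto_ident_at, of t t] tendsto_max[OF tendsto_const tendsto_ident_at, of t t]
    by auto
  show "((\<lambda>y. f (min t y)) \<longlongrightarrow> f t) (at t within {a..b})"
    by (rule continuous_on_tendsto_compose[OF assms(1) m(1)])
       (use assms(2) in \<open>auto simp: eventually_at_filter intro!: always_eventually\<close>)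
  show "((\<lambda>y. f (max t y)) \<longlongrightarrow> f t) (at t within {a..b})"
    by (rule continuous_on_tendsto_compose[OF assms(1) m(2)])
       (use assms(2) in \<open>auto simp: eventually_at_filter intro!: always_eventually\<close>)
qed

text \<open>The integral in the exponent may diverge at the endpoint and is therefore an
  \<open>ennreal\<close>. This is its value on intervals where the integrand stays
  continuous.\<close>

lemma nn_integral_FTC_within:
  fixes F f :: "real \<Rightarrow> real"
  assumes "a \<le> b"
    and d: "\<And>x. x \<in> {a..b} \<Longrightarrow> (F has_real_derivative f x) (at x within {a..b})"
    and cont: "continuous_on {a..b} f"
    and pos: "\<And>x. x \<in> {a..b} \<Longrightarrow> 0 \<le> f x"
  shows "(\<integral>\<^sup>+x\<in>{a..b}. ennreal (f x) \<partial>lborel) = ennreal (F b - F a)" and "F a \<le> F b"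
proof -
  define g where "g x = indicator {a..b} x * f x" for x
  have "(f has_integral (F b - F a)) {a..b}"
    using fundamental_theorem_of_calculus[OF \<open>a \<le> b\<close>, of F f] d
    by (simp add: has_real_derivative_iff_has_vector_derivative)
  note int = this
  have "0 \<le> F b - F a" using has_integral_nonneg[OF int pos] .
  then show "F a \<le> F b" by simp
  from int have "(g has_integral (F b - F a)) UNIV"
    unfolding g_def by (subst (asm) has_integral_restrict_UNIV[symmetric])
      (auto simp: indicator_def if_distrib if_distribR elim!: has_integral_eq[rotated])
  moreover have "g \<in> borel_measurable borel"
    unfolding g_def using borel_measurable_continuous_on_indicator[OF _ cont] by simp
  moreover have "0 \<le> g x" for x using pos by (auto simp: g_def indicator_def)
  ultimately have "(\<integral>\<^sup>+x. ennreal (g x) \<partial>lborel) = ennreal (F b - F a)"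
    by (intro nn_integral_has_integral_lborel) auto
  also have "(\<integral>\<^sup>+x. ennreal (g x) \<partial>lborel) = (\<integral>\<^sup>+x\<in>{a..b}. ennreal (f x) \<partial>lborel)"
    by (intro nn_integral_cong) (auto simp: g_def indicator_def)
  finally show "(\<integral>\<^sup>+x\<in>{a..b}. ennreal (f x) \<partial>lborel) = ennreal (F b - F a)" .
qed

lemma continuous_within_approach_right_end:
  fixes f :: "real \<Rightarrow> real"
  assumes "0 < T" "continuous_on {0..T} f" "0 < e"
  shows "\<exists>t. 0 \<le> t \<and> t < T \<and> \<bar>f t - f T\<bar> < e"
proof -
  obtain d where d: "d > 0" "\<And>y. y \<in> {0..T} \<Longrightarrow> dist y T < d \<Longrightarrow> dist (f y) (f T) < e"
    using assms unfolding continuous_on_iff by (metis atLeastAtMost_iff less_eq_real_def)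
  define t where "t = max 0 (T - d / 2)"
  have "0 \<le> t" "t < T" "dist t T < d" using d(1) assms(1) by (auto simp: t_def dist_real_def)
  then show ?thesis using d(2)[of t] by (auto simp: dist_real_def)
qed

text \<open>The deterministic core. \<open>R\<close> plays the role of the limit of
  \<open>N Q\<close>, \<open>c\<close> keeps \<open>1 - \<eta>\<close> away from zero, and one
  constant \<open>K\<close> serves all Lipschitz bounds. In the sandwich inequalities both sides,
  divided by \<open>t - s\<close>, have the same limit as the interval shrinks, since
  \<open>\<eta>\<close>, \<open>z\<close> and \<open>R\<close> are continuous.\<close>

lemma adsorption_derivatives:
  fixes z \<eta> R :: "real \<Rightarrow> real" and T K c :: real
  assumes T: "0 < T" and K: "0 \<le> K" and c: "0 < c"
    and z0: "z 0 = 0" and eta0: "\<eta> 0 = 0"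
    and z_less: "\<And>t. 0 \<le> t \<Longrightarrow> t < T \<Longrightarrow> z t < 1"
    and z_le: "z T \<le> 1"
    and eta_le: "\<And>t. 0 \<le> t \<Longrightarrow> t \<le> T \<Longrightarrow> \<eta> t \<le> 1 - c"
    and eta_lip: "\<And>s t. 0 \<le> s \<Longrightarrow> s \<le> t \<Longrightarrow> t \<le> T \<Longrightarrow> 0 \<le> \<eta> t - \<eta> s \<and> \<eta> t - \<eta> s \<le> K * (t - s)"
    and z_lip: "\<And>s t. 0 \<le> s \<Longrightarrow> s \<le> t \<Longrightarrow> t \<le> T \<Longrightarrow> 0 \<le> z t - z s \<and> z t - z s \<le> K * (t - s)"
    and R_lip: "\<And>s t. 0 \<le> s \<Longrightarrow> s \<le> t \<Longrightarrow> t \<le> T \<Longrightarrow> R t \<le> R s \<and> R s \<le> R t + K * (\<eta> t - \<eta> s)"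
    and eta_upper: "\<And>s t. 0 \<le> s \<Longrightarrow> s \<le> t \<Longrightarrow> t \<le> T \<Longrightarrow> (1 - \<eta> t) * (\<eta> t - \<eta> s) \<le> (t - s) * R s"
    and eta_lower: "\<And>s t. 0 \<le> s \<Longrightarrow> s \<le> t \<Longrightarrow> t \<le> T \<Longrightarrow> (t - s) * R t \<le> (1 - \<eta> s) * (\<eta> t - \<eta> s)"
    and z_upper: "\<And>s t. 0 \<le> s \<Longrightarrow> s \<le> t \<Longrightarrow> t \<le> T \<Longrightarrow>
        (1 - \<eta> t) * (z t - z s - (t - s)) \<le> (1 - z s) * (\<eta> t - \<eta> s)"
    and z_lower: "\<And>s t. 0 \<le> s \<Longrightarrow> s \<le> t \<Longrightarrow> t \<le> T \<Longrightarrow>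
        (1 - z t) * (\<eta> t - \<eta> s) \<le> (1 - \<eta> s) * (z t - z s - (t - s))"
    and t: "t \<in> {0..T}"
  shows "\<exists>dz d\<eta>.
         (z has_real_derivative dz) (at t within {0..T}) \<and>
         (\<eta> has_real_derivative d\<eta>) (at t within {0..T}) \<and>
         dz = 1 + (1 - z t) * (d\<eta> / (1 - \<eta> t)) \<and>
         dz = 1 + d\<eta> * exp_minus (\<integral>\<^sup>+s\<in>{0..t}. ennreal (1 / (1 - z s)) \<partial>lborel)"
proof -
  have ceta: "continuous_on {0..T} \<eta>" using eta_lip by (intro continuous_on_lipschitz_interval[where K=K]) force
  have cz: "continuous_on {0..T} z" using z_lip by (intro continuous_on_lipschitz_interval[where K=K]) force
  have cR: "continuous_on {0..T} R"
  proof (rule continuous_on_lipschitz_interval[where K="K * K"])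
    fix s t :: real assume st: "0 \<le> s" "s \<le> t" "t \<le> T"
    have "K * (\<eta> t - \<eta> s) \<le> K * (K * (t - s))" using eta_lip[OF st] K by (intro mult_left_mono) auto
    then show "\<bar>R t - R s\<bar> \<le> K * K * (t - s)" using R_lip[OF st] by (simp add: algebra_simps)
  qed
  have pos: "0 < 1 - \<eta> s" if "s \<in> {0..T}" for s using eta_le[of s] c that by auto
  define D where "D s = R s / (1 - \<eta> s)" for s
  have cD: "continuous_on {0..T} D" unfolding D_def
    using pos by (intro continuous_intros ceta cR) fastforce
  have d\<eta>: "(\<eta> has_real_derivative D t) (at t within {0..T})" if t: "t \<in> {0..T}" for t
  proof (rule has_real_derivative_sandwich[where lo="\<lambda>x y. R y / (1 - \<eta> x)" and hi="\<lambda>x y. R x / (1 - \<eta> y)"])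
    fix x y :: real assume xy: "0 \<le> x" "x < y" "y \<le> T"
    show "R y / (1 - \<eta> x) * (y - x) \<le> \<eta> y - \<eta> x \<and> \<eta> y - \<eta> x \<le> R x / (1 - \<eta> y) * (y - x)"
      using eta_upper[of x y] eta_lower[of x y] pos[of x] pos[of y] xy by (simp add: field_simps)
  next
    show "((\<lambda>y. R (max t y) / (1 - \<eta> (min t y))) \<longlongrightarrow> D t) (at t within {0..T})"
      unfolding D_def using t pos[OF t]
      by (intro tendsto_intros tendsto_min_max_within[where a=0 and b=T] ceta cR) auto
    show "((\<lambda>y. R (min t y) / (1 - \<eta> (max t y))) \<longlongrightarrow> D t) (at t within {0..T})"
      unfolding D_def using t pos[OF t]
      by (intro tendsto_intros tendsto_min_max_within[where a=0 and b=T] ceta cR) auto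
  qed (use t in auto)
  define Dz where "Dz s = 1 + (1 - z s) * (D s / (1 - \<eta> s))" for s
  have dz: "(z has_real_derivative Dz t) (at t within {0..T})" if t: "t \<in> {0..T}" for t
  proof (rule has_real_derivative_sandwich[where
        lo="\<lambda>x y. 1 + (1 - z y) * (R y / (1 - \<eta> x)) / (1 - \<eta> x)" and
        hi="\<lambda>x y. 1 + (1 - z x) * (R x / (1 - \<eta> y)) / (1 - \<eta> y)"])
    fix x y :: real assume xy: "0 \<le> x" "x < y" "y \<le> T"
    have e: "R y / (1 - \<eta> x) * (y - x) \<le> \<eta> y - \<eta> x" "\<eta> y - \<eta> x \<le> R x / (1 - \<eta> y) * (y - x)"
      using eta_upper[of x y] eta_lower[of x y] pos[of x] pos[of y] xy by (simp_all add: field_simps)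
    have z1: "0 \<le> 1 - z y" "0 \<le> 1 - z x" using z_less[of x] z_less[of y] z_le xy
      by (auto simp: less_le)
    have "(1 - z y) * (R y / (1 - \<eta> x) * (y - x)) \<le> (1 - \<eta> x) * (z y - z x - (y - x))"
      using mult_left_mono[OF e(1) z1(1)] z_lower[of x y] xy by linarith
    moreover have "(1 - \<eta> y) * (z y - z x - (y - x)) \<le> (1 - z x) * (R x / (1 - \<eta> y) * (y - x))"
      using mult_left_mono[OF e(2) z1(2)] z_upper[of x y] xy by linarith
    ultimately have "(1 - z y) * (R y / (1 - \<eta> x) * (y - x)) \<le> (z y - z x - (y - x)) * (1 - \<eta> x)"
      "(z y - z x - (y - x)) * (1 - \<eta> y) \<le> (1 - z x) * (R x / (1 - \<eta> y) * (y - x))"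
      by (simp_all only: mult.commute)
    moreover have "0 < 1 - \<eta> x" "0 < 1 - \<eta> y" using pos[of x] pos[of y] xy by auto
    ultimately have "(1 - z y) * (R y / (1 - \<eta> x) * (y - x)) / (1 - \<eta> x) \<le> z y - z x - (y - x)"
      "z y - z x - (y - x) \<le> (1 - z x) * (R x / (1 - \<eta> y) * (y - x)) / (1 - \<eta> y)"
      by (simp_all only: pos_divide_le_eq pos_le_divide_eq)
    then show "(1 + (1 - z y) * (R y / (1 - \<eta> x)) / (1 - \<eta> x)) * (y - x) \<le> z y - z x \<and>
       z y - z x \<le> (1 + (1 - z x) * (R x / (1 - \<eta> y)) / (1 - \<eta> y)) * (y - x)"
      by (simp add: distrib_right algebra_simps)
  next
    show "((\<lambda>y. 1 + (1 - z (max t y)) * (R (max t y) / (1 - \<eta> (min t y))) / (1 - \<eta> (min t y))) \<longlongrightarrow> Dz t)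
        (at t within {0..T})"
      unfolding Dz_def D_def times_divide_eq_right using t pos[OF t]
      by (intro tendsto_intros tendsto_min_max_within[where a=0 and b=T] ceta cR cz) auto
    show "((\<lambda>y. 1 + (1 - z (min t y)) * (R (min t y) / (1 - \<eta> (max t y))) / (1 - \<eta> (max t y))) \<longlongrightarrow> Dz t)
        (at t within {0..T})"
      unfolding Dz_def D_def times_divide_eq_right using t pos[OF t]
      by (intro tendsto_intros tendsto_min_max_within[where a=0 and b=T] ceta cR cz) auto
  qed (use t in auto)
  define \<phi> where "\<phi> s = (1 - z s) / (1 - \<eta> s)" for s
  have c\<phi>: "continuous_on {0..T} \<phi>" unfolding \<phi>_def
    using pos by (intro continuous_intros ceta cz) fastforce
  have d\<phi>: "(\<phi> has_real_derivative - 1 / (1 - \<eta> s)) (at s within {0..T})" if s: "s \<in> {0..T}" for s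
  proof -
    \<comment> \<open>In the quotient rule for \<open>\<phi>\<close> the two terms containing
      \<open>d\<close> cancel. This uses exactly the form of \<open>Dz\<close>, and leaves a
      derivative without \<open>D\<close>.\<close>
    have "((0 - (1 + u * (d / v))) * v - u * (0 - d)) / (v * v) = - 1 / v" if "v \<noteq> 0" for u d v :: real
      using that by (simp add: field_simps)
    from this[of "1 - \<eta> s" "1 - z s" "D s"] show ?thesis
      unfolding \<phi>_def using pos[OF s] DERIV_divide[OF DERIV_diff[OF DERIV_const dz[OF s]]
        DERIV_diff[OF DERIV_const d\<eta>[OF s]], of 1 1] by (simp add: Dz_def)
  qed
  have I: "(\<integral>\<^sup>+s\<in>{0..t}. ennreal (1 / (1 - z s)) \<partial>lborel) = ennreal (- ln (\<phi> t)) \<and> 0 \<le> - ln (\<phi> t)"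
    if t: "0 \<le> t" "t \<le> T" and zt: "\<And>s. 0 \<le> s \<Longrightarrow> s \<le> t \<Longrightarrow> z s < 1" for t
  proof -
    have d: "((\<lambda>x. - ln (\<phi> x)) has_real_derivative 1 / (1 - z x)) (at x within {0..t})" if x: "x \<in> {0..t}" for x
    proof -
      have p: "0 < 1 - z x" "0 < 1 - \<eta> x" "0 < \<phi> x" using pos[of x] zt[of x] x t by (auto simp: \<phi>_def)
      have "(\<phi> has_real_derivative - 1 / (1 - \<eta> x)) (at x within {0..t})"
        by (rule DERIV_subset[OF d\<phi>]) (use x t in auto)
      note DERIV_minus[OF DERIV_chain2[where f = ln, OF DERIV_ln[OF p(3)] this]]
      \<comment> \<open>Division by \<open>\<phi>\<close> replaces the denominator
        \<open>1 - \<eta>\<close> by \<open>1 - z\<close>, so \<open>- ln \<phi>\<close> is an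
        antiderivative of the integrand in the exponent; it vanishes at 0 because \<open>z 0\<close>
        and \<open>\<eta> 0\<close> do.\<close>
      moreover have "- (inverse (\<phi> x) * (- 1 / (1 - \<eta> x))) = 1 / (1 - z x)"
        using p(1,2) by (simp add: \<phi>_def)
      ultimately show ?thesis by simp
    qed
    have "continuous_on {0..t} (\<lambda>s. 1 / (1 - z s))"
      using zt t by (intro continuous_intros continuous_on_subset[OF cz]) (auto, fastforce)
    note nn_integral_FTC_within[OF t(1) d this]
    then show ?thesis using zt by (simp add: \<phi>_def z0 eta0 less_imp_le)
  qed
  have E: "exp_minus (\<integral>\<^sup>+s\<in>{0..t}. ennreal (1 / (1 - z s)) \<partial>lborel) = \<phi> t"
  proof (cases "t < T \<or> z T < 1")
    case True
    then have zt: "z s < 1" if "0 \<le> s" "s \<le> t" for s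
      using z_less[of s] that t by (cases "s = T") auto
    have p: "0 < \<phi> t" using zt[of t] pos[of t] t by (auto simp: \<phi>_def)
    then show ?thesis using p I[of t] zt t by (simp add: exp_minus_def)
  next
    case False
    then have tT: "t = T" and zT: "z T = 1" using t z_le by auto
    then have "\<phi> T = 0" by (simp add: \<phi>_def)
    have "(\<integral>\<^sup>+s\<in>{0..T}. ennreal (1 / (1 - z s)) \<partial>lborel) = \<infinity>"
    \<comment> \<open>A finite value \<open>B\<close> would bound \<open>- ln (\<phi> s)\<close> for
      every \<open>s < T\<close>, hence \<open>\<phi> s\<close> would be at least
      \<open>exp (- B)\<close> up to the endpoint, against continuity and
      \<open>\<phi> T = 0\<close>.\<close>
    proof (rule ccontr)
      assume "\<not> ?thesis"
      then obtain B where B: "0 \<le> B" "(\<integral>\<^sup>+s\<in>{0..T}. ennreal (1 / (1 - z s)) \<partial>lborel) = ennreal B"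
        by (cases "\<integral>\<^sup>+s\<in>{0..T}. ennreal (1 / (1 - z s)) \<partial>lborel") auto
      obtain s where s: "0 \<le> s" "s < T" "\<bar>\<phi> s - \<phi> T\<bar> < exp (- B)"
        using continuous_within_approach_right_end[OF T c\<phi>, of "exp (- B)"] by auto
      have p: "0 < \<phi> s" using s z_less[of s] pos[of s] by (auto simp: \<phi>_def)
      have "ennreal (- ln (\<phi> s)) = (\<integral>\<^sup>+s\<in>{0..s}. ennreal (1 / (1 - z s)) \<partial>lborel)"
        using I[of s] s z_less by simp
      also have "\<dots> \<le> (\<integral>\<^sup>+s\<in>{0..T}. ennreal (1 / (1 - z s)) \<partial>lborel)"
        using s by (intro nn_integral_mono) (auto simp: indicator_def)
      finally have "ennreal (- ln (\<phi> s)) \<le> ennreal B" unfolding B(2) .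
      then have "- ln (\<phi> s) \<le> B" using B(1) by (simp add: ennreal_le_iff)
      then have "exp (- B) \<le> \<phi> s" using p by (metis exp_le_cancel_iff exp_ln minus_le_iff)
      then show False using s(3) \<open>\<phi> T = 0\<close> p by simp
    qed
    then show ?thesis using tT \<open>\<phi> T = 0\<close> by (simp add: exp_minus_def)
  qed
  show ?thesis
    by (intro exI[of _ "Dz t"] exI[of _ "D t"] conjI dz d\<eta> t) (simp_all add: E Dz_def \<phi>_def)
qed

section \<open>The exploration of a fixed configuration\<close>

text \<open>
  Unlike the regions \<open>S\<^sub>k\<close>, the balls excluded here contain their centres; the covered sets differ by
  a null set.
\<close>

fun free :: "real \<Rightarrow> nat \<Rightarrow> (nat \<Rightarrow> 'a::euclidean_space) \<Rightarrow> (nat \<Rightarrow> nat) \<Rightarrow> nat \<Rightarrow> 'a \<Rightarrow> bool" where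
  "free r N x j 0 y \<longleftrightarrow> True"
| "free r N x j (Suc n) y \<longleftrightarrow>
     free r N x j n y \<and> (unexplored r N x j n \<noteq> {} \<longrightarrow> r < dist y (x (j (Suc n))))"

lemma free_antimono: "free r N x j n y \<Longrightarrow> m \<le> n \<Longrightarrow> free r N x j m y"
  by (induction n) (auto simp: le_Suc_eq)

lemma unexplored_antimono: "m \<le> n \<Longrightarrow> unexplored r N x j n \<subseteq> unexplored r N x j m"
proof (induction n)
  case (Suc n)
  have "unexplored r N x j (Suc n) \<subseteq> unexplored r N x j n" by (simp add: unexplored_def) blast
  then show ?case using Suc by (auto simp: le_Suc_eq)
qed simp

lemma finite_unexplored [simp]: "finite (unexplored r N x j n)"
  by (simp add: unexplored_def)

lemma unexplored_subset: "unexplored r N x j n \<subseteq> {..<N}"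
  by (simp add: unexplored_def)

lemma unexplored_0 [simp]: "unexplored r N x j 0 = {..<N}"
  by (simp add: unexplored_def)

lemma unexplored_Suc:
  "unexplored r N x j (Suc n) = (if unexplored r N x j n = {} then {} else
     {k \<in> unexplored r N x j n. k \<noteq> j (Suc n) \<and> r < dist (x k) (x (j (Suc n)))})"
  by (auto simp: unexplored_def not_le)

text \<open>A chosen point needs no separate treatment since it lies in its own ball.\<close>

lemma mem_unexplored_iff_free:
  assumes "0 < r"
  shows "k \<in> unexplored r N x j n \<longleftrightarrow> k < N \<and> free r N x j n (x k)"
  using assms by (induction n) (auto simp: unexplored_Suc)

lemma explored_subset:
  assumes "\<And>l. l \<in> {1..n} \<Longrightarrow> j l < N"
  shows "explored r N x j n \<subseteq> {..<N}"
  using assms by (induction n) (auto simp: less_Suc_eq_le)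

lemma card_unexplored:
  assumes "\<And>l. l \<in> {1..n} \<Longrightarrow> j l < N"
  shows "card (unexplored r N x j n) + num_explored r N x j n = N"
proof -
  have "card (unexplored r N x j n) = N - card (explored r N x j n)"
    unfolding unexplored_def using explored_subset[of n j N r x] assms
    by (subst card_Diff_subset) (auto intro: finite_subset)
  moreover have "card (explored r N x j n) \<le> card {..<N}"
    using explored_subset[of n j N r x] assms by (intro card_mono) auto
  ultimately show ?thesis by (simp add: num_explored_def)
qed

lemma explored_cong:
  assumes "\<And>k. k < N \<Longrightarrow> x k = x' k" "\<And>l. l \<in> {1..n} \<Longrightarrow> j l = j' l" "\<And>l. l \<in> {1..n} \<Longrightarrow> j l < N"
  shows "explored r N x j n = explored r N x' j' n"
  using assms(2,3)
proof (induction n)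
  case (Suc n)
  then have "explored r N x j n = explored r N x' j' n" "j (Suc n) = j' (Suc n)" "j (Suc n) < N" by auto
  then show ?case using assms(1) by auto
qed simp

lemma unexplored_cong:
  assumes "\<And>k. k < N \<Longrightarrow> x k = x' k" "\<And>l. l \<in> {1..n} \<Longrightarrow> j l = j' l" "\<And>l. l \<in> {1..n} \<Longrightarrow> j l < N"
  shows "unexplored r N x j n = unexplored r N x' j' n"
  unfolding unexplored_def using explored_cong[of N x x' n j j' r] assms by simp

lemma free_cong:
  assumes "\<And>k. k < N \<Longrightarrow> x k = x' k" "\<And>l. l \<in> {1..n} \<Longrightarrow> j l = j' l" "\<And>l. l \<in> {1..n} \<Longrightarrow> j l < N"
  shows "free r N x j n y = free r N x' j' n y"
  using assms(2,3)
proof (induction n)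
  case (Suc n)
  have "unexplored r N x j n = unexplored r N x' j' n"
    using Suc.prems assms(1) by (intro unexplored_cong) auto
  moreover have "x (j (Suc n)) = x' (j' (Suc n))" using Suc.prems assms(1) by simp
  ultimately show ?case using Suc by simp
qed simp

text \<open>For fixed positions \<open>x\<close>, the probability that uniform choices among the
  unexplored points produce \<open>j 1, ..., j n\<close>. It is zero if the exploration ends before
  \<open>n\<close> steps.\<close>

definition choice_weight ::
  "real \<Rightarrow> nat \<Rightarrow> (nat \<Rightarrow> 'a::euclidean_space) \<Rightarrow> (nat \<Rightarrow> nat) \<Rightarrow> nat \<Rightarrow> real" where
  "choice_weight r N x j n = (\<Prod>l<n. if j (Suc l) \<in> unexplored r N x j l
     then 1 / real (card (unexplored r N x j l)) else 0)"

lemma choice_weight_nonneg: "0 \<le> choice_weight r N x j n"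
  unfolding choice_weight_def by (intro prod_nonneg) auto

lemma choice_weight_le_1: "choice_weight r N x j n \<le> 1"
proof -
  have "1 / real c \<le> 1" for c by (cases c) auto
  then show ?thesis unfolding choice_weight_def by (intro prod_le_1) auto
qed

lemma choice_weight_nonzeroD:
  "choice_weight r N x j n \<noteq> 0 \<Longrightarrow> l < n \<Longrightarrow> j (Suc l) \<in> unexplored r N x j l"
  unfolding choice_weight_def by (auto split: if_splits)

text \<open>A point outside the first \<open>n\<close> balls was never chosen, since it would lie in
  its own ball; so moving it leaves all centres in place. If the new location is uncovered too, the
  index stays unexplored throughout, and by induction nothing else changes.\<close>

lemma exploration_fun_upd:
  assumes r: "0 < r" and k: "free r N x j n (x k)" and y: "free r N x j n y" and m: "m \<le> n"
  shows "unexplored r N (x(k := y)) j m = unexplored r N x j m \<and>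
    free r N (x(k := y)) j m = free r N x j m"
  using m
proof (induction m)
  case (Suc m)
  then have IH: "unexplored r N (x(k := y)) j m = unexplored r N x j m"
    "free r N (x(k := y)) j m = free r N x j m"
    using Suc_leD by blast+
  have fk: "free r N x j (Suc m) (x k)" "free r N x j (Suc m) y"
    using free_antimono[OF k Suc.prems] free_antimono[OF y Suc.prems] by blast+
  have ne: "j (Suc m) \<noteq> k" if "unexplored r N x j m \<noteq> {}"
  proof
    assume "j (Suc m) = k"
    then have "r < dist (x k) (x k)" using fk(1) that by (simp only: free.simps simp_thms)
    then show False using r by simp
  qed
  have f: "free r N (x(k := y)) j (Suc m) = free r N x j (Suc m)"
  proof
    fix a show "free r N (x(k := y)) j (Suc m) a = free r N x j (Suc m) a"
      using ne by (cases "unexplored r N x j m = {}") (simp_all only: free.simps IH fun_upd_other simp_thms)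
  qed
  show ?case
  proof (intro conjI f set_eqI)
    fix k' show "k' \<in> unexplored r N (x(k := y)) j (Suc m) \<longleftrightarrow> k' \<in> unexplored r N x j (Suc m)"
      unfolding mem_unexplored_iff_free[OF r] f using fk by (cases "k' = k") (simp_all only: fun_upd_same fun_upd_other simp_thms)
  qed
qed auto

text \<open>The bound is \<open>Suc n\<close>, one more than the number of balls avoided: the weight
  of step \<open>Suc n\<close> looks only at the unexplored sets up to time \<open>n\<close>.
  Therefore \<open>k\<close> may itself be the point chosen at step \<open>Suc n\<close>.\<close>

lemma choice_weight_fun_upd:
  assumes "0 < r" "free r N x j n (x k)" "free r N x j n y" "m \<le> Suc n"
  shows "choice_weight r N (x(k := y)) j m = choice_weight r N x j m"
  unfolding choice_weight_def
proof (rule prod.cong[OF refl])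
  fix l assume "l \<in> {..<m}"
  then have "l \<le> n" using assms(4) by auto
  then show "(if j (Suc l) \<in> unexplored r N (x(k := y)) j l then 1 / real (card (unexplored r N (x(k := y)) j l)) else 0) =
       (if j (Suc l) \<in> unexplored r N x j l then 1 / real (card (unexplored r N x j l)) else 0)"
    using exploration_fun_upd[OF assms(1-3)] by simp
qed

section \<open>The union of the regions \<open>S\<^sub>k\<close> and its volume\<close>

lemma Union_new_region:
  "(\<Union>k\<in>{1..n}. new_region r N x j k) \<subseteq> {y. \<not> free r N x j n y}"
  "{y. \<not> free r N x j n y} - (\<Union>k\<in>{1..n}. new_region r N x j k) \<subseteq> (\<lambda>l. x (j l)) ` {1..n}"
proof -
  have "(\<Union>k\<in>{1..n}. new_region r N x j k) \<subseteq> {y. \<not> free r N x j n y} \<and>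
    {y. \<not> free r N x j n y} - (\<Union>k\<in>{1..n}. new_region r N x j k) \<subseteq> (\<lambda>l. x (j l)) ` {1..n}"
  proof (induction n)
    case (Suc n)
    have e: "new_region r N x j (Suc n) = (if unexplored r N x j n = {} then {}
      else (cball (x (j (Suc n))) r - {x (j (Suc n))}) - (\<Union>k\<in>{1..n}. new_region r N x j k))"
      by (subst new_region.simps) (simp add: atLeastLessThanSuc_atLeastAtMost)
    show ?case using Suc
      by (simp add: atLeastAtMostSuc_conv e) (auto simp: not_less dist_commute)
  qed simp
  then show "(\<Union>k\<in>{1..n}. new_region r N x j k) \<subseteq> {y. \<not> free r N x j n y}"
    "{y. \<not> free r N x j n y} - (\<Union>k\<in>{1..n}. new_region r N x j k) \<subseteq> (\<lambda>l. x (j l)) ` {1..n}" by auto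
qed

lemma new_region_disjoint: "disjoint_family_on (new_region r N x j) {1..n}"
proof -
  have "new_region r N x j k \<inter> new_region r N x j l = {}" if "1 \<le> k" "k < l" for k l
    using that by (subst new_region.simps[of r N x j l]) auto
  then show ?thesis unfolding disjoint_family_on_def
    by (metis Int_commute atLeastAtMost_iff linorder_neqE_nat)
qed

lemma new_region_measurable [measurable]: "new_region r N x j n \<in> sets borel"
proof (induction n rule: less_induct)
  case (less n)
  have "(\<Union>k\<in>{1..<n}. new_region r N x j k) \<in> sets borel" using less by auto
  then show ?case by (subst new_region.simps) auto
qed

lemma free_measurable [measurable]: "Measurable.pred borel (free r N x j n)"
  by (induction n) simp_all

text \<open>The regions are disjoint, and their union misses only finitely many centres of the
  covered set. The volumes are those in the whole space, including what lies outside the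
  cube.\<close>

lemma sum_new_region:
  fixes x :: "nat \<Rightarrow> 'a::euclidean_space"
  shows "(\<Sum>k = 1..n. measure lborel (new_region r N x j k)) = measure lborel {y. \<not> free r N x j n y}"
proof -
  let ?A = "\<Union>k\<in>{1..n}. new_region r N x j k" and ?B = "{y. \<not> free r N x j n y}"
  have sub: "new_region r N x j k \<subseteq> cball (x (j k)) r" for k
    by (subst new_region.simps) auto
  have fin: "emeasure lborel (new_region r N x j k) < \<infinity>" for k
    by (rule le_less_trans[OF emeasure_mono[OF sub] emeasure_bounded_finite[OF bounded_cball]]) simp
  have "measure lborel ?B = measure lborel ?A"
  proof -
    have B: "?B = ?A \<union> (?B - ?A)" using Union_new_region(1) by blast
    have "?B - ?A \<in> null_sets lborel"
      by (rule finite_imp_null_set_lborel) (use Union_new_region(2)[of r N x j n] finite_subset in blast)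
    from measure_Un_null_set[OF _ this, of ?A] show ?thesis
      by (subst B) auto
  qed
  also have "\<dots> = (\<Sum>k = 1..n. measure lborel (new_region r N x j k))"
    using fin by (intro measure_finite_Union[of "{1..n}"] new_region_disjoint) (auto simp: less_top)
  finally show ?thesis ..
qed

lemma not_free_subset:
  fixes x :: "nat \<Rightarrow> 'a::euclidean_space"
  assumes "\<And>l. l \<in> {1..n} \<Longrightarrow> x (j l) \<in> A"
  shows "{y. \<not> free r N x j n y} \<subseteq> (\<Union>a\<in>A. cball a r)"
  using assms
proof (induction n)
  case (Suc n)
  then have "{y. \<not> free r N x j n y} \<subseteq> (\<Union>a\<in>A. cball a r)" "x (j (Suc n)) \<in> A" by auto
  then show ?case by (auto simp: not_less dist_commute)
qed simp

section \<open>Exchanging a sample point with a fresh point\<close>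

definition free_volume ::
  "'a::euclidean_space measure \<Rightarrow> real \<Rightarrow> nat \<Rightarrow> (nat \<Rightarrow> 'a) \<Rightarrow> (nat \<Rightarrow> nat) \<Rightarrow> nat \<Rightarrow> real" where
  "free_volume \<mu> r N x j n = measure \<mu> {y. free r N x j n y}"

definition free_ball_volume ::
  "'a::euclidean_space measure \<Rightarrow> real \<Rightarrow> nat \<Rightarrow> (nat \<Rightarrow> 'a) \<Rightarrow> (nat \<Rightarrow> nat) \<Rightarrow> nat \<Rightarrow> 'a \<Rightarrow> real" where
  "free_ball_volume \<mu> r N x j n c = measure \<mu> {y. free r N x j n y \<and> dist y c \<le> r}"

text \<open>This is \<open>Q\<^sub>n\<close> of the overview, written as the iterated integral that
  remains when the fresh point has become the centre of the ball and is integrated out.\<close>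

definition free_pair_volume ::
  "'a::euclidean_space measure \<Rightarrow> real \<Rightarrow> nat \<Rightarrow> (nat \<Rightarrow> 'a) \<Rightarrow> (nat \<Rightarrow> nat) \<Rightarrow> nat \<Rightarrow> real" where
  "free_pair_volume \<mu> r N x j n =
     (\<integral>y. of_bool (free r N x j n y) * free_ball_volume \<mu> r N x j n y \<partial>\<mu>)"

definition free_neighbours ::
  "real \<Rightarrow> nat \<Rightarrow> (nat \<Rightarrow> 'a::euclidean_space) \<Rightarrow> (nat \<Rightarrow> nat) \<Rightarrow> nat \<Rightarrow> nat set" where
  "free_neighbours r N x j n =
     {k \<in> unexplored r N x j n. k \<noteq> j (Suc n) \<and> dist (x k) (x (j (Suc n))) \<le> r}"

abbreviation configs :: "nat \<Rightarrow> (nat \<Rightarrow> 'a::euclidean_space) measure" where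
  "configs N \<equiv> PiM {..<N} (\<lambda>_. borel)"

text \<open>The recursion of \<open>free\<close> tests whether unexplored points remain, which
  depends on the configuration. Expressing this test as the existence of a sample point that is
  itself free keeps the induction within a single predicate.\<close>

lemma free_measurable_pair:
  assumes "0 < r" "\<And>l. l \<in> {1..n} \<Longrightarrow> j l < N"
  shows "Measurable.pred ((configs N :: (nat \<Rightarrow> 'a::euclidean_space) measure) \<Otimes>\<^sub>M borel)
    (\<lambda>p. free r N (fst p) j n (snd p))"
  using assms(2)
proof (induction n)
  case (Suc n)
  let ?S = "configs N :: (nat \<Rightarrow> 'a) measure"
  have IH: "Measurable.pred (?S \<Otimes>\<^sub>M borel) (\<lambda>p. free r N (fst p) j n (snd p))" using Suc by auto
  have j: "j (Suc n) \<in> {..<N}" using Suc.prems[of "Suc n"] by simp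
  have U: "unexplored r N x j n \<noteq> {} \<longleftrightarrow> (\<exists>k\<in>{..<N}. free r N x j n (x k))" for x :: "nat \<Rightarrow> 'a"
    using mem_unexplored_iff_free[OF assms(1), of _ N x j n] by auto
  have "Measurable.pred (?S \<Otimes>\<^sub>M borel) (\<lambda>p. free r N (fst p) j n (fst p k))" if "k \<in> {..<N}" for k
    by (rule measurable_compose[OF _ IH, of "\<lambda>p. (fst p, fst p k)", simplified]) (use that in measurable)
  then have "Measurable.pred (?S \<Otimes>\<^sub>M borel) (\<lambda>p. \<exists>k\<in>{..<N}. free r N (fst p) j n (fst p k))"
    by (intro pred_intros_countable_bounded) auto
  then show ?case unfolding free.simps U using IH j by measurable
qed simp

lemma
  assumes "0 < r" "\<And>l. l \<in> {1..n} \<Longrightarrow> j l < N"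
  shows mem_unexplored_measurable:
      "Measurable.pred (configs N :: (nat \<Rightarrow> 'a::euclidean_space) measure) (\<lambda>x. k \<in> unexplored r N x j n)"
    and card_unexplored_measurable:
      "(\<lambda>x. real (card (unexplored r N x j n))) \<in> borel_measurable (configs N :: (nat \<Rightarrow> 'a) measure)"
proof -
  let ?S = "configs N :: (nat \<Rightarrow> 'a) measure"
  have *: "Measurable.pred ?S (\<lambda>x. k \<in> unexplored r N x j n)" for k
  proof (cases "k < N")
    case True
    then have "Measurable.pred ?S (\<lambda>x. free r N x j n (x k))"
      by (intro measurable_compose[OF _ free_measurable_pair[OF assms], of "\<lambda>x. (x, x k)", simplified]) measurable
    then show ?thesis using True unfolding mem_unexplored_iff_free[OF assms(1)] by simp
  qed (simp add: unexplored_def)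
  then show "Measurable.pred ?S (\<lambda>x. k \<in> unexplored r N x j n)" .
  have "real (card (unexplored r N x j n)) = (\<Sum>k<N. of_bool (k \<in> unexplored r N x j n))" for x :: "nat \<Rightarrow> 'a"
    using unexplored_subset[of r N x j n] by (simp add: sum.If_cases of_bool_def Int_absorb1)
  then show "(\<lambda>x. real (card (unexplored r N x j n))) \<in> borel_measurable ?S"
    using * by simp
qed

lemma choice_weight_measurable:
  assumes "0 < r" "\<And>l. l \<in> {1..n} \<Longrightarrow> j l < N"
  shows "(\<lambda>x. choice_weight r N x j n) \<in> borel_measurable (configs N :: (nat \<Rightarrow> 'a::euclidean_space) measure)"
  unfolding choice_weight_def
proof (rule borel_measurable_prod)
  fix l assume "l \<in> {..<n}"
  then have "\<And>l'. l' \<in> {1..l} \<Longrightarrow> j l' < N" using assms(2) by auto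
  note [measurable] = mem_unexplored_measurable[OF assms(1) this] card_unexplored_measurable[OF assms(1) this]
  show "(\<lambda>x. if j (Suc l) \<in> unexplored r N x j l then 1 / real (card (unexplored r N x j l)) else 0)
    \<in> borel_measurable (configs N :: (nat \<Rightarrow> 'a) measure)" by measurable
qed

text \<open>The exchange argument concerns i.i.d. points with an arbitrary law on the Borel sets;
  the uniform law on the cube is substituted later.\<close>

locale point_law = prob_space \<mu> for \<mu> :: "'a::euclidean_space measure" +
  assumes sets_eq [measurable_cong, simp]: "sets \<mu> = sets borel"
begin

lemma space_eq [simp]: "space \<mu> = UNIV"
  using sets_eq_imp_space_eq[OF sets_eq] by simp

lemma measure_Collect_measurable:
  assumes "Measurable.pred (S \<Otimes>\<^sub>M borel) (\<lambda>p. Q (fst p) (snd p))"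
  shows "(\<lambda>x. measure \<mu> {y. Q x y}) \<in> borel_measurable S"
proof -
  have "{p \<in> space (S \<Otimes>\<^sub>M \<mu>). snd p \<in> {y. Q (fst p) y}} \<in> sets (S \<Otimes>\<^sub>M \<mu>)"
    using assms by (simp add: pred_def sets_pair_measure_cong[OF refl sets_eq] space_pair_measure)
  then have "(\<lambda>x. emeasure \<mu> {y. Q x y}) \<in> borel_measurable S"
    by (intro measurable_emeasure) auto
  then show ?thesis unfolding measure_def by measurable
qed

lemma
  assumes "0 < r" "\<And>l. l \<in> {1..n} \<Longrightarrow> j l < N"
  shows free_volume_measurable:
      "(\<lambda>x. free_volume \<mu> r N x j n) \<in> borel_measurable (configs N)"
    and free_ball_volume_measurable:
      "(\<lambda>p. free_ball_volume \<mu> r N (fst p) j n (snd p)) \<in> borel_measurable (configs N \<Otimes>\<^sub>M borel)"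
    and free_pair_volume_measurable:
      "(\<lambda>x. free_pair_volume \<mu> r N x j n) \<in> borel_measurable (configs N)"
proof -
  let ?S = "configs N :: (nat \<Rightarrow> 'a) measure"
  note f [measurable] = free_measurable_pair[OF assms]
  show "(\<lambda>x. free_volume \<mu> r N x j n) \<in> borel_measurable ?S"
    unfolding free_volume_def by (rule measure_Collect_measurable) (rule f)
  have [measurable]: "Measurable.pred ((?S \<Otimes>\<^sub>M (borel :: 'a measure)) \<Otimes>\<^sub>M borel) (\<lambda>p. free r N (fst (fst p)) j n (snd p))"
    by (rule measurable_compose[OF _ f, of "\<lambda>p. (fst (fst p), snd p)", simplified]) measurable
  then show b: "(\<lambda>p. free_ball_volume \<mu> r N (fst p) j n (snd p)) \<in> borel_measurable (?S \<Otimes>\<^sub>M borel)"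
    unfolding free_ball_volume_def by (intro measure_Collect_measurable pred_intros_logic) measurable
  show "(\<lambda>x. free_pair_volume \<mu> r N x j n) \<in> borel_measurable ?S"
    unfolding free_pair_volume_def using f b
    by (intro borel_measurable_lebesgue_integral) (simp add: case_prod_beta', measurable)
qed

lemma free_ball_volume_bounds: "0 \<le> free_ball_volume \<mu> r N x j n c" "free_ball_volume \<mu> r N x j n c \<le> 1"
  by (simp_all add: free_ball_volume_def)

lemma free_volume_bounds: "0 \<le> free_volume \<mu> r N x j n" "free_volume \<mu> r N x j n \<le> 1"
  by (simp_all add: free_volume_def)

abbreviation sample :: "nat \<Rightarrow> (nat \<Rightarrow> 'a) measure" where
  "sample N \<equiv> PiM {..<N} (\<lambda>_. \<mu>)"

lemma sets_sample [measurable_cong]: "sets (sample N) = sets (configs N)"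
  by (intro sets_PiM_cong) auto

lemma prob_space_sample: "prob_space (sample N)"
  by (intro prob_space_PiM) unfold_locales

lemma fun_upd_in_sample [measurable]:
  "k < N \<Longrightarrow> (\<lambda>p. (fst p)(k := snd p)) \<in> measurable (sample N \<Otimes>\<^sub>M \<mu>) (sample N)"
  using measurable_fun_upd[of "{..<N}" "{..<N}" k fst "sample N \<Otimes>\<^sub>M \<mu>" "\<lambda>_. \<mu>" snd]
  by (auto simp: insert_absorb)

text \<open>Coordinate \<open>k\<close> and the fresh point are independent with the same law. After
  all other coordinates are fixed, swapping them is an interchange of two integrals over
  \<open>\<mu>\<close>.\<close>

lemma distr_exchange:
  assumes k: "k < N"
  shows "distr (sample N \<Otimes>\<^sub>M \<mu>) (sample N \<Otimes>\<^sub>M \<mu>) (\<lambda>p. ((fst p)(k := snd p), fst p k)) = sample N \<Otimes>\<^sub>M \<mu>"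
    (is "distr ?P ?P ?T = _")
proof (rule measure_eqI)
  interpret prod: product_sigma_finite "\<lambda>_::nat. \<mu>" by unfold_locales
  have k': "k \<in> {..<N}" using k by simp
  have T [measurable]: "?T \<in> measurable ?P ?P" using k k' by measurable
  fix A assume "A \<in> sets (distr ?P ?P ?T)"
  then have A [measurable]: "A \<in> sets ?P" by simp
  define I where "I = {..<N} - {k}"
  have I: "finite I" "k \<notin> I" "insert k I = {..<N}" using k by (auto simp: I_def)
  have [measurable]: "(\<lambda>p. (fst p)(k := snd p)) \<in> measurable (PiM I (\<lambda>_. \<mu>) \<Otimes>\<^sub>M \<mu>) (sample N)"
    using measurable_fun_upd[of "{..<N}" I k fst "PiM I (\<lambda>_. \<mu>) \<Otimes>\<^sub>M \<mu>" "\<lambda>_. \<mu>" snd] I by auto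
  interpret sI: prob_space "PiM I (\<lambda>_. \<mu>)" by (intro prob_space_PiM) unfold_locales
  interpret pp: pair_sigma_finite \<mu> \<mu> by unfold_locales
  have split: "(\<integral>\<^sup>+p. f p \<partial>?P) = (\<integral>\<^sup>+x. \<integral>\<^sup>+y'. \<integral>\<^sup>+y. f (x(k := y'), y) \<partial>\<mu> \<partial>\<mu> \<partial>PiM I (\<lambda>_. \<mu>))"
    if [measurable]: "f \<in> borel_measurable ?P" for f
  proof -
    have "(\<integral>\<^sup>+p. f p \<partial>?P) = (\<integral>\<^sup>+x. \<integral>\<^sup>+y. f (x, y) \<partial>\<mu> \<partial>sample N)"
      by (rule nn_integral_fst[symmetric]) measurable
    also have "\<dots> = (\<integral>\<^sup>+x. \<integral>\<^sup>+y'. \<integral>\<^sup>+y. f (x(k := y'), y) \<partial>\<mu> \<partial>\<mu> \<partial>PiM I (\<lambda>_. \<mu>))"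
      unfolding I(3)[symmetric] by (rule prod.product_nn_integral_insert) (use I in \<open>auto simp: I(3)\<close>)
    finally show ?thesis .
  qed
  have mT: "(\<lambda>p. indicator A (?T p) :: ennreal) \<in> borel_measurable ?P"
    using T A by measurable
  have "emeasure (distr ?P ?P ?T) A = (\<integral>\<^sup>+p. indicator A p \<partial>distr ?P ?P ?T)"
    using A by (intro nn_integral_indicator[symmetric]) (simp only: sets_distr)
  also have "\<dots> = (\<integral>\<^sup>+p. indicator A (?T p) \<partial>?P)"
    by (rule nn_integral_distr) measurable
  also have "\<dots> = (\<integral>\<^sup>+x. \<integral>\<^sup>+y'. \<integral>\<^sup>+y. indicator A (x(k := y), y') \<partial>\<mu> \<partial>\<mu> \<partial>PiM I (\<lambda>_. \<mu>))"
    by (subst split[OF mT]) simp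
  also have "\<dots> = (\<integral>\<^sup>+x. \<integral>\<^sup>+y. \<integral>\<^sup>+y'. indicator A (x(k := y), y') \<partial>\<mu> \<partial>\<mu> \<partial>PiM I (\<lambda>_. \<mu>))"
  proof (rule nn_integral_cong)
    fix x assume x [measurable]: "x \<in> space (PiM I (\<lambda>_. \<mu>))"
    have "(\<lambda>p. ((fst (x, snd p))(k := snd (x, snd p)), fst p)) \<in> measurable (\<mu> \<Otimes>\<^sub>M \<mu>) ?P"
      by (rule measurable_Pair, rule measurable_compose[of "\<lambda>p. (x, snd p)" _ "PiM I (\<lambda>_. \<mu>) \<Otimes>\<^sub>M \<mu>"]) (use x in measurable)
    then have "(\<lambda>(y', y). indicator A (x(k := y), y') :: ennreal) \<in> borel_measurable (\<mu> \<Otimes>\<^sub>M \<mu>)"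
      by (auto simp: case_prod_beta')
    then show "(\<integral>\<^sup>+y'. \<integral>\<^sup>+y. indicator A (x(k := y), y') \<partial>\<mu> \<partial>\<mu>) = (\<integral>\<^sup>+y. \<integral>\<^sup>+y'. indicator A (x(k := y), y') \<partial>\<mu> \<partial>\<mu>)"
      by (rule pp.Fubini'[symmetric])
  qed
  also have "\<dots> = emeasure ?P A"
    using A by (subst split[symmetric]) (simp_all add: borel_measurable_indicator nn_integral_indicator)
  finally show "emeasure (distr ?P ?P ?T) A = emeasure ?P A" .
qed simp

lemma integral_exchange:
  fixes f :: "(nat \<Rightarrow> 'a) \<Rightarrow> 'a \<Rightarrow> real"
  assumes "k < N" and [measurable]: "(\<lambda>p. f (fst p) (snd p)) \<in> borel_measurable (sample N \<Otimes>\<^sub>M \<mu>)"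
  shows "(\<integral>p. f ((fst p)(k := snd p)) (fst p k) \<partial>(sample N \<Otimes>\<^sub>M \<mu>)) = (\<integral>p. f (fst p) (snd p) \<partial>(sample N \<Otimes>\<^sub>M \<mu>))"
proof -
  have k: "k \<in> {..<N}" using assms(1) by simp
  have [measurable]: "(\<lambda>p. ((fst p)(k := snd p), fst p k)) \<in> measurable (sample N \<Otimes>\<^sub>M \<mu>) (sample N \<Otimes>\<^sub>M \<mu>)"
    using assms(1) k by measurable
  show ?thesis
    by (subst distr_exchange[OF assms(1), symmetric], subst integral_distr) auto
qed

end

text \<open>\<open>H\<close> weights a sequence of choices by the event that both point
  \<open>k\<close> and the fresh point \<open>y\<close> are uncovered. On this event the swap leaves
  the exploration unchanged. Off it both sides vanish: if both points were uncovered after the swap,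
  swapping back would show that they were uncovered before.\<close>

lemma exchange_weight:
  fixes x :: "nat \<Rightarrow> 'a::euclidean_space" and r :: real and N n k :: nat and j :: "nat \<Rightarrow> nat"
  assumes r: "0 < r"
  defines "H \<equiv> \<lambda>x y. choice_weight r N x j (Suc n) * (of_bool (free r N x j n (x k)) * of_bool (free r N x j n y))"
  shows "H (x(k := y)) (x k) = H x y"
    and "H x y \<noteq> 0 \<Longrightarrow> free r N (x(k := y)) j n = free r N x j n"
proof -
  have inv: "choice_weight r N (x(k := y)) j (Suc n) = choice_weight r N x j (Suc n)"
    "free r N (x(k := y)) j n = free r N x j n"
    if "free r N x j n (x k)" "free r N x j n y" for x y
    using choice_weight_fun_upd[OF r that order_refl] exploration_fun_upd[OF r that order_refl] by auto
  show "H (x(k := y)) (x k) = H x y"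
  proof (cases "free r N x j n (x k) \<and> free r N x j n y")
    case True
    then show ?thesis using inv[of x y] by (simp add: H_def)
  next
    case False
    define x' where "x' = x(k := y)"
    have "x'(k := x k) = x" by (simp add: x'_def)
    then have "\<not> (free r N x' j n (x' k) \<and> free r N x' j n (x k))"
      using inv(2)[of x' "x k"] False by (auto simp: x'_def)
    then show ?thesis using False by (simp only: H_def x'_def) auto
  qed
  show "H x y \<noteq> 0 \<Longrightarrow> free r N (x(k := y)) j n = free r N x j n"
    using inv(2)[of x y] by (auto simp: H_def)
qed

section \<open>Lost volume and lost points for a fixed sequence of choices\<close>

context point_law
begin

lemma integrable_bounded_sample:
  fixes f :: "(nat \<Rightarrow> 'a) \<times> 'a \<Rightarrow> real"
  assumes "f \<in> borel_measurable (sample N \<Otimes>\<^sub>M \<mu>)" "\<And>p. \<bar>f p\<bar> \<le> B"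
  shows "integrable (sample N \<Otimes>\<^sub>M \<mu>) f"
proof -
  interpret S: prob_space "sample N" by (rule prob_space_sample)
  interpret P: pair_prob_space "sample N" \<mu> by unfold_locales
  show ?thesis using assms by (intro P.integrable_const_bound[where B=B]) auto
qed

lemma integral_pair_sample:
  fixes f :: "(nat \<Rightarrow> 'a) \<Rightarrow> 'a \<Rightarrow> real"
  assumes "(\<lambda>p. f (fst p) (snd p)) \<in> borel_measurable (sample N \<Otimes>\<^sub>M \<mu>)" "\<And>x y. \<bar>f x y\<bar> \<le> B"
  shows "(\<integral>x. \<integral>y. f x y \<partial>\<mu> \<partial>sample N) = (\<integral>p. f (fst p) (snd p) \<partial>(sample N \<Otimes>\<^sub>M \<mu>))"
proof -
  interpret S: prob_space "sample N" by (rule prob_space_sample)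
  interpret P: pair_prob_space "sample N" \<mu> by unfold_locales
  show ?thesis using P.integral_fst'[OF integrable_bounded_sample[OF assms(1), of B]] assms(2) by simp
qed

lemma integral_of_bool: "Measurable.pred borel Q \<Longrightarrow> (\<integral>y. of_bool (Q y) \<partial>\<mu>) = measure \<mu> {y. Q y}"
proof -
  assume "Measurable.pred borel Q"
  have "(\<integral>y. of_bool (Q y) \<partial>\<mu>) = (\<integral>y. indicator {y. Q y} y \<partial>\<mu>)"
    by (simp add: indicator_def)
  also have "\<dots> = measure \<mu> {y. Q y}"
    using \<open>Measurable.pred borel Q\<close> by (subst Bochner_Integration.integral_indicator) (auto simp: pred_def)
  finally show ?thesis .
qed

text \<open>The factor \<open>free_volume\<close> is the probability that a fresh point is
  uncovered. Swapping that point with the chosen one makes the fresh point the centre of the ball,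
  and integrating it out gives the pair volume.\<close>

lemma expected_free_ball_volume:
  assumes r: "0 < r" and j: "\<And>l. l \<in> {1..Suc n} \<Longrightarrow> j l < N"
  shows "(\<integral>x. choice_weight r N x j (Suc n) * (free_volume \<mu> r N x j n * free_ball_volume \<mu> r N x j n (x (j (Suc n)))) \<partial>sample N)
    = (\<integral>x. choice_weight r N x j (Suc n) * free_pair_volume \<mu> r N x j n \<partial>sample N)"
proof -
  define k where "k = j (Suc n)"
  have k: "k < N" "k \<in> {..<N}" using j[of "Suc n"] by (auto simp: k_def)
  have j': "\<And>l. l \<in> {1..n} \<Longrightarrow> j l < N" using j by auto
  define H where "H x y = choice_weight r N x j (Suc n) * (of_bool (free r N x j n (x k)) * of_bool (free r N x j n y))" for x :: "nat \<Rightarrow> 'a" and y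
  \<comment> \<open>A nonzero weight forces the chosen point to be unexplored. The indicator that it
    is uncovered can thus be inserted for free, which produces the symmetric
    \<open>H\<close>.\<close>
  have w: "choice_weight r N x j (Suc n) = choice_weight r N x j (Suc n) * of_bool (free r N x j n (x k))" for x :: "nat \<Rightarrow> 'a"
    using choice_weight_nonzeroD[of r N x j "Suc n" n] mem_unexplored_iff_free[OF r, of k N x j n] by (auto simp: k_def)
  have H': "H x y = choice_weight r N x j (Suc n) * of_bool (free r N x j n y)" for x y
    unfolding H_def using w[of x] by auto
  have Hb: "0 \<le> H x y" "H x y \<le> 1" for x y
    using choice_weight_nonneg[of r N x j "Suc n"] choice_weight_le_1[of r N x j "Suc n"] by (auto simp: H')
  note [measurable] = free_measurable_pair[OF r j'] choice_weight_measurable[OF r j]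
    free_ball_volume_measurable[OF r j']
  have [measurable]: "(\<lambda>p. free_ball_volume \<mu> r N (fst p) j n (fst p k)) \<in> borel_measurable (sample N \<Otimes>\<^sub>M \<mu>)"
    by (rule measurable_compose[OF _ free_ball_volume_measurable[OF r j'], of "\<lambda>p. (fst p, fst p k)", simplified])
       (use k in measurable)
  have [measurable]: "(\<lambda>p. H (fst p) (snd p)) \<in> borel_measurable (sample N \<Otimes>\<^sub>M \<mu>)"
    unfolding H' by measurable
  have bound: "\<bar>H x y * free_ball_volume \<mu> r N x j n c\<bar> \<le> 1" for x y c
    using Hb[of x y] free_ball_volume_bounds[of r N x j n c] by (simp add: abs_mult mult_le_one)
  have "(\<integral>x. choice_weight r N x j (Suc n) * (free_volume \<mu> r N x j n * free_ball_volume \<mu> r N x j n (x k)) \<partial>sample N)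
    = (\<integral>x. \<integral>y. H x y * free_ball_volume \<mu> r N x j n (x k) \<partial>\<mu> \<partial>sample N)"
    by (simp add: H' free_volume_def mult.assoc flip: integral_of_bool)
  also have "\<dots> = (\<integral>p. H (fst p) (snd p) * free_ball_volume \<mu> r N (fst p) j n (fst p k) \<partial>(sample N \<Otimes>\<^sub>M \<mu>))"
    by (rule integral_pair_sample[OF _ bound]) measurable
  also have "\<dots> = (\<integral>p. H ((fst p)(k := snd p)) (fst p k) * free_ball_volume \<mu> r N ((fst p)(k := snd p)) j n (((fst p)(k := snd p)) k) \<partial>(sample N \<Otimes>\<^sub>M \<mu>))"
    by (rule integral_exchange[OF k(1), symmetric]) measurable
  also have "\<dots> = (\<integral>p. H (fst p) (snd p) * free_ball_volume \<mu> r N (fst p) j n (snd p) \<partial>(sample N \<Otimes>\<^sub>M \<mu>))"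
  proof (rule Bochner_Integration.integral_cong[OF refl])
    fix p :: "(nat \<Rightarrow> 'a) \<times> 'a"
    show "H ((fst p)(k := snd p)) (fst p k) * free_ball_volume \<mu> r N ((fst p)(k := snd p)) j n (((fst p)(k := snd p)) k) =
      H (fst p) (snd p) * free_ball_volume \<mu> r N (fst p) j n (snd p)"
      using exchange_weight[OF r, where x="fst p" and y="snd p" and N=N and n=n and k=k and j=j]
      by (cases "H (fst p) (snd p) = 0") (simp_all add: H_def free_ball_volume_def)
  qed
  also have "\<dots> = (\<integral>x. \<integral>y. H x y * free_ball_volume \<mu> r N x j n y \<partial>\<mu> \<partial>sample N)"
    by (rule integral_pair_sample[OF _ bound, symmetric]) measurable
  also have "\<dots> = (\<integral>x. choice_weight r N x j (Suc n) * free_pair_volume \<mu> r N x j n \<partial>sample N)"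
    by (simp add: H' free_pair_volume_def mult.assoc)
  finally show ?thesis by (simp add: k_def)
qed

text \<open>Now a point \<open>k\<close> other than the chosen one is swapped with the fresh point.
  The centre of the ball stays in place because \<open>k\<close> differs from it, and the event that
  \<open>k\<close> lies in the ball becomes the event that the fresh point does.\<close>

lemma expected_free_neighbour:
  assumes r: "0 < r" and j: "\<And>l. l \<in> {1..Suc n} \<Longrightarrow> j l < N" and k: "k < N" "k \<noteq> j (Suc n)"
  shows "(\<integral>x. choice_weight r N x j (Suc n) * (free_volume \<mu> r N x j n * of_bool (k \<in> free_neighbours r N x j n)) \<partial>sample N)
    = (\<integral>x. choice_weight r N x j (Suc n) * (of_bool (k \<in> unexplored r N x j n) * free_ball_volume \<mu> r N x j n (x (j (Suc n)))) \<partial>sample N)"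
proof -
  define c where "c = j (Suc n)"
  have c: "c \<in> {..<N}" "k \<in> {..<N}" "k \<noteq> c" using j[of "Suc n"] k by (auto simp: c_def)
  have j': "\<And>l. l \<in> {1..n} \<Longrightarrow> j l < N" using j by auto
  define H where "H x y = choice_weight r N x j (Suc n) * (of_bool (free r N x j n (x k)) * of_bool (free r N x j n y))" for x :: "nat \<Rightarrow> 'a" and y
  have Hb: "0 \<le> H x y" "H x y \<le> 1" for x y
    using choice_weight_nonneg[of r N x j "Suc n"] choice_weight_le_1[of r N x j "Suc n"] by (auto simp: H_def)
  note [measurable] = free_measurable_pair[OF r j'] choice_weight_measurable[OF r j]
    mem_unexplored_measurable[OF r j']
  have [measurable]: "Measurable.pred (sample N \<Otimes>\<^sub>M \<mu>) (\<lambda>p. free r N (fst p) j n (fst p k))"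
    by (rule measurable_compose[OF _ free_measurable_pair[OF r j'], of "\<lambda>p. (fst p, fst p k)", simplified])
       (use c in measurable)
  have [measurable]: "(\<lambda>p. H (fst p) (snd p)) \<in> borel_measurable (sample N \<Otimes>\<^sub>M \<mu>)"
    unfolding H_def by measurable
  have [measurable]: "Measurable.pred (sample N \<Otimes>\<^sub>M \<mu>) (\<lambda>p. dist (fst p k) (fst p c) \<le> r)"
    "Measurable.pred (sample N \<Otimes>\<^sub>M \<mu>) (\<lambda>p. dist (snd p) (fst p c) \<le> r)" using c by measurable
  have bound: "\<bar>H x y * of_bool Q\<bar> \<le> 1" for x y Q
    using Hb[of x y] by auto
  have "(\<integral>x. choice_weight r N x j (Suc n) * (free_volume \<mu> r N x j n * of_bool (k \<in> free_neighbours r N x j n)) \<partial>sample N)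
    = (\<integral>x. \<integral>y. H x y * of_bool (dist (x k) (x c) \<le> r) \<partial>\<mu> \<partial>sample N)"
    using k by (intro Bochner_Integration.integral_cong refl)
      (auto simp: H_def free_volume_def free_neighbours_def c_def mem_unexplored_iff_free[OF r] simp flip: integral_of_bool)
  also have "\<dots> = (\<integral>p. H (fst p) (snd p) * of_bool (dist (fst p k) (fst p c) \<le> r) \<partial>(sample N \<Otimes>\<^sub>M \<mu>))"
    by (rule integral_pair_sample[OF _ bound]) measurable
  also have "\<dots> = (\<integral>p. H ((fst p)(k := snd p)) (fst p k) * of_bool (dist (((fst p)(k := snd p)) k) (((fst p)(k := snd p)) c) \<le> r) \<partial>(sample N \<Otimes>\<^sub>M \<mu>))"
    by (rule integral_exchange[OF k(1), symmetric]) measurable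
  also have "\<dots> = (\<integral>p. H (fst p) (snd p) * of_bool (dist (snd p) (fst p c) \<le> r) \<partial>(sample N \<Otimes>\<^sub>M \<mu>))"
  proof (rule Bochner_Integration.integral_cong[OF refl])
    fix p :: "(nat \<Rightarrow> 'a) \<times> 'a"
    have "H ((fst p)(k := snd p)) (fst p k) = H (fst p) (snd p)"
      unfolding H_def by (rule exchange_weight(1)[OF r])
    then show "H ((fst p)(k := snd p)) (fst p k) * of_bool (dist (((fst p)(k := snd p)) k) (((fst p)(k := snd p)) c) \<le> r)
      = H (fst p) (snd p) * of_bool (dist (snd p) (fst p c) \<le> r)"
      using c(3) by (simp only: fun_upd_same fun_upd_other[OF c(3)[symmetric]])
  qed
  also have "\<dots> = (\<integral>x. \<integral>y. H x y * of_bool (dist y (x c) \<le> r) \<partial>\<mu> \<partial>sample N)"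
    by (rule integral_pair_sample[OF _ bound, symmetric]) measurable
  also have "\<dots> = (\<integral>x. choice_weight r N x j (Suc n) * (of_bool (k \<in> unexplored r N x j n) * free_ball_volume \<mu> r N x j n (x c)) \<partial>sample N)"
    using k by (intro Bochner_Integration.integral_cong refl)
      (auto simp: H_def free_ball_volume_def mem_unexplored_iff_free[OF r] mult.assoc of_bool_conj simp flip: integral_of_bool)
  finally show ?thesis by (simp add: c_def)
qed

lemma expected_free_neighbours:
  assumes r: "0 < r" and j: "\<And>l. l \<in> {1..Suc n} \<Longrightarrow> j l < N"
  shows "(\<integral>x. choice_weight r N x j (Suc n) * (free_volume \<mu> r N x j n * real (card (free_neighbours r N x j n))) \<partial>sample N)
    = (\<integral>x. choice_weight r N x j (Suc n) * ((real (card (unexplored r N x j n)) - 1) * free_ball_volume \<mu> r N x j n (x (j (Suc n)))) \<partial>sample N)"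
proof -
  interpret S: prob_space "sample N" by (rule prob_space_sample)
  define K where "K = {..<N} - {j (Suc n)}"
  have j': "\<And>l. l \<in> {1..n} \<Longrightarrow> j l < N" and c: "j (Suc n) \<in> {..<N}" using j by auto
  note [measurable] = choice_weight_measurable[OF r j]
    mem_unexplored_measurable[OF r j'] free_volume_measurable[OF r j']
  have [measurable]: "(\<lambda>x. free_ball_volume \<mu> r N x j n (x (j (Suc n)))) \<in> borel_measurable (sample N)"
    by (rule measurable_compose[OF _ free_ball_volume_measurable[OF r j'], of "\<lambda>x. (x, x (j (Suc n)))", simplified])
       (use c in measurable)
  have bound: "integrable (sample N) (\<lambda>x. choice_weight r N x j (Suc n) * g x)"
    if "g \<in> borel_measurable (sample N)" "\<And>x. 0 \<le> g x" "\<And>x. g x \<le> 1" for g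
  proof (rule S.integrable_const_bound[where B=1])
    have "\<bar>choice_weight r N x j (Suc n) * g x\<bar> \<le> 1" for x
      using that(2,3)[of x] choice_weight_nonneg[of r N x j "Suc n"] choice_weight_le_1[of r N x j "Suc n"]
      by (simp add: abs_mult mult_le_one)
    then show "AE x in sample N. norm (choice_weight r N x j (Suc n) * g x) \<le> 1" by simp
    show "(\<lambda>x. choice_weight r N x j (Suc n) * g x) \<in> borel_measurable (sample N)"
      using that(1) by measurable
  qed
  have nb: "real (card (free_neighbours r N x j n)) = (\<Sum>k\<in>K. of_bool (k \<in> free_neighbours r N x j n))" for x :: "nat \<Rightarrow> 'a"
  proof -
    have "free_neighbours r N x j n \<subseteq> K" using unexplored_subset[of r N x j n] by (auto simp: free_neighbours_def K_def)
    then show ?thesis by (simp add: sum.If_cases of_bool_def Int_absorb1 K_def)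
  qed
  \<comment> \<open>A nonzero weight puts the chosen index among the unexplored ones; leaving it out
    of the sum over \<open>K\<close> accounts for the \<open>- 1\<close>.\<close>
  have ub: "choice_weight r N x j (Suc n) * (real (card (unexplored r N x j n)) - 1)
     = choice_weight r N x j (Suc n) * (\<Sum>k\<in>K. of_bool (k \<in> unexplored r N x j n))" for x :: "nat \<Rightarrow> 'a"
  proof (cases "choice_weight r N x j (Suc n) = 0")
    case False
    have in_U: "j (Suc n) \<in> unexplored r N x j n" using choice_weight_nonzeroD[OF False, of n] by simp
    have "K \<inter> unexplored r N x j n = unexplored r N x j n - {j (Suc n)}"
      using unexplored_subset[of r N x j n] by (auto simp: K_def)
    moreover have "1 \<le> card (unexplored r N x j n)" using in_U by (simp add: Suc_le_eq card_gt_0_iff) blast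
    moreover have "(\<Sum>k\<in>K. of_bool (k \<in> unexplored r N x j n)) = real (card (K \<inter> unexplored r N x j n))"
      by (simp add: K_def)
    ultimately show ?thesis using in_U by (simp add: of_nat_diff)
  qed simp
  have nbm [measurable]: "Measurable.pred (sample N) (\<lambda>x. k \<in> free_neighbours r N x j n)" if "k \<in> K" for k
  proof -
    have "k \<in> {..<N}" using that by (simp add: K_def)
    then show ?thesis unfolding free_neighbours_def using c by simp
  qed
  have "(\<integral>x. choice_weight r N x j (Suc n) * (free_volume \<mu> r N x j n * real (card (free_neighbours r N x j n))) \<partial>sample N)
    = (\<Sum>k\<in>K. \<integral>x. choice_weight r N x j (Suc n) * (free_volume \<mu> r N x j n * of_bool (k \<in> free_neighbours r N x j n)) \<partial>sample N)"
    unfolding nb sum_distrib_left using free_volume_bounds nbm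
    by (intro Bochner_Integration.integral_sum bound) (auto simp: mult_le_one)
  also have "\<dots> = (\<Sum>k\<in>K. \<integral>x. choice_weight r N x j (Suc n) * (of_bool (k \<in> unexplored r N x j n) * free_ball_volume \<mu> r N x j n (x (j (Suc n)))) \<partial>sample N)"
    by (intro sum.cong refl expected_free_neighbour r j) (auto simp: K_def)
  also have "\<dots> = (\<integral>x. (\<Sum>k\<in>K. choice_weight r N x j (Suc n) * (of_bool (k \<in> unexplored r N x j n) * free_ball_volume \<mu> r N x j n (x (j (Suc n))))) \<partial>sample N)"
    using free_ball_volume_bounds
    by (intro Bochner_Integration.integral_sum[symmetric] bound) (auto simp: mult_le_one)
  also have "\<dots> = (\<integral>x. choice_weight r N x j (Suc n) * ((real (card (unexplored r N x j n)) - 1) * free_ball_volume \<mu> r N x j n (x (j (Suc n)))) \<partial>sample N)"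
    unfolding mult.assoc[symmetric] ub by (simp add: sum_distrib_left sum_distrib_right mult.assoc)
  finally show ?thesis .
qed

end

section \<open>The law of the choices\<close>

context rsa_exploration
begin

abbreviation law :: "nat \<Rightarrow> 'a measure" where
  "law N \<equiv> uniform_measure lborel (C N)"

abbreviation sampled :: "nat \<Rightarrow> (nat \<Rightarrow> 'a) measure" where
  "sampled N \<equiv> PiM {..<N} (\<lambda>_. law N)"

definition pos :: "nat \<Rightarrow> 'w \<Rightarrow> nat \<Rightarrow> 'a" where
  "pos N w = (\<lambda>i\<in>{..<N}. X N i w)"

definition cho :: "nat \<Rightarrow> 'w \<Rightarrow> nat \<Rightarrow> nat" where
  "cho N w = (\<lambda>k. J N k w)"

abbreviation unex :: "nat \<Rightarrow> nat \<Rightarrow> 'w \<Rightarrow> nat set" where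
  "unex N n w \<equiv> unexplored r N (pos N w) (cho N w) n"

lemma emeasure_cube: "0 < N \<Longrightarrow> emeasure lborel (C N) = ennreal (real N / lam)"
proof -
  assume N: "0 < N"
  have "emeasure lborel (C N) < \<infinity>"
    using cube[OF N] emeasure_bounded_finite[OF bounded_cbox] by (auto simp: is_cube_def)
  then show ?thesis using volume[OF N] by (simp add: emeasure_eq_ennreal_measure)
qed

lemma cube_borel: "0 < N \<Longrightarrow> C N \<in> sets borel"
  using cube[of N] by (auto simp: is_cube_def)

lemma point_law_law: "0 < N \<Longrightarrow> point_law (law N)"
proof -
  assume N: "0 < N"
  then have "emeasure lborel (C N) \<noteq> 0" "emeasure lborel (C N) \<noteq> \<infinity>"
    using emeasure_cube[OF N] lam_pos by auto
  then show ?thesis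
    by (simp add: point_law_def point_law_axioms_def prob_space_uniform_measure)
qed

lemma X_measurable: "k < N \<Longrightarrow> X N k \<in> borel_measurable M"
  using points_indep[of N] by (cases "N = 0") (auto simp: indep_vars_def)

lemma pos_measurable [measurable]: "0 < N \<Longrightarrow> pos N \<in> measurable M (configs N)"
  unfolding pos_def using X_measurable by (intro measurable_restrict) auto

lemma cho_less: "0 < N \<Longrightarrow> w \<in> space M \<Longrightarrow> 0 < l \<Longrightarrow> cho N w l < N"
  using measurable_space[OF choice_measurable[of N l]] by (auto simp: cho_def)

lemma unexplored_pos_cho:
  assumes "0 < N" "w \<in> space M"
  shows "unexplored r N (\<lambda>k. X N k w) (\<lambda>k. J N k w) n = unex N n w"
  using cho_less[OF assms]
  by (intro unexplored_cong) (auto simp: pos_def cho_def)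

lemma expectation_pos:
  fixes f :: "(nat \<Rightarrow> 'a) \<Rightarrow> real"
  assumes "0 < N" "f \<in> borel_measurable (configs N)"
  shows "expectation (\<lambda>w. f (pos N w)) = (\<integral>x. f x \<partial>sampled N)"
proof -
  have "distr M (configs N) (pos N) = PiM {..<N} (\<lambda>i. distr M borel (X N i))"
    using points_indep[OF assms(1)] assms(1) X_measurable unfolding pos_def
    by (subst (asm) indep_vars_iff_distr_eq_PiM') auto
  also have "\<dots> = sampled N"
    using points_uniform by (intro PiM_cong) auto
  finally show ?thesis
    using integral_distr[OF pos_measurable[OF assms(1)] assms(2)] by simp
qed

lemma
  assumes N: "0 < N"
  shows subalgebra_history: "subalgebra M (history M N (X N) (J N) n)"
    and pos_measurable_history: "pos N \<in> measurable (history M N (X N) (J N) n) (configs N)"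
    and J_measurable_history: "\<And>l. l \<in> {1..n} \<Longrightarrow> J N l \<in> measurable (history M N (X N) (J N) n) (count_space {..<N})"
proof -
  let ?S = "(configs N :: (nat \<Rightarrow> 'a) measure) \<Otimes>\<^sub>M PiM {1..n} (\<lambda>_. count_space {..<N})"
  define h where "h w = (\<lambda>i\<in>{..<N}. X N i w, \<lambda>k\<in>{1..n}. J N k w)" for w
  have H: "history M N (X N) (J N) n = vimage_algebra (space M) h ?S"
    by (simp add: history_def h_def[abs_def])
  have hM: "h \<in> measurable M ?S"
    unfolding h_def using X_measurable choice_measurable[OF N]
    by (intro measurable_Pair measurable_restrict) auto
  have hH: "h \<in> measurable (history M N (X N) (J N) n) ?S"
    unfolding H by (rule measurable_vimage_algebra1) (use measurable_space[OF hM] in auto)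
  show "subalgebra M (history M N (X N) (J N) n)"
    unfolding subalgebra_def H using measurable_sets[OF hM] measurable_space[OF hM]
    by (auto simp: sets_vimage_algebra2)
  have "(\<lambda>w. fst (h w)) \<in> measurable (history M N (X N) (J N) n) (configs N)"
    using hH by measurable
  then show "pos N \<in> measurable (history M N (X N) (J N) n) (configs N)"
    by (simp add: h_def pos_def[abs_def])
  fix l assume l: "l \<in> {1..n}"
  have "(\<lambda>w. snd (h w) l) \<in> measurable (history M N (X N) (J N) n) (count_space {..<N})"
    using hH l by measurable
  then show "J N l \<in> measurable (history M N (X N) (J N) n) (count_space {..<N})"
    using l by (simp add: h_def)
qed

text \<open>The indicator that the first \<open>n\<close> choices are those of \<open>i\<close> and
  that unexplored points remained before each of them. The unexplored sets are computed from the
  fixed sequence \<open>i\<close>, which agrees with the actual choices as long as the preceding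
  factors are nonzero; so every factor depends on the positions and on one choice only.\<close>

definition follows :: "nat \<Rightarrow> (nat \<Rightarrow> nat) \<Rightarrow> nat \<Rightarrow> 'w \<Rightarrow> real" where
  "follows N i n w = (\<Prod>l<n. of_bool (J N (Suc l) w = i (Suc l) \<and> unexplored r N (pos N w) i l \<noteq> {}))"

lemma follows_eq: "follows N i n w =
    of_bool (\<forall>l<n. J N (Suc l) w = i (Suc l) \<and> unexplored r N (pos N w) i l \<noteq> {})"
  unfolding follows_def by (induction n) (auto simp: less_Suc_eq)

lemma unexplored_nonempty_measurable:
  assumes "\<And>l. l \<in> {1..n} \<Longrightarrow> i l < N"
  shows "Measurable.pred (configs N :: (nat \<Rightarrow> 'a) measure) (\<lambda>x. unexplored r N x i n \<noteq> {})"
proof -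
  have m: "(\<lambda>x. real (card (unexplored r N x i n))) \<in> borel_measurable (configs N :: (nat \<Rightarrow> 'a) measure)"
    using card_unexplored_measurable[OF r_pos, of n i N] assms by simp
  have e: "(\<lambda>x. unexplored r N x i n \<noteq> {}) = (\<lambda>x :: nat \<Rightarrow> 'a. real (card (unexplored r N x i n)) \<noteq> 0)"
    by simp
  show ?thesis unfolding e using m by measurable
qed

lemma follows_measurable:
  assumes N: "0 < N" and i: "\<And>l. l \<in> {1..n} \<Longrightarrow> i l < N"
  shows "follows N i n \<in> borel_measurable (history M N (X N) (J N) n)"
  unfolding follows_def[abs_def]
proof (rule borel_measurable_prod)
  let ?H = "history M N (X N) (J N) n"
  fix l assume l: "l \<in> {..<n}"
  have J: "J N (Suc l) \<in> measurable ?H (count_space {..<N})"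
    using J_measurable_history[OF N, of "Suc l" n] l by auto
  have "Measurable.pred ?H (\<lambda>w. J N (Suc l) w = i (Suc l))"
    by (rule measurable_compose[OF J]) simp
  moreover have "Measurable.pred ?H (\<lambda>w. unexplored r N (pos N w) i l \<noteq> {})"
    by (rule measurable_compose[OF pos_measurable_history[OF N] unexplored_nonempty_measurable]) (use i l in auto)
  ultimately show "(\<lambda>w. of_bool (J N (Suc l) w = i (Suc l) \<and> unexplored r N (pos N w) i l \<noteq> {}) :: real) \<in> borel_measurable ?H"
    by measurable
qed

text \<open>Each step conditions on the history and replaces the indicator of the next choice by its
  conditional probability. That probability is a function of the positions and can be absorbed into
  \<open>F\<close>, which is why the induction runs over all \<open>F\<close>.\<close>

lemma expectation_follows:
  fixes F :: "(nat \<Rightarrow> 'a) \<Rightarrow> real"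
  assumes N: "0 < N" and i: "\<And>l. l \<in> {1..n} \<Longrightarrow> i l < N"
    and F: "F \<in> borel_measurable (configs N)" "\<And>x. \<bar>F x\<bar> \<le> B"
  shows "expectation (\<lambda>w. follows N i n w * F (pos N w)) =
    expectation (\<lambda>w. choice_weight r N (pos N w) i n * F (pos N w))"
  using i F
proof (induction n arbitrary: F)
  case 0
  then show ?case by (simp add: follows_def choice_weight_def)
next
  case (Suc n)
  let ?H = "history M N (X N) (J N) n"
  interpret H: sigma_finite_subalgebra M ?H
    by (rule finite_measure_subalgebra_is_sigma_finite)
       (simp add: finite_measure_subalgebra_def finite_measure_subalgebra_axioms_def subalgebra_history[OF N] finite_measure_axioms)
  have i': "\<And>l. l \<in> {1..n} \<Longrightarrow> i l < N" and iN: "i (Suc n) < N" using Suc.prems(1) by auto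
  \<comment> \<open>The indicator that unexplored points remain is included because the conditional
    law of the choice is prescribed on that event only.\<close>
  define f where "f w = follows N i n w * (of_bool (unexplored r N (pos N w) i n \<noteq> {}) * F (pos N w))" for w
  define g :: "'w \<Rightarrow> real" where "g = indicator {w' \<in> space M. J N (Suc n) w' = i (Suc n)}"
  define p where "p x = (if i (Suc n) \<in> unexplored r N x i n then 1 / real (card (unexplored r N x i n)) else 0)" for x :: "nat \<Rightarrow> 'a"
  have p: "0 \<le> p x" "p x \<le> 1" for x
  proof -
    have "1 / real c \<le> 1" for c by (cases c) auto
    then show "0 \<le> p x" "p x \<le> 1" by (auto simp: p_def)
  qed
  note [measurable] = mem_unexplored_measurable[OF r_pos i'] card_unexplored_measurable[OF r_pos i']
    unexplored_nonempty_measurable[OF i'] Suc.prems(2)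
  have fH: "f \<in> borel_measurable ?H"
    unfolding f_def[abs_def]
    by (intro borel_measurable_times follows_measurable[OF N i']
        measurable_compose[OF pos_measurable_history[OF N], of "\<lambda>x. of_bool (unexplored r N x i n \<noteq> {})"]
        measurable_compose[OF pos_measurable_history[OF N] Suc.prems(2)]) auto
  have fM [measurable]: "f \<in> borel_measurable M"
    by (rule measurable_from_subalg[OF subalgebra_history[OF N] fH])
  have JM: "J N (Suc n) \<in> measurable M (count_space {..<N})" using choice_measurable[OF N] by simp
  have "{w' \<in> space M. J N (Suc n) w' = i (Suc n)} \<in> sets M"
    using measurable_sets[OF JM, of "{i (Suc n)}"] iN by (auto simp: vimage_def Int_def conj_commute)
  then have gM [measurable]: "g \<in> borel_measurable M" by (simp add: g_def)
  have fb: "\<bar>f w * g w\<bar> \<le> B" for w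
    using Suc.prems(3)[of "pos N w"] by (auto simp: f_def g_def follows_eq indicator_def)
  have "expectation (\<lambda>w. follows N i (Suc n) w * F (pos N w)) = expectation (\<lambda>w. f w * g w)"
    by (intro Bochner_Integration.integral_cong refl) (auto simp: follows_def f_def g_def)
  also have "\<dots> = expectation (\<lambda>w. f w * real_cond_exp M ?H g w)"
    using fb by (intro H.real_cond_exp_intg(2)[symmetric] fH gM integrable_const_bound[where B=B]) auto
  also have "\<dots> = expectation (\<lambda>w. follows N i n w * (p (pos N w) * F (pos N w)))"
  proof (rule integral_cong_AE)
    show "(\<lambda>w. f w * real_cond_exp M ?H g w) \<in> borel_measurable M" by measurable
    have "follows N i n \<in> borel_measurable M"
      by (rule measurable_from_subalg[OF subalgebra_history[OF N] follows_measurable[OF N i']])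
    moreover have "(\<lambda>w. p (pos N w)) \<in> borel_measurable M"
      by (rule measurable_compose[OF pos_measurable[OF N]]) (simp add: p_def[abs_def])
    moreover have "(\<lambda>w. F (pos N w)) \<in> borel_measurable M"
      by (rule measurable_compose[OF pos_measurable[OF N] Suc.prems(2)])
    ultimately show "(\<lambda>w. follows N i n w * (p (pos N w) * F (pos N w))) \<in> borel_measurable M" by measurable
    show "AE w in M. f w * real_cond_exp M ?H g w = follows N i n w * (p (pos N w) * F (pos N w))"
      using choice_uniform[OF iN, of n]
    proof (rule AE_mp, intro AE_I2 impI)
      fix w assume w: "w \<in> space M"
        and ce: "unexplored r N (\<lambda>k. X N k w) (\<lambda>k. J N k w) n \<noteq> {} \<longrightarrow>
           real_cond_exp M ?H (indicator {w' \<in> space M. J N (Suc n) w' = i (Suc n)}) w =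
           (if i (Suc n) \<in> unexplored r N (\<lambda>k. X N k w) (\<lambda>k. J N k w) n
            then 1 / real (card (unexplored r N (\<lambda>k. X N k w) (\<lambda>k. J N k w) n)) else 0)"
      show "f w * real_cond_exp M ?H g w = follows N i n w * (p (pos N w) * F (pos N w))"
      proof (cases "follows N i n w = 0 \<or> unexplored r N (pos N w) i n = {}")
        case True
        then show ?thesis by (auto simp: f_def p_def)
      next
        case False
        have "cho N w l = i l" if "l \<in> {1..n}" for l
          using False that by (cases l) (auto simp: follows_eq cho_def Suc_le_eq split: if_splits)
        then have "unex N n w = unexplored r N (pos N w) i n"
          using i' by (intro unexplored_cong) auto
        then show ?thesis using ce False unexplored_pos_cho[OF N w, of n]
          by (simp add: f_def g_def p_def)
      qed
    qed
  qed
  also have "\<dots> = expectation (\<lambda>w. choice_weight r N (pos N w) i n * (p (pos N w) * F (pos N w)))"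
  proof (rule Suc.IH[OF i'])
    show "(\<lambda>x. p x * F x) \<in> borel_measurable (configs N)" unfolding p_def by measurable
    fix x
    have "p x * \<bar>F x\<bar> \<le> 1 * \<bar>F x\<bar>" using p(2) by (intro mult_right_mono) auto
    then show "\<bar>p x * F x\<bar> \<le> B" using Suc.prems(3)[of x] p(1)[of x] by (simp add: abs_mult)
  qed
  also have "\<dots> = expectation (\<lambda>w. choice_weight r N (pos N w) i (Suc n) * F (pos N w))"
    by (simp add: choice_weight_def p_def mult.assoc)
  finally show ?case .
qed

text \<open>A function of the positions and the first \<open>m\<close> choices. Measurability is
  asked in the positions for each fixed sequence of choices; only finitely many such sequences
  exist, so this makes the corresponding random variable measurable.\<close>

definition adapted :: "nat \<Rightarrow> nat \<Rightarrow> ((nat \<Rightarrow> 'a) \<Rightarrow> (nat \<Rightarrow> nat) \<Rightarrow> real) \<Rightarrow> bool" where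
  "adapted N m G \<longleftrightarrow>
     (\<forall>i. (\<forall>l\<in>{1..m}. i l < N) \<longrightarrow> (\<lambda>x. G x i) \<in> borel_measurable (configs N)) \<and>
     (\<forall>x i i'. (\<forall>l\<in>{1..m}. i l < N \<and> i l = i' l) \<longrightarrow> G x i = G x i')"

text \<open>If unexplored points remain after \<open>n\<close> steps, they also remained earlier,
  and exactly one sequence of \<open>Suc n\<close> choices is followed, the actual one
  \<open>i0\<close>. Otherwise none is. The expectation splits into a finite sum over sequences,
  each an integral over i.i.d. positions.\<close>

lemma expectation_active:
  fixes G :: "(nat \<Rightarrow> 'a) \<Rightarrow> (nat \<Rightarrow> nat) \<Rightarrow> real"
  assumes N: "0 < N"
    and adapted: "adapted N (Suc n) G"
    and B: "\<And>x i. \<bar>G x i\<bar> \<le> B"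
  shows "expectation (\<lambda>w. of_bool (unex N n w \<noteq> {}) * G (pos N w) (cho N w)) =
    (\<Sum>i\<in>PiE {1..Suc n} (\<lambda>_. {..<N}). \<integral>x. choice_weight r N x i (Suc n) * G x i \<partial>sampled N)"
proof -
  have G: "\<And>i. (\<And>l. l \<in> {1..Suc n} \<Longrightarrow> i l < N) \<Longrightarrow> (\<lambda>x. G x i) \<in> borel_measurable (configs N)"
    and cong: "\<And>x i i'. (\<And>l. l \<in> {1..Suc n} \<Longrightarrow> i l < N \<and> i l = i' l) \<Longrightarrow> G x i = G x i'"
    using adapted unfolding adapted_def by blast+
  let ?I = "PiE {1..Suc n} (\<lambda>_. {..<N})"
  have fin: "finite ?I" by (intro finite_PiE) auto
  have iN: "i l < N" if "i \<in> ?I" "l \<in> {1..Suc n}" for i l using PiE_mem[OF that] by simp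
  have split: "of_bool (unex N n w \<noteq> {}) * G (pos N w) (cho N w) =
      (\<Sum>i\<in>?I. follows N i (Suc n) w * G (pos N w) i)" if w: "w \<in> space M" for w
  proof -
    define i0 where "i0 = restrict (cho N w) {1..Suc n}"
    have i0: "i0 \<in> ?I" using cho_less[OF N w] by (auto simp: i0_def)
    have "follows N i (Suc n) w = 0" if i: "i \<in> ?I" "i \<noteq> i0" for i
    proof -
      obtain l where "l \<in> {1..Suc n}" "i l \<noteq> i0 l" using PiE_ext[OF i(1) i0] i(2) by blast
      then have "l - 1 < Suc n" "J N (Suc (l - 1)) w \<noteq> i (Suc (l - 1))" by (auto simp: i0_def cho_def)
      then show ?thesis unfolding follows_eq by force
    qed
    then have "(\<Sum>i\<in>?I. follows N i (Suc n) w * G (pos N w) i) = (\<Sum>i\<in>{i0}. follows N i (Suc n) w * G (pos N w) i)"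
      using i0 fin by (intro sum.mono_neutral_right) auto
    moreover have "G (pos N w) (cho N w) = G (pos N w) i0"
      using cho_less[OF N w] by (intro cong) (auto simp: i0_def)
    moreover have "follows N i0 (Suc n) w = of_bool (unex N n w \<noteq> {})"
    proof -
      have e: "unexplored r N (pos N w) i0 l = unex N l w" if "l \<le> n" for l
        using that cho_less[OF N w] by (intro unexplored_cong) (auto simp: i0_def)
      have "unex N l w \<noteq> {}" if "unex N n w \<noteq> {}" "l \<le> n" for l
        using unexplored_antimono[OF that(2), of r N "pos N w" "cho N w"] that(1) by blast
      then show ?thesis by (auto simp: follows_eq e less_Suc_eq_le) (auto simp: i0_def cho_def)
    qed
    ultimately show ?thesis by simp
  qed
  have int: "integrable M (\<lambda>w. follows N i (Suc n) w * G (pos N w) i)" if i: "i \<in> ?I" for i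
  proof (rule integrable_const_bound[where B=B])
    show "AE w in M. norm (follows N i (Suc n) w * G (pos N w) i) \<le> B"
      using B order_trans[OF abs_ge_zero B] by (auto simp: follows_eq)
    have "follows N i (Suc n) \<in> borel_measurable M"
      by (rule measurable_from_subalg[OF subalgebra_history[OF N] follows_measurable[OF N]]) (use iN[OF i] in auto)
    moreover have "(\<lambda>w. G (pos N w) i) \<in> borel_measurable M"
      by (rule measurable_compose[OF pos_measurable[OF N] G]) (use iN[OF i] in auto)
    ultimately show "(\<lambda>w. follows N i (Suc n) w * G (pos N w) i) \<in> borel_measurable M" by measurable
  qed
  have "expectation (\<lambda>w. of_bool (unex N n w \<noteq> {}) * G (pos N w) (cho N w)) =
      expectation (\<lambda>w. \<Sum>i\<in>?I. follows N i (Suc n) w * G (pos N w) i)"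
    by (intro Bochner_Integration.integral_cong refl split)
  also have "\<dots> = (\<Sum>i\<in>?I. expectation (\<lambda>w. follows N i (Suc n) w * G (pos N w) i))"
    by (intro Bochner_Integration.integral_sum int)
  also have "\<dots> = (\<Sum>i\<in>?I. \<integral>x. choice_weight r N x i (Suc n) * G x i \<partial>sampled N)"
  proof (rule sum.cong[OF refl])
    fix i assume i: "i \<in> ?I"
    have iN': "\<And>l. l \<in> {1..Suc n} \<Longrightarrow> i l < N" using iN[OF i] .
    have "expectation (\<lambda>w. follows N i (Suc n) w * G (pos N w) i) =
        expectation (\<lambda>w. choice_weight r N (pos N w) i (Suc n) * G (pos N w) i)"
      by (rule expectation_follows[OF N iN' G[OF iN'] B])
    also have "\<dots> = (\<integral>x. choice_weight r N x i (Suc n) * G x i \<partial>sampled N)"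
      using iN' by (intro expectation_pos[OF N, of "\<lambda>x. choice_weight r N x i (Suc n) * G x i"]
        borel_measurable_times choice_weight_measurable[OF r_pos] G)
    finally show "expectation (\<lambda>w. follows N i (Suc n) w * G (pos N w) i) =
      (\<integral>x. choice_weight r N x i (Suc n) * G x i \<partial>sampled N)" .
  qed
  finally show ?thesis .
qed

end

section \<open>Volumes of the explored region\<close>

context point_law
begin

lemma free_ball_volume_le:
  assumes "\<And>c. measure \<mu> (cball c r) \<le> \<kappa>"
  shows "free_ball_volume \<mu> r N x j n c \<le> \<kappa>"
proof -
  have "free_ball_volume \<mu> r N x j n c \<le> measure \<mu> (cball c r)"
    unfolding free_ball_volume_def by (intro finite_measure_mono) (auto simp: dist_commute)
  then show ?thesis using assms order_trans by blast
qed

lemma free_ball_volume_antimono: "m \<le> n \<Longrightarrow> free_ball_volume \<mu> r N x j n c \<le> free_ball_volume \<mu> r N x j m c"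
  unfolding free_ball_volume_def
  by (intro finite_measure_mono) (auto intro: free_antimono)

lemma free_volume_antimono: "m \<le> n \<Longrightarrow> free_volume \<mu> r N x j n \<le> free_volume \<mu> r N x j m"
  unfolding free_volume_def
  by (intro finite_measure_mono) (auto intro: free_antimono)

lemma free_volume_Suc:
  "free_volume \<mu> r N x j (Suc n) = free_volume \<mu> r N x j n -
     of_bool (unexplored r N x j n \<noteq> {}) * free_ball_volume \<mu> r N x j n (x (j (Suc n)))"
proof (cases "unexplored r N x j n = {}")
  case False
  have eq: "{y. free r N x j (Suc n) y} = {y. free r N x j n y} - {y. free r N x j n y \<and> dist y (x (j (Suc n))) \<le> r}"
    using False by (auto simp: not_le)
  have "{y. free r N x j n y} \<in> sets \<mu>" "{y. free r N x j n y \<and> dist y (x (j (Suc n))) \<le> r} \<in> sets \<mu>"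
    using free_measurable[of r N x j n] by (simp_all add: pred_def)
  then have "measure \<mu> ({y. free r N x j n y} - {y. free r N x j n y \<and> dist y (x (j (Suc n))) \<le> r}) =
      measure \<mu> {y. free r N x j n y} - measure \<mu> {y. free r N x j n y \<and> dist y (x (j (Suc n))) \<le> r}"
    by (rule finite_measure_Diff) auto
  then show ?thesis using False by (simp only: free_volume_def free_ball_volume_def eq) simp
qed (simp add: free_volume_def)

lemma free_ball_volume_measurable_borel [measurable]:
  "(\<lambda>c. free_ball_volume \<mu> r N x j n c) \<in> borel_measurable borel"
  unfolding free_ball_volume_def by (intro measure_Collect_measurable) measurable

lemma integrable_bounded:
  "f \<in> borel_measurable \<mu> \<Longrightarrow> (\<And>y. \<bar>f y\<bar> \<le> B) \<Longrightarrow> integrable \<mu> (f :: 'a \<Rightarrow> real)"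
  by (rule integrable_const_bound[where B=B]) auto

lemma free_pair_volume_integrand:
  shows "integrable \<mu> (\<lambda>y. of_bool (free r N x j n y) * free_ball_volume \<mu> r N x j m y)"
  using free_ball_volume_bounds[of r N x j m]
  by (intro integrable_bounded[where B=1]) (auto simp: abs_of_nonneg)

lemma free_pair_volume_bounds:
  assumes "\<And>c. measure \<mu> (cball c r) \<le> \<kappa>"
  shows "0 \<le> free_pair_volume \<mu> r N x j n" "free_pair_volume \<mu> r N x j n \<le> \<kappa>"
proof -
  show "0 \<le> free_pair_volume \<mu> r N x j n"
    unfolding free_pair_volume_def using free_ball_volume_bounds by (intro integral_nonneg_AE) auto
  have "0 \<le> \<kappa>" using order_trans[OF measure_nonneg assms] .
  then have "of_bool (free r N x j n y) * free_ball_volume \<mu> r N x j n y \<le> \<kappa>" for y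
    using free_ball_volume_le[OF assms, of N x j n y] by auto
  then have "free_pair_volume \<mu> r N x j n \<le> (\<integral>y. \<kappa> \<partial>\<mu>)"
    unfolding free_pair_volume_def by (intro integral_mono free_pair_volume_integrand) auto
  then show "free_pair_volume \<mu> r N x j n \<le> \<kappa>" by (simp add: prob_space[unfolded space_eq])
qed

lemma free_pair_volume_antimono:
  assumes "m \<le> n"
  shows "free_pair_volume \<mu> r N x j n \<le> free_pair_volume \<mu> r N x j m"
proof -
  have "of_bool (free r N x j n y) * free_ball_volume \<mu> r N x j n y
    \<le> of_bool (free r N x j m y) * free_ball_volume \<mu> r N x j m y" for y
    using free_antimono[OF _ assms, of r N x j y] free_ball_volume_antimono[OF assms, of r N x j y] free_ball_volume_bounds[of r N x j m y] by auto
  then show ?thesis unfolding free_pair_volume_def by (intro integral_mono free_pair_volume_integrand)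
qed

text \<open>A pair counted at time \<open>m\<close> but not at time \<open>n\<close> has a member in
  the region covered in between. Given that member, the partner lies in a ball of measure at most
  \<open>\<kappa>\<close>; the two members give the factor 2.\<close>

lemma free_pair_volume_lipschitz:
  assumes \<kappa>: "\<And>c. measure \<mu> (cball c r) \<le> \<kappa>" and mn: "m \<le> n"
  shows "free_pair_volume \<mu> r N x j m \<le> free_pair_volume \<mu> r N x j n +
    2 * \<kappa> * (free_volume \<mu> r N x j m - free_volume \<mu> r N x j n)"
proof -
  interpret P: pair_prob_space \<mu> \<mu> by unfold_locales
  define f where "f l y = (of_bool (free r N x j l y) :: real)" for l y
  define B where "B l y = free_ball_volume \<mu> r N x j l y" for l y
  define D where "D = free_volume \<mu> r N x j m - free_volume \<mu> r N x j n"
  have fm [measurable]: "f l \<in> borel_measurable borel" for l unfolding f_def by measurable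
  have Bm [measurable]: "B l \<in> borel_measurable borel" for l unfolding B_def by measurable
  have f01: "0 \<le> f l y" "f l y \<le> 1" for l y by (auto simp: f_def)
  have fmn: "f n y \<le> f m y" for y using free_antimono[OF _ mn, of r N x j y] by (auto simp: f_def)
  have B01: "0 \<le> B l y" "B l y \<le> \<kappa>" "B l y \<le> 1" for l y
    using free_ball_volume_bounds free_ball_volume_le[OF \<kappa>] by (auto simp: B_def)
  have intf: "integrable \<mu> (f l)" for l using f01 by (intro integrable_bounded[where B=1]) (auto simp: abs_of_nonneg)
  have intfB: "integrable \<mu> (\<lambda>y. f k y * B l y)" for k l
    using f01 B01 by (intro integrable_bounded[where B=1]) (auto simp: abs_mult mult_le_one)
  have V: "free_volume \<mu> r N x j l = (\<integral>y. f l y \<partial>\<mu>)" for l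
    by (simp add: free_volume_def f_def integral_of_bool)
  have Dint: "D = (\<integral>y. f m y - f n y \<partial>\<mu>)" by (simp add: D_def V intf)
  have Bint: "B l y = (\<integral>y'. f l y' * of_bool (dist y' y \<le> r) \<partial>\<mu>)" for l y
  proof -
    have "(\<integral>y'. f l y' * of_bool (dist y' y \<le> r) \<partial>\<mu>) = (\<integral>y'. of_bool (free r N x j l y' \<and> dist y' y \<le> r) \<partial>\<mu>)"
      by (intro Bochner_Integration.integral_cong) (auto simp: f_def)
    also have "\<dots> = B l y" unfolding B_def free_ball_volume_def by (rule integral_of_bool) measurable
    finally show ?thesis ..
  qed
  have Q: "free_pair_volume \<mu> r N x j l = (\<integral>y. f l y * B l y \<partial>\<mu>)" for l
    by (simp add: free_pair_volume_def f_def B_def)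
  have fB_le: "(f m y - f n y) * B l y \<le> (f m y - f n y) * \<kappa>" for l y
    using fmn[of y] B01[of l y] by (intro mult_left_mono) auto
  have int_diff: "integrable \<mu> (\<lambda>y. (f m y - f n y) * B l y)" for l
    using intfB by (simp add: left_diff_distrib)
  have first: "(\<integral>y. (f m y - f n y) * B l y \<partial>\<mu>) \<le> \<kappa> * D" for l
  proof -
    have "(\<integral>y. (f m y - f n y) * B l y \<partial>\<mu>) \<le> (\<integral>y. (f m y - f n y) * \<kappa> \<partial>\<mu>)"
      using fB_le intf by (intro integral_mono int_diff) auto
    then show ?thesis by (simp add: Dint mult.commute)
  qed
  let ?g = "\<lambda>y y'. f n y * ((f m y' - f n y') * of_bool (dist y' y \<le> r))"
  have gm [measurable]: "(\<lambda>p. ?g (fst p) (snd p)) \<in> borel_measurable (\<mu> \<Otimes>\<^sub>M \<mu>)" by measurable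
  have ig: "integrable (\<mu> \<Otimes>\<^sub>M \<mu>) (\<lambda>p. ?g (fst p) (snd p))"
    by (rule P.integrable_const_bound[where B=1]) (auto simp: f_def)
  have "(\<integral>y. f n y * (B m y - B n y) \<partial>\<mu>) = (\<integral>y. \<integral>y'. ?g y y' \<partial>\<mu> \<partial>\<mu>)"
  proof (intro Bochner_Integration.integral_cong refl)
    fix y
    have i: "integrable \<mu> (\<lambda>y'. f l y' * of_bool (dist y' y \<le> r))" for l
      by (intro integrable_bounded[where B=1]) (auto simp: f_def)
    show "f n y * (B m y - B n y) = (\<integral>y'. ?g y y' \<partial>\<mu>)"
      unfolding Bint by (simp add: i left_diff_distrib)
  qed
  \<comment> \<open>Closeness of the two points is symmetric, so interchanging the integrals reduces
    a loss of the second point to a loss of the first.\<close>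
  also have "\<dots> = (\<integral>y'. \<integral>y. ?g y y' \<partial>\<mu> \<partial>\<mu>)"
    by (rule P.Fubini_integral[symmetric]) (use ig in \<open>simp add: case_prod_beta'\<close>)
  also have "\<dots> = (\<integral>y'. (f m y' - f n y') * B n y' \<partial>\<mu>)"
  proof (intro Bochner_Integration.integral_cong refl)
    fix y'
    have "(\<integral>y. ?g y y' \<partial>\<mu>) = (\<integral>y. (f m y' - f n y') * (f n y * of_bool (dist y y' \<le> r)) \<partial>\<mu>)"
      by (intro Bochner_Integration.integral_cong) (auto simp: dist_commute)
    then show "(\<integral>y. ?g y y' \<partial>\<mu>) = (f m y' - f n y') * B n y'" by (simp add: Bint)
  qed
  finally have second: "(\<integral>y. f n y * (B m y - B n y) \<partial>\<mu>) \<le> \<kappa> * D" using first by simp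
  have "free_pair_volume \<mu> r N x j m - free_pair_volume \<mu> r N x j n =
      (\<integral>y. (f m y - f n y) * B m y \<partial>\<mu>) + (\<integral>y. f n y * (B m y - B n y) \<partial>\<mu>)"
    by (simp add: Q intfB left_diff_distrib right_diff_distrib)
  then show ?thesis using first[of m] second by (simp add: D_def)
qed

end

section \<open>Adapted processes and the exact identities for one step\<close>

context rsa_exploration
begin

lemma adapted_measurable:
  assumes N: "0 < N" and G: "adapted N m G"
  shows "(\<lambda>w. G (pos N w) (cho N w)) \<in> borel_measurable M"
proof -
  let ?I = "PiE {1..m} (\<lambda>_. {..<N})"
  have rm: "(\<lambda>w. restrict (cho N w) {1..m}) \<in> measurable M (PiM {1..m} (\<lambda>_. count_space {..<N}))"
    using choice_measurable[OF N] by (intro measurable_restrict) (auto simp: cho_def)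
  have r: "(\<lambda>w. restrict (cho N w) {1..m}) \<in> measurable M (count_space ?I)"
    using rm by (subst (asm) count_space_PiM_finite) auto
  have "(\<lambda>w. G (pos N w) (restrict (cho N w) {1..m})) \<in> borel_measurable M"
  proof (rule measurable_compose_countable'[OF _ r])
    fix i assume i: "i \<in> ?I"
    have "(\<lambda>x. G x i) \<in> borel_measurable (configs N)"
      using G PiE_mem[OF i] by (auto simp: adapted_def)
    then show "(\<lambda>w. G (pos N w) i) \<in> borel_measurable M"
      by (rule measurable_compose[OF pos_measurable[OF N]])
  qed (auto intro!: countable_finite finite_PiE)
  moreover have "G (pos N w) (cho N w) = G (pos N w) (restrict (cho N w) {1..m})" if "w \<in> space M" for w
  proof -
    have "\<forall>l\<in>{1..m}. cho N w l < N \<and> cho N w l = restrict (cho N w) {1..m} l" using cho_less[OF N that] by auto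
    then show ?thesis using G unfolding adapted_def by blast
  qed
  ultimately show ?thesis by (subst measurable_cong) auto
qed

lemma adapted_binop:
  assumes "adapted N m G" "adapted N m G'"
    and "\<And>S f g. f \<in> borel_measurable S \<Longrightarrow> g \<in> borel_measurable S \<Longrightarrow> (\<lambda>x. h (f x) (g x)) \<in> borel_measurable (S :: (nat \<Rightarrow> 'a) measure)"
  shows "adapted N m (\<lambda>x i. h (G x i) (G' x i))"
proof -
  have eq: "G x i = G x i' \<and> G' x i = G' x i'" if "\<forall>l\<in>{1..m}. i l < N \<and> i l = i' l" for x i i'
    using assms(1,2) that unfolding adapted_def by blast
  have "(\<lambda>x. h (G x i) (G' x i)) \<in> borel_measurable (configs N)"
    if "\<forall>l\<in>{1..m}. i l < N" for i
    using assms(1,2) that unfolding adapted_def by (intro assms(3)) blast+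
  moreover have "h (G x i) (G' x i) = h (G x i') (G' x i')" if "\<forall>l\<in>{1..m}. i l < N \<and> i l = i' l" for x i i'
    using eq[OF that, of x] by simp
  ultimately show ?thesis unfolding adapted_def by blast
qed

lemma adaptedI:
  assumes "\<And>i. (\<And>l. l \<in> {1..m} \<Longrightarrow> i l < N) \<Longrightarrow> (\<lambda>x. G x i) \<in> borel_measurable (configs N)"
    and "\<And>x i i'. (\<forall>l\<in>{1..m}. i l < N \<and> i l = i' l) \<Longrightarrow> G x i = G x i'"
  shows "adapted N m G"
  using assms unfolding adapted_def by blast

lemma adapted_mult: "adapted N m G \<Longrightarrow> adapted N m G' \<Longrightarrow> adapted N m (\<lambda>x i. G x i * G' x i)"
  by (rule adapted_binop[where h = "(*)"]) auto

lemma adapted_diff: "adapted N m G \<Longrightarrow> adapted N m G' \<Longrightarrow> adapted N m (\<lambda>x i. G x i - G' x i)"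
  by (rule adapted_binop[where h = "(-)"]) auto

lemma adapted_const: "adapted N m (\<lambda>x i. c)"
  by (simp add: adapted_def)

lemma adapted_mono: "adapted N m G \<Longrightarrow> m \<le> n \<Longrightarrow> adapted N n G"
proof -
  assume G: "adapted N m G" and "m \<le> n"
  then have "\<forall>l\<in>{1..m}. P l" if "\<forall>l\<in>{1..n}. P l" for P using that by auto
  with G show "adapted N n G" unfolding adapted_def by blast
qed

lemma adapted_processes:
  assumes N: "0 < N"
  shows "adapted N n (\<lambda>x i. of_bool (unexplored r N x i n \<noteq> {}))" (is ?a)
    and "adapted N n (\<lambda>x i. real (card (unexplored r N x i n)))" (is ?u)
    and "adapted N n (\<lambda>x i. free_volume (law N) r N x i n)" (is ?V)
    and "adapted N n (\<lambda>x i. free_pair_volume (law N) r N x i n)" (is ?Q)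
    and "adapted N (Suc n) (\<lambda>x i. free_ball_volume (law N) r N x i n (x (i (Suc n))))" (is ?B)
    and "adapted N (Suc n) (\<lambda>x i. real (card (free_neighbours r N x i n)))" (is ?n)
    and "adapted N (Suc n) (\<lambda>x i. of_bool (i (Suc n) \<in> unexplored r N x i n))" (is ?m)
proof -
  interpret L: point_law "law N" by (rule point_law_law[OF N])
  have U: "unexplored r N x i n = unexplored r N x i' n" "free r N x i n = free r N x i' n"
    if "\<forall>l\<in>{1..n}. i l < N \<and> i l = i' l" for x :: "nat \<Rightarrow> 'a" and i i'
  proof -
    show "unexplored r N x i n = unexplored r N x i' n" by (rule unexplored_cong[OF refl]) (use that in blast)+
    show "free r N x i n = free r N x i' n" by (rule ext, rule free_cong[OF refl]) (use that in blast)+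
  qed
  have U': "unexplored r N x i n = unexplored r N x i' n" "free r N x i n = free r N x i' n" "i (Suc n) = i' (Suc n)"
    if "\<forall>l\<in>{1..Suc n}. i l < N \<and> i l = i' l" for x :: "nat \<Rightarrow> 'a" and i i'
  proof -
    have a: "\<forall>l\<in>{1..n}. i l < N \<and> i l = i' l" using that by (meson atLeastAtMost_iff le_SucI)
    show "unexplored r N x i n = unexplored r N x i' n" "free r N x i n = free r N x i' n" by (rule U[OF a])+
    show "i (Suc n) = i' (Suc n)" using bspec[OF that, of "Suc n"] by simp
  qed
  have adaptedI': "adapted N n G"
    if "\<And>i. (\<And>l. l \<in> {1..n} \<Longrightarrow> i l < N) \<Longrightarrow> (\<lambda>x. G x i) \<in> borel_measurable (configs N)"
      and "\<And>x i i'. unexplored r N x i n = unexplored r N x i' n \<Longrightarrow> free r N x i n = free r N x i' n \<Longrightarrow> G x i = G x i'"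
    for G :: "(nat \<Rightarrow> 'a) \<Rightarrow> (nat \<Rightarrow> nat) \<Rightarrow> real"
    using that(1) that(2)[OF U] by (rule adaptedI)
  show ?a
    by (rule adaptedI', rule measurable_compose[OF unexplored_nonempty_measurable, of n _ N of_bool]) auto
  show ?u by (rule adaptedI'[OF card_unexplored_measurable[OF r_pos]]) (simp_all only:)
  show ?V by (rule adaptedI'[OF L.free_volume_measurable[OF r_pos]]) (simp_all only: free_volume_def)
  show ?Q by (rule adaptedI'[OF L.free_pair_volume_measurable[OF r_pos]])
    (simp_all only: free_pair_volume_def free_ball_volume_def)
  show ?B unfolding adapted_def
  proof (intro conjI allI impI)
    fix i assume i: "\<forall>l\<in>{1..Suc n}. i l < N"
    then have c: "i (Suc n) \<in> {..<N}" by auto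
    have m: "(\<lambda>p. free_ball_volume (law N) r N (fst p) i n (snd p)) \<in> borel_measurable (configs N \<Otimes>\<^sub>M borel)"
      using i by (intro L.free_ball_volume_measurable r_pos) auto
    show "(\<lambda>x :: nat \<Rightarrow> 'a. free_ball_volume (law N) r N x i n (x (i (Suc n)))) \<in> borel_measurable (configs N)"
      by (rule measurable_compose[OF _ m, of "\<lambda>x. (x, x (i (Suc n)))", simplified]) (use c in measurable)
  next
    fix x :: "nat \<Rightarrow> 'a" and i i' assume "\<forall>l\<in>{1..Suc n}. i l < N \<and> i l = i' l"
    from U'(1,2)[OF this, of x] U'(3)[OF this] show "free_ball_volume (law N) r N x i n (x (i (Suc n))) = free_ball_volume (law N) r N x i' n (x (i' (Suc n)))"
      by (simp add: free_ball_volume_def)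
  qed
  show ?n unfolding adapted_def
  proof (intro conjI allI impI)
    fix i assume i: "\<forall>l\<in>{1..Suc n}. i l < N"
    then have c: "i (Suc n) \<in> {..<N}" and i': "\<And>l. l \<in> {1..n} \<Longrightarrow> i l < N" by auto
    have nm: "Measurable.pred (configs N :: (nat \<Rightarrow> 'a) measure) (\<lambda>x. k \<in> free_neighbours r N x i n)" if "k \<in> {..<N}" for k
    proof -
      have [measurable]: "Measurable.pred (configs N :: (nat \<Rightarrow> 'a) measure) (\<lambda>x. k \<in> unexplored r N x i n)"
        by (rule mem_unexplored_measurable[OF r_pos i'])
      show ?thesis unfolding free_neighbours_def mem_Collect_eq using c that by measurable
    qed
    have e: "real (card (free_neighbours r N x i n)) = (\<Sum>k<N. of_bool (k \<in> free_neighbours r N x i n))" for x :: "nat \<Rightarrow> 'a"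
      using unexplored_subset[of r N x i n] by (subst sum_of_bool_eq) (auto simp: free_neighbours_def intro!: arg_cong[where f=card])
    show "(\<lambda>x :: nat \<Rightarrow> 'a. real (card (free_neighbours r N x i n))) \<in> borel_measurable (configs N)"
      unfolding e by (intro borel_measurable_sum measurable_compose[OF nm]) auto
  next
    fix x :: "nat \<Rightarrow> 'a" and i i' assume "\<forall>l\<in>{1..Suc n}. i l < N \<and> i l = i' l"
    from U'(1,2)[OF this, of x] U'(3)[OF this] show "real (card (free_neighbours r N x i n)) = real (card (free_neighbours r N x i' n))"
      by (simp add: free_neighbours_def)
  qed
  show ?m
  proof (rule adaptedI)
    fix i assume "\<And>l. l \<in> {1..Suc n} \<Longrightarrow> i l < N"
    then show "(\<lambda>x :: nat \<Rightarrow> 'a. of_bool (i (Suc n) \<in> unexplored r N x i n) :: real) \<in> borel_measurable (configs N)"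
      by (intro measurable_compose[OF mem_unexplored_measurable[OF r_pos]]) auto
  next
    fix x :: "nat \<Rightarrow> 'a" and i i' assume "\<forall>l\<in>{1..Suc n}. i l < N \<and> i l = i' l"
    from U'(1,2)[OF this, of x] U'(3)[OF this] show "(of_bool (i (Suc n) \<in> unexplored r N x i n) :: real) = of_bool (i' (Suc n) \<in> unexplored r N x i' n)"
      by simp
  qed
qed

text \<open>In the notation of the overview, \<open>vol\<close> is \<open>V\<^sub>n\<close>,
  \<open>num\<close> is \<open>u\<^sub>n\<close> and \<open>pvol\<close> is
  \<open>Q\<^sub>n\<close>. While \<open>act\<close> is 1, \<open>bvol\<close> is the volume lost at
  step \<open>n + 1\<close>, and \<open>nbr\<close> counts the points lost besides the chosen
  one.\<close>

abbreviation act where "act N n w \<equiv> (of_bool (unex N n w \<noteq> {}) :: real)"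
abbreviation num where "num N n w \<equiv> real (card (unex N n w))"
abbreviation vol where "vol N n w \<equiv> free_volume (law N) r N (pos N w) (cho N w) n"
abbreviation bvol where "bvol N n w \<equiv> free_ball_volume (law N) r N (pos N w) (cho N w) n (pos N w (cho N w (Suc n)))"
abbreviation pvol where "pvol N n w \<equiv> free_pair_volume (law N) r N (pos N w) (cho N w) n"
abbreviation nbr where "nbr N n w \<equiv> real (card (free_neighbours r N (pos N w) (cho N w) n))"

lemma process_measurable:
  assumes "0 < N"
  shows "act N n \<in> borel_measurable M" "num N n \<in> borel_measurable M" "vol N n \<in> borel_measurable M"
    "pvol N n \<in> borel_measurable M" "bvol N n \<in> borel_measurable M" "nbr N n \<in> borel_measurable M"
  by (rule adapted_measurable[OF assms adapted_processes(1)[OF assms]]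
      adapted_measurable[OF assms adapted_processes(2)[OF assms]]
      adapted_measurable[OF assms adapted_processes(3)[OF assms]]
      adapted_measurable[OF assms adapted_processes(4)[OF assms]]
      adapted_measurable[OF assms adapted_processes(5)[OF assms]]
      adapted_measurable[OF assms adapted_processes(6)[OF assms]])+

lemma num_le: "num N n w \<le> real N"
  using card_mono[OF finite_lessThan unexplored_subset, of r N "pos N w" "cho N w" n] by simp

lemma nbr_le: "nbr N n w \<le> real N"
proof -
  have "card (free_neighbours r N (pos N w) (cho N w) n) \<le> card (unex N n w)"
    by (rule card_mono) (auto simp: free_neighbours_def)
  then show ?thesis using num_le[where N=N and n=n and w=w] by simp
qed

text \<open>Reduces an identity for the random exploration to one for each fixed sequence of
  choices, where the exchange argument applies.\<close>

lemma expectation_active_eqI: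
  assumes N: "0 < N" and G: "adapted N (Suc n) G" "\<And>x i. \<bar>G x i\<bar> \<le> B"
    and G': "adapted N (Suc n) G'" "\<And>x i. \<bar>G' x i\<bar> \<le> B"
    and eq: "\<And>i. (\<And>l. l \<in> {1..Suc n} \<Longrightarrow> i l < N) \<Longrightarrow>
       (\<integral>x. choice_weight r N x i (Suc n) * G x i \<partial>sampled N) =
       (\<integral>x. choice_weight r N x i (Suc n) * G' x i \<partial>sampled N)"
  shows "expectation (\<lambda>w. act N n w * G (pos N w) (cho N w)) = expectation (\<lambda>w. act N n w * G' (pos N w) (cho N w))"
  unfolding expectation_active[OF N G] expectation_active[OF N G']
  by (intro sum.cong refl eq) (use PiE_mem in fastforce)

lemma expectation_act_bvol:
  assumes N: "0 < N"
  shows "expectation (\<lambda>w. act N n w * (vol N n w * bvol N n w)) = expectation (\<lambda>w. act N n w * pvol N n w)"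
proof -
  interpret L: point_law "law N" by (rule point_law_law[OF N])
  note ad = adapted_processes[OF N, of n]
  show ?thesis
  proof (rule expectation_active_eqI[OF N, where B=1])
    show "adapted N (Suc n) (\<lambda>x i. free_volume (law N) r N x i n * free_ball_volume (law N) r N x i n (x (i (Suc n))))"
      using adapted_mult[OF adapted_mono[OF ad(3)] ad(5)] by simp
    show "adapted N (Suc n) (\<lambda>x i. free_pair_volume (law N) r N x i n)" using adapted_mono[OF ad(4)] by simp
    show "\<bar>free_volume (law N) r N x i n * free_ball_volume (law N) r N x i n (x (i (Suc n)))\<bar> \<le> 1" for x :: "nat \<Rightarrow> 'a" and i
      using L.free_volume_bounds[of r N x i n] L.free_ball_volume_bounds[of r N x i n "x (i (Suc n))"]
      by (simp add: abs_mult mult_le_one)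
    show "\<bar>free_pair_volume (law N) r N x i n\<bar> \<le> 1" for x :: "nat \<Rightarrow> 'a" and i
      using L.free_pair_volume_bounds[of r 1 N x i n] by (simp add: abs_of_nonneg)
  qed (rule L.expected_free_ball_volume[OF r_pos])
qed

lemma expectation_act_nbr:
  assumes N: "0 < N"
  shows "expectation (\<lambda>w. act N n w * (vol N n w * nbr N n w)) =
    expectation (\<lambda>w. act N n w * ((num N n w - 1) * bvol N n w))"
proof -
  interpret L: point_law "law N" by (rule point_law_law[OF N])
  note ad = adapted_processes[OF N, of n]
  show ?thesis
  proof (rule expectation_active_eqI[OF N, where B="real N"])
    show "adapted N (Suc n) (\<lambda>x i. free_volume (law N) r N x i n * real (card (free_neighbours r N x i n)))"
      using adapted_mult[OF adapted_mono[OF ad(3)] ad(6)] by simp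
    show "adapted N (Suc n) (\<lambda>x i. (real (card (unexplored r N x i n)) - 1) * free_ball_volume (law N) r N x i n (x (i (Suc n))))"
      using adapted_mult[OF adapted_diff[OF adapted_mono[OF ad(2)] adapted_const] ad(5)] by simp
    fix x :: "nat \<Rightarrow> 'a" and i
    have u: "card (unexplored r N x i n) \<le> N"
      using card_mono[OF finite_lessThan unexplored_subset, of r N x i n] by simp
    have "card (free_neighbours r N x i n) \<le> card (unexplored r N x i n)"
      by (rule card_mono) (auto simp: free_neighbours_def)
    then have "card (free_neighbours r N x i n) \<le> N" using u by simp
    then have "free_volume (law N) r N x i n * real (card (free_neighbours r N x i n)) \<le> 1 * real N"
      using L.free_volume_bounds[of r N x i n] by (intro mult_mono) auto
    then show "\<bar>free_volume (law N) r N x i n * real (card (free_neighbours r N x i n))\<bar> \<le> real N"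
      using L.free_volume_bounds[of r N x i n] by (simp add: abs_mult)
    have "\<bar>real (card (unexplored r N x i n)) - 1\<bar> * free_ball_volume (law N) r N x i n (x (i (Suc n))) \<le> real N * 1"
      using L.free_ball_volume_bounds[of r N x i n "x (i (Suc n))"] u N by (intro mult_mono) auto
    then show "\<bar>(real (card (unexplored r N x i n)) - 1) * free_ball_volume (law N) r N x i n (x (i (Suc n)))\<bar> \<le> real N"
      using L.free_ball_volume_bounds[of r N x i n "x (i (Suc n))"] by (simp add: abs_mult)
  qed (rule L.expected_free_neighbours[OF r_pos])
qed

text \<open>Sequences that choose an explored point have weight zero, so the event of such a choice
  while unexplored points remain has probability zero.\<close>

lemma AE_choice_unexplored:
  assumes N: "0 < N"
  shows "AE w in M. \<forall>n. unex N n w \<noteq> {} \<longrightarrow> cho N w (Suc n) \<in> unex N n w"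
proof (subst AE_all_countable, rule allI)
  fix n
  define m where "m x i = (of_bool (i (Suc n) \<in> unexplored r N x i n) :: real)" for x :: "nat \<Rightarrow> 'a" and i
  have ad: "adapted N (Suc n) m" using adapted_processes(7)[OF N] by (simp add: m_def[abs_def])
  have ad': "adapted N (Suc n) (\<lambda>x i. 1 - m x i)" by (rule adapted_diff[OF adapted_const ad])
  have "expectation (\<lambda>w. act N n w * (1 - m (pos N w) (cho N w))) = expectation (\<lambda>w. act N n w * 0)"
  proof (rule expectation_active_eqI[OF N ad' _ adapted_const, where B=1])
    fix i :: "nat \<Rightarrow> nat"
    have eq0: "choice_weight r N x i (Suc n) * (1 - m x i) = 0" for x :: "nat \<Rightarrow> 'a"
      using choice_weight_nonzeroD[of r N x i "Suc n" n] by (auto simp: m_def)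
    show "(\<integral>x. choice_weight r N x i (Suc n) * (1 - m x i) \<partial>sampled N) =
       (\<integral>x. choice_weight r N x i (Suc n) * 0 \<partial>sampled N)" by (simp only: eq0 mult_zero_right)
  qed (auto simp: m_def)
  moreover have "integrable M (\<lambda>w. act N n w * (1 - m (pos N w) (cho N w)))"
    using process_measurable(1)[OF N] adapted_measurable[OF N ad']
    by (intro integrable_const_bound[where B=1]) (auto simp: m_def)
  ultimately have "AE w in M. act N n w * (1 - m (pos N w) (cho N w)) = 0"
    by (intro iffD1[OF integral_nonneg_eq_0_iff_AE]) (auto simp: m_def)
  then show "AE w in M. unex N n w \<noteq> {} \<longrightarrow> cho N w (Suc n) \<in> unex N n w"
    by eventually_elim (auto simp: m_def split: if_splits)
qed

lemma vol_Suc: "0 < N \<Longrightarrow> act N n w * bvol N n w = vol N n w - vol N (Suc n) w"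
  using point_law.free_volume_Suc[OF point_law_law, of N r N "pos N w" "cho N w" n] by simp

text \<open>The chosen point disappears too; as \<open>free_neighbours\<close> leaves it out, it
  contributes the separate term \<open>act\<close>. This needs the choice to be unexplored, which
  holds only almost surely.\<close>

lemma num_Suc:
  assumes "unex N n w \<noteq> {} \<Longrightarrow> cho N w (Suc n) \<in> unex N n w"
  shows "act N n w * nbr N n w = num N n w - num N (Suc n) w - act N n w"
proof (cases "unex N n w = {}")
  case False
  let ?c = "cho N w (Suc n)"
  let ?A = "free_neighbours r N (pos N w) (cho N w) n"
  have c: "?c \<in> unex N n w" by (rule assms[OF False])
  have "unex N n w = unex N (Suc n) w \<union> insert ?c ?A"
    using c r_pos by (auto simp: unexplored_Suc free_neighbours_def)
  moreover have "card (unex N (Suc n) w \<union> insert ?c ?A) = card (unex N (Suc n) w) + card (insert ?c ?A)"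
    by (rule card_Un_disjoint) (auto simp: unexplored_Suc free_neighbours_def)
  moreover have "card (insert ?c ?A) = Suc (card ?A)" by (simp add: free_neighbours_def)
  ultimately have "card (unex N n w) = card (unex N (Suc n) w) + Suc (card ?A)" by simp
  then show ?thesis using False by simp
qed (simp add: unexplored_Suc)

end

section \<open>From single steps to time intervals\<close>

lemma sum_weighted_antimono_bounds:
  fixes a d :: "nat \<Rightarrow> real"
  assumes "\<And>k l. k \<le> l \<Longrightarrow> a l \<le> a k" "\<And>l. 0 \<le> d l"
  shows "a n * (\<Sum>l=m..<n. d l) \<le> (\<Sum>l=m..<n. a l * d l)"
    and "(\<Sum>l=m..<n. a l * d l) \<le> a m * (\<Sum>l=m..<n. d l)"
  unfolding sum_distrib_left using assms by (auto intro!: sum_mono mult_right_mono)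

text \<open>Stated for abstract processes: \<open>a\<close> activity, \<open>u\<close> unexplored
  points, \<open>v\<close> uncovered volume, \<open>b\<close> volume of the next ball,
  \<open>q\<close> pair volume, \<open>d\<close> neighbours. The one-step identities are summed; a
  decreasing factor is replaced by its value at an end of the interval, and the remaining
  nonnegative increments telescope. The factor \<open>u - 1\<close> may become negative, but only
  its monotonicity enters.\<close>

lemma (in prob_space) exploration_inequalities:
  fixes a u v b q d :: "nat \<Rightarrow> 'a \<Rightarrow> real" and K :: real
  assumes meas [measurable]: "\<And>n. a n \<in> borel_measurable M" "\<And>n. u n \<in> borel_measurable M"
      "\<And>n. v n \<in> borel_measurable M" "\<And>n. b n \<in> borel_measurable M"
      "\<And>n. q n \<in> borel_measurable M" "\<And>n. d n \<in> borel_measurable M"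
    and a: "\<And>n w. 0 \<le> a n w" "\<And>n w. a n w \<le> 1"
    and u: "\<And>n w. 0 \<le> u n w" "\<And>n w. u n w \<le> K" and K: "1 \<le> K"
    and v: "\<And>n w. 0 \<le> v n w" "\<And>n w. v n w \<le> 1"
    and b: "\<And>n w. 0 \<le> b n w" "\<And>n w. b n w \<le> 1"
    and q: "\<And>n w. 0 \<le> q n w" "\<And>n w. q n w \<le> 1"
    and d: "\<And>n w. 0 \<le> d n w" "\<And>n w. d n w \<le> K"
    and q_antimono: "\<And>m n w. m \<le> n \<Longrightarrow> q n w \<le> q m w"
    and v_Suc: "\<And>n w. a n w * b n w = v n w - v (Suc n) w"
    and u_Suc: "AE w in M. \<forall>n. a n w * d n w = u n w - u (Suc n) w - a n w"
    and E_vb: "\<And>n. expectation (\<lambda>w. a n w * (v n w * b n w)) = expectation (\<lambda>w. a n w * q n w)"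
    and E_vd: "\<And>n. expectation (\<lambda>w. a n w * (v n w * d n w)) = expectation (\<lambda>w. a n w * ((u n w - 1) * b n w))"
    and mn: "m \<le> n"
  defines "A \<equiv> \<lambda>w. \<Sum>l=m..<n. a l w"
  shows "expectation (\<lambda>w. v n w * (v m w - v n w)) \<le> real (n - m) * expectation (q m)"
    and "expectation (\<lambda>w. A w * q n w) \<le> expectation (\<lambda>w. v m w * (v m w - v n w))"
    and "expectation (\<lambda>w. v n w * (u m w - u n w - A w)) \<le> expectation (\<lambda>w. (u m w - 1) * (v m w - v n w))"
    and "expectation (\<lambda>w. (u n w - 1) * (v m w - v n w)) \<le> expectation (\<lambda>w. v m w * (u m w - u n w - A w))"
proof -
  have [measurable]: "A \<in> borel_measurable M" unfolding A_def by measurable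
  have int_times: "integrable M (\<lambda>w. f w * g w)"
    if "f \<in> borel_measurable M" "g \<in> borel_measurable M" "\<And>w. \<bar>f w\<bar> \<le> B" "\<And>w. \<bar>g w\<bar> \<le> B'" for f g and B B' :: real
  proof (rule integrable_const_bound[where B="B * B'"])
    have "\<bar>f w\<bar> * \<bar>g w\<bar> \<le> B * B'" for w using that(3,4)[of w] by (intro mult_mono) auto
    then show "AE w in M. norm (f w * g w) \<le> B * B'" by (simp add: abs_mult)
  qed (use that in measurable)
  have A0: "0 \<le> A w" "A w \<le> real (n - m)" for w
    unfolding A_def using a sum_bounded_above[of "{m..<n}" "\<lambda>l. a l w" 1] by (auto intro!: sum_nonneg)
  have vdec: "v l w \<le> v k w" if "k \<le> l" for k l w
  proof (rule lift_Suc_antimono_le[OF _ that, of "\<lambda>l. v l w"])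
    show "v (Suc i) w \<le> v i w" for i using v_Suc[of i w] mult_nonneg_nonneg[OF a(1) b(1), of i w i w] by simp
  qed
  have udec: "AE w in M. \<forall>k l. k \<le> l \<longrightarrow> u l w \<le> u k w"
    using u_Suc
  proof eventually_elim
    case (elim w)
    have "u (Suc i) w \<le> u i w" for i
      using elim[rule_format, of i] mult_nonneg_nonneg[OF a(1) d(1), of i w i w] a(1)[of i w] by simp
    then show ?case using lift_Suc_antimono_le[of "\<lambda>l. u l w"] by blast
  qed
  have sum_ab: "(\<Sum>l=m..<n. a l w * b l w) = v m w - v n w" for w
    using sum_Suc_diff'[OF mn, of "\<lambda>l. - v l w"] by (simp add: v_Suc)
  have ab: "0 \<le> a l w * b l w" for l w using a b by simp
  have vmn: "\<bar>v m w - v n w\<bar> \<le> 2" for w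
    using v(1)[of m w] v(2)[of m w] v(1)[of n w] v(2)[of n w] by linarith
  have i_v: "integrable M (\<lambda>w. v k w * (v m w - v n w))" for k
    using v vmn by (intro int_times[of _ _ 1 2]) auto
  have i_avb: "integrable M (\<lambda>w. a l w * (v l w * b l w))" for l
    using a v b by (intro int_times[of _ _ 1 1]) (auto simp: abs_mult mult_le_one)
  have i_aq: "integrable M (\<lambda>w. a l w * q l w)" for l
    using a q by (intro int_times[of _ _ 1 1]) auto
  have i_q: "integrable M (q l)" for l
    using q by (intro integrable_const_bound[where B=1]) auto
  have vb: "expectation (\<lambda>w. \<Sum>l=m..<n. a l w * (v l w * b l w)) = expectation (\<lambda>w. \<Sum>l=m..<n. a l w * q l w)"
    by (simp add: i_avb i_aq E_vb)
  have e: "(\<Sum>l=m..<n. a l w * (g l w * b l w)) = (\<Sum>l=m..<n. g l w * (a l w * b l w))" for w and g :: "nat \<Rightarrow> 'a \<Rightarrow> real"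
    by (simp add: mult_ac)
  have vb_bounds: "v n w * (v m w - v n w) \<le> (\<Sum>l=m..<n. a l w * (v l w * b l w))"
    "(\<Sum>l=m..<n. a l w * (v l w * b l w)) \<le> v m w * (v m w - v n w)" for w
    unfolding e using sum_weighted_antimono_bounds[of "\<lambda>l. v l w" "\<lambda>l. a l w * b l w", OF vdec ab, where n=n and m=m] by (simp_all add: sum_ab)
  \<comment> \<open>The upper bound may replace the number of active steps by the number of all
    steps. The lower bound must keep \<open>A\<close>, since steps after the end of the exploration
    remove no volume.\<close>
  have q_bounds: "A w * q n w \<le> (\<Sum>l=m..<n. a l w * q l w)"
    "(\<Sum>l=m..<n. a l w * q l w) \<le> real (n - m) * q m w" for w
  proof -
    note s = sum_weighted_antimono_bounds[of "\<lambda>l. q l w" "\<lambda>l. a l w", OF q_antimono a(1), where n=n and m=m]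
    show "A w * q n w \<le> (\<Sum>l=m..<n. a l w * q l w)" using s(1) by (simp add: A_def mult.commute)
    have "q m w * A w \<le> q m w * real (n - m)" using A0 q by (intro mult_left_mono) auto
    then show "(\<Sum>l=m..<n. a l w * q l w) \<le> real (n - m) * q m w" using s(2) by (simp add: A_def mult.commute)
  qed
  have "expectation (\<lambda>w. v n w * (v m w - v n w)) \<le> expectation (\<lambda>w. \<Sum>l=m..<n. a l w * (v l w * b l w))"
    using vb_bounds(1) by (intro integral_mono i_v Bochner_Integration.integrable_sum i_avb)
  also have "\<dots> \<le> expectation (\<lambda>w. real (n - m) * q m w)"
    unfolding vb using q_bounds(2) by (intro integral_mono Bochner_Integration.integrable_sum i_aq) (auto intro: i_q)
  finally show "expectation (\<lambda>w. v n w * (v m w - v n w)) \<le> real (n - m) * expectation (q m)" by simp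
  have "integrable M (\<lambda>w. A w * q n w)"
    using A0 q by (intro int_times[of _ _ "real (n - m)" 1]) auto
  then have "expectation (\<lambda>w. A w * q n w) \<le> expectation (\<lambda>w. \<Sum>l=m..<n. a l w * q l w)"
    using q_bounds(1) by (intro integral_mono Bochner_Integration.integrable_sum i_aq)
  also have "\<dots> \<le> expectation (\<lambda>w. v m w * (v m w - v n w))"
    unfolding vb[symmetric] using vb_bounds(2) by (intro integral_mono i_v Bochner_Integration.integrable_sum i_avb)
  finally show "expectation (\<lambda>w. A w * q n w) \<le> expectation (\<lambda>w. v m w * (v m w - v n w))" .
  have i_avd: "integrable M (\<lambda>w. a l w * (v l w * d l w))" for l
  proof (rule int_times[of _ _ 1 "1 * K"])
    fix w have "v l w * d l w \<le> 1 * K" using v d K by (intro mult_mono) auto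
    then show "\<bar>v l w * d l w\<bar> \<le> 1 * K" using v d by simp
  qed (use a in auto)
  have u1: "\<bar>u l w - 1\<bar> \<le> K" for l w using u(1,2)[of l w] K by (simp add: abs_le_iff)
  have i_aub: "integrable M (\<lambda>w. a l w * ((u l w - 1) * b l w))" for l
  proof (rule int_times[of _ _ 1 "K * 1"])
    fix w show "\<bar>(u l w - 1) * b l w\<bar> \<le> K * 1" unfolding abs_mult using u1 b K by (intro mult_mono) auto
  qed (use a in auto)
  have ud: "expectation (\<lambda>w. \<Sum>l=m..<n. a l w * (v l w * d l w)) = expectation (\<lambda>w. \<Sum>l=m..<n. a l w * ((u l w - 1) * b l w))"
    by (simp add: i_avd i_aub E_vd)
  have i_u: "integrable M (\<lambda>w. (u k w - 1) * (v m w - v n w))" for k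
    using u1 vmn by (intro int_times[of _ _ K 2]) auto
  have i_vu: "integrable M (\<lambda>w. v k w * (u m w - u n w - A w))" for k
  proof (rule int_times[of _ _ 1 "2 * K + real (n - m)"])
    fix w show "\<bar>u m w - u n w - A w\<bar> \<le> 2 * K + real (n - m)"
      using u(1,2)[of m w] u(1,2)[of n w] A0[of w] K by linarith
  qed (use v in auto)
  have d_bounds: "AE w in M. v n w * (u m w - u n w - A w) \<le> (\<Sum>l=m..<n. a l w * (v l w * d l w)) \<and>
      (\<Sum>l=m..<n. a l w * (v l w * d l w)) \<le> v m w * (u m w - u n w - A w)"
    using u_Suc
  proof eventually_elim
    case (elim w)
    have "(\<Sum>l=m..<n. a l w * d l w) = (\<Sum>l=m..<n. u l w - u (Suc l) w) - A w"
      using elim by (simp add: sum_subtractf A_def)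
    also have "(\<Sum>l=m..<n. u l w - u (Suc l) w) = u m w - u n w"
      using sum_Suc_diff'[OF mn, of "\<lambda>l. - u l w"] by simp
    finally have s: "(\<Sum>l=m..<n. a l w * d l w) = u m w - u n w - A w" .
    have ad: "0 \<le> a l w * d l w" for l using a d by simp
    have e: "(\<Sum>l=m..<n. a l w * (v l w * d l w)) = (\<Sum>l=m..<n. v l w * (a l w * d l w))"
      by (simp add: mult_ac)
    show ?case unfolding e using sum_weighted_antimono_bounds[of "\<lambda>l. v l w" "\<lambda>l. a l w * d l w", OF vdec ad, where n=n and m=m] by (simp add: s)
  qed
  have u_bounds: "AE w in M. (u n w - 1) * (v m w - v n w) \<le> (\<Sum>l=m..<n. a l w * ((u l w - 1) * b l w)) \<and>
      (\<Sum>l=m..<n. a l w * ((u l w - 1) * b l w)) \<le> (u m w - 1) * (v m w - v n w)"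
    using udec
  proof eventually_elim
    case (elim w)
    have "k \<le> l \<Longrightarrow> u l w - 1 \<le> u k w - 1" for k l using elim by simp
    from sum_weighted_antimono_bounds[of "\<lambda>l. u l w - 1" "\<lambda>l. a l w * b l w", OF this ab, where n=n and m=m]
    show ?case unfolding e[of _ "\<lambda>l w. u l w - 1"] by (simp add: sum_ab)
  qed
  have "expectation (\<lambda>w. v n w * (u m w - u n w - A w)) \<le> expectation (\<lambda>w. \<Sum>l=m..<n. a l w * (v l w * d l w))"
    using d_bounds by (intro integral_mono_AE i_vu Bochner_Integration.integrable_sum i_avd) auto
  also have "\<dots> \<le> expectation (\<lambda>w. (u m w - 1) * (v m w - v n w))"
    unfolding ud using u_bounds by (intro integral_mono_AE i_u Bochner_Integration.integrable_sum i_aub) auto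
  finally show "expectation (\<lambda>w. v n w * (u m w - u n w - A w)) \<le> expectation (\<lambda>w. (u m w - 1) * (v m w - v n w))" .
  have "expectation (\<lambda>w. (u n w - 1) * (v m w - v n w)) \<le> expectation (\<lambda>w. \<Sum>l=m..<n. a l w * ((u l w - 1) * b l w))"
    using u_bounds by (intro integral_mono_AE i_u Bochner_Integration.integrable_sum i_aub) auto
  also have "\<dots> \<le> expectation (\<lambda>w. v m w * (u m w - u n w - A w))"
    unfolding ud[symmetric] using d_bounds by (intro integral_mono_AE i_vu Bochner_Integration.integrable_sum i_avd) auto
  finally show "expectation (\<lambda>w. (u n w - 1) * (v m w - v n w)) \<le> expectation (\<lambda>w. v m w * (u m w - u n w - A w))" .
qed

section \<open>Boundary effects and a lower bound for the free volume\<close>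

lemma divide_collect:
  fixes v a b c d :: real
  shows "v * (a / c - b / c - d / c) = v * (a - b - d) / c"
    and "(a / c - inverse c) * v = (a - 1) * v / c"
  by (simp_all add: diff_divide_distrib divide_inverse algebra_simps)

text \<open>The two ways in which the lower limit is used: it is attained along a subsequence, and
  any subsequence dominated by a convergent sequence bounds it from above. The index 0 is left out
  because the model is specified for positive \<open>N\<close> only.\<close>

lemma bounded_seq_liminf:
  fixes x :: "nat \<Rightarrow> real"
  assumes "\<And>n. 0 \<le> x n" "\<And>n. x n \<le> K"
  defines "L \<equiv> real_of_ereal (liminf (\<lambda>n. ereal (x n)))"
  shows "\<exists>\<phi>. strict_mono \<phi> \<and> (\<lambda>n. x (\<phi> n)) \<longlonglongrightarrow> L"
    and "strict_mono \<psi> \<Longrightarrow> w \<longlonglongrightarrow> c \<Longrightarrow> (\<And>n. 0 < n \<Longrightarrow> x (\<psi> n) \<le> w n) \<Longrightarrow> L \<le> c"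
proof -
  let ?l = "liminf (\<lambda>n. ereal (x n))"
  have "ereal 0 \<le> ?l" using assms(1) by (intro Liminf_bounded) auto
  moreover have "?l \<le> ereal K"
    using assms(2) by (intro order_trans[OF Liminf_le_Limsup Limsup_bounded]) auto
  ultimately have L: "?l = ereal L" unfolding L_def by (cases ?l) auto
  obtain \<phi> where "strict_mono \<phi>" "((\<lambda>n. ereal (x n)) \<circ> \<phi>) \<longlonglongrightarrow> ?l" using liminf_subseq_lim by blast
  then show "\<exists>\<phi>. strict_mono \<phi> \<and> (\<lambda>n. x (\<phi> n)) \<longlonglongrightarrow> L"
    unfolding L by (auto simp: o_def)
  assume \<psi>: "strict_mono \<psi>" and w: "w \<longlonglongrightarrow> c" and le: "\<And>n. 0 < n \<Longrightarrow> x (\<psi> n) \<le> w n"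
  have "?l \<le> liminf ((\<lambda>n. ereal (x n)) \<circ> \<psi>)" by (rule liminf_subseq_mono[OF \<psi>])
  also have "\<dots> \<le> liminf (\<lambda>n. ereal (w n))"
    using le by (intro Liminf_mono) (auto intro: eventually_sequentiallyI[of 1])
  also have "\<dots> = ereal c" using w by (intro lim_imp_Liminf) auto
  finally show "L \<le> c" by (simp add: L)
qed

lemma tendsto_nat_floor_div:
  assumes "0 \<le> t"
  shows "(\<lambda>N. real (nat \<lfloor>t * real N\<rfloor>) / real N) \<longlonglongrightarrow> t"
proof (rule tendsto_sandwich)
  have "(\<lambda>N. inverse (real N)) \<longlonglongrightarrow> 0" by (rule lim_inverse_n)
  then have "(\<lambda>N. t - inverse (real N)) \<longlonglongrightarrow> t - 0" by (intro tendsto_intros)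
  then show "(\<lambda>N. t - inverse (real N)) \<longlonglongrightarrow> t" by simp
  show "(\<lambda>N. t) \<longlonglongrightarrow> t" by simp
  have b: "real (nat \<lfloor>t * real N\<rfloor>) \<le> t * real N" "t * real N - 1 \<le> real (nat \<lfloor>t * real N\<rfloor>)" for N
    using assms by (auto simp: of_nat_nat)
  show "\<forall>\<^sub>F N in sequentially. t - inverse (real N) \<le> real (nat \<lfloor>t * real N\<rfloor>) / real N"
    using eventually_gt_at_top[of 0]
  proof eventually_elim
    case (elim N)
    have "(t - inverse (real N)) * real N \<le> real (nat \<lfloor>t * real N\<rfloor>)" using b(2)[of N] elim by (simp add: left_diff_distrib)
    then show ?case using elim by (simp add: pos_le_divide_eq)
  qed
  show "\<forall>\<^sub>F N in sequentially. real (nat \<lfloor>t * real N\<rfloor>) / real N \<le> t"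
    using eventually_gt_at_top[of 0]
    by eventually_elim (use b(1) in \<open>simp add: pos_divide_le_eq\<close>)
qed

lemma (in prob_space) expectation_tendsto:
  fixes f :: "nat \<Rightarrow> 'a \<Rightarrow> real"
  assumes "\<And>N. 0 < N \<Longrightarrow> f N \<in> borel_measurable M" "\<And>N w. 0 < N \<Longrightarrow> \<bar>f N w\<bar> \<le> B"
    and "AE w in M. (\<lambda>N. f N w) \<longlonglongrightarrow> c"
  shows "(\<lambda>N. expectation (f N)) \<longlonglongrightarrow> c"
proof -
  \<comment> \<open>Shifting by one discards \<open>N = 0\<close>, for which neither measurability
    nor the bound is available.\<close>
  have "(\<lambda>N. expectation (f (Suc N))) \<longlonglongrightarrow> expectation (\<lambda>_. c)"
  proof (rule integral_dominated_convergence[where w="\<lambda>_. B"])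
    show "AE w in M. (\<lambda>N. f (Suc N) w) \<longlonglongrightarrow> c"
      using assms(3) by eventually_elim (rule LIMSEQ_Suc)
  qed (use assms in auto)
  then show ?thesis by (subst (asm) filterlim_sequentially_Suc[of "\<lambda>N. expectation (f N)"]) (simp add: prob_space)
qed

lemma abs_mult_le:
  fixes a b :: real
  shows "\<bar>a\<bar> \<le> A \<Longrightarrow> \<bar>b\<bar> \<le> B \<Longrightarrow> \<bar>a * b\<bar> \<le> A * B"
  unfolding abs_mult by (intro mult_mono) auto

text \<open>Because the almost sure limits are constants, the expectation of a product tends to the
  product of the limits even though the factors are dependent.\<close>

lemma (in prob_space) expectation_mult_tendsto:
  fixes f g :: "nat \<Rightarrow> 'a \<Rightarrow> real"
  assumes f: "AE w in M. (\<lambda>N. f N w) \<longlonglongrightarrow> a" and g: "AE w in M. (\<lambda>N. g N w) \<longlonglongrightarrow> b"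
    and meas: "\<And>N. 0 < N \<Longrightarrow> f N \<in> borel_measurable M" "\<And>N. 0 < N \<Longrightarrow> g N \<in> borel_measurable M"
    and bound: "\<And>N w. 0 < N \<Longrightarrow> \<bar>f N w\<bar> \<le> A" "\<And>N w. 0 < N \<Longrightarrow> \<bar>g N w\<bar> \<le> B"
  shows "(\<lambda>N. expectation (\<lambda>w. f N w * g N w)) \<longlonglongrightarrow> a * b"
proof (rule expectation_tendsto[where B="A * B"])
  show "AE w in M. (\<lambda>N. f N w * g N w) \<longlonglongrightarrow> a * b"
    using f g by eventually_elim (rule tendsto_mult)
  show "(\<lambda>w. f N w * g N w) \<in> borel_measurable M" if "0 < N" for N
    by (intro borel_measurable_times meas that)
  show "\<bar>f N w * g N w\<bar> \<le> A * B" if "0 < N" for N w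
    by (intro abs_mult_le bound that)
qed

lemma cube_boundary:
  fixes a :: "'a::euclidean_space"
  assumes s: "0 < s" and r: "0 \<le> r"
  shows "(\<Union>c\<in>cbox a (a + s *\<^sub>R One). cball c r) \<subseteq> cbox (a - r *\<^sub>R One) (a + (s + r) *\<^sub>R One)"
    and "measure lborel (cbox (a - r *\<^sub>R One) (a + (s + r) *\<^sub>R One)) = (s + 2 * r) ^ DIM('a)"
    and "measure lborel (cbox a (a + s *\<^sub>R One)) = s ^ DIM('a)"
proof -
  show "(\<Union>c\<in>cbox a (a + s *\<^sub>R One). cball c r) \<subseteq> cbox (a - r *\<^sub>R One) (a + (s + r) *\<^sub>R One)"
  proof safe
    fix c y assume c: "c \<in> cbox a (a + s *\<^sub>R One)" and y: "y \<in> cball c r"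
    show "y \<in> cbox (a - r *\<^sub>R One) (a + (s + r) *\<^sub>R One)"
      unfolding mem_box
    proof
      fix i :: 'a assume i: "i \<in> Basis"
      have "\<bar>(y - c) \<bullet> i\<bar> \<le> r" using Basis_le_norm[OF i, of "y - c"] y by (simp add: dist_norm norm_minus_commute)
      then have "\<bar>y \<bullet> i - c \<bullet> i\<bar> \<le> r" by (simp add: inner_diff_left)
      moreover have "a \<bullet> i \<le> c \<bullet> i" "c \<bullet> i \<le> a \<bullet> i + s"
        using c i by (auto simp: mem_box inner_add_left)
      ultimately show "(a - r *\<^sub>R One) \<bullet> i \<le> y \<bullet> i \<and> y \<bullet> i \<le> (a + (s + r) *\<^sub>R One) \<bullet> i"
        using i by (simp add: inner_add_left inner_diff_left abs_le_iff)
    qed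
  qed
  have m: "measure lborel (cbox u (u + l *\<^sub>R One)) = l ^ DIM('a)" if "0 \<le> l" for u :: 'a and l :: real
  proof -
    have "measure lborel (cbox u (u + l *\<^sub>R One)) = (\<Prod>b\<in>Basis. (u + l *\<^sub>R One - u) \<bullet> b)"
      using that by (intro measure_lborel_cbox) (auto simp: inner_add_left)
    also have "\<dots> = l ^ DIM('a)" by simp
    finally show ?thesis .
  qed
  show "measure lborel (cbox a (a + s *\<^sub>R One)) = s ^ DIM('a)" using s by (intro m) simp
  have e: "a + (s + r) *\<^sub>R One = (a - r *\<^sub>R One) + (s + 2 * r) *\<^sub>R One"
    by (simp add: algebra_simps) (simp flip: scaleR_add_left)
  show "measure lborel (cbox (a - r *\<^sub>R One) (a + (s + r) *\<^sub>R One)) = (s + 2 * r) ^ DIM('a)"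
    unfolding e by (rule m) (use s r in simp)
qed

section \<open>Balls, boundary shell and the region that is never covered\<close>

context rsa_exploration
begin

text \<open>The intensity times the volume of a ball, that is, the mean number of points of the
  Poisson process in a ball. After division by \<open>N\<close> it bounds the share of the cube that
  one ball can cover.\<close>

definition ball_rate :: real where
  "ball_rate = lam * measure lborel (cball (0::'a) r)"

lemma ball_rate_nonneg: "0 \<le> ball_rate"
  using lam_pos by (simp add: ball_rate_def)

lemma measure_law:
  assumes "0 < N" "A \<in> sets borel"
  shows "measure (law N) A = measure lborel (C N \<inter> A) * lam / real N"
  using emeasure_cube[OF assms(1)] cube_borel[OF assms(1)] volume[OF assms(1)] assms lam_pos
  by (subst measure_uniform_measure) auto

lemma law_cball_le:
  assumes N: "0 < N"
  shows "measure (law N) (cball c r) \<le> ball_rate / real N"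
proof -
  have "measure lborel (C N \<inter> cball c r) \<le> measure lborel (cball c r)"
    using cube_borel[OF N] emeasure_bounded_finite[OF bounded_cball, of c r]
    by (intro measure_mono_fmeasurable) (auto simp: fmeasurable_def)
  also have "\<dots> = measure lborel (cball (0::'a) r)"
    using r_pos by (simp add: content_cball)
  finally have "measure lborel (C N \<inter> cball c r) * lam / real N \<le> measure lborel (cball (0::'a) r) * lam / real N"
    using lam_pos by (intro divide_right_mono mult_right_mono) auto
  then show ?thesis using N by (simp add: measure_law ball_rate_def mult.commute)
qed

lemma process_inequalities:
  fixes N m n :: nat
  assumes N: "0 < N" and mn: "m \<le> n"
  defines "A \<equiv> \<lambda>w. \<Sum>l=m..<n. act N l w"
  shows "expectation (\<lambda>w. vol N n w * (vol N m w - vol N n w)) \<le> real (n - m) * expectation (pvol N m)"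
    and "expectation (\<lambda>w. A w * pvol N n w) \<le> expectation (\<lambda>w. vol N m w * (vol N m w - vol N n w))"
    and "expectation (\<lambda>w. vol N n w * (num N m w - num N n w - A w)) \<le>
      expectation (\<lambda>w. (num N m w - 1) * (vol N m w - vol N n w))"
    and "expectation (\<lambda>w. (num N n w - 1) * (vol N m w - vol N n w)) \<le>
      expectation (\<lambda>w. vol N m w * (num N m w - num N n w - A w))"
proof -
  interpret L: point_law "law N" by (rule point_law_law[OF N])
  have "AE w in M. \<forall>n. act N n w * nbr N n w = num N n w - num N (Suc n) w - act N n w"
    using AE_choice_unexplored[OF N] by eventually_elim (use num_Suc in blast)
  note * = exploration_inequalities[where a="act N" and u="num N" and v="vol N" and b="bvol N" and q="pvol N"
      and d="nbr N" and K="real N", OF _ _ _ _ _ _ _ _ _ _ _ _ _ _ _ _ _ _ _ _ _ this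
        expectation_act_bvol[OF N] expectation_act_nbr[OF N] mn]
  have q: "0 \<le> pvol N k w" "pvol N k w \<le> 1" for k w
    using L.free_pair_volume_bounds[of r 1] by auto
  have N1: "1 \<le> real N" using N by simp
  note side = process_measurable[OF N] zero_less_eq_of_bool of_bool_less_eq_one of_nat_0_le_iff N1 L.free_volume_bounds L.free_ball_volume_bounds q num_le nbr_le
    L.free_pair_volume_antimono vol_Suc[OF N]
  show "expectation (\<lambda>w. vol N n w * (vol N m w - vol N n w)) \<le> real (n - m) * expectation (pvol N m)"
    by (rule *(1)) (rule side | assumption)+
  show "expectation (\<lambda>w. A w * pvol N n w) \<le> expectation (\<lambda>w. vol N m w * (vol N m w - vol N n w))"
    unfolding A_def by (rule *(2)) (rule side | assumption)+
  show "expectation (\<lambda>w. vol N n w * (num N m w - num N n w - A w)) \<le>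
      expectation (\<lambda>w. (num N m w - 1) * (vol N m w - vol N n w))"
    unfolding A_def by (rule *(3)) (rule side | assumption)+
  show "expectation (\<lambda>w. (num N n w - 1) * (vol N m w - vol N n w)) \<le>
      expectation (\<lambda>w. vol N m w * (num N m w - num N n w - A w))"
    unfolding A_def by (rule *(4)) (rule side | assumption)+
qed

lemma AE_points_in_cube:
  "AE w in M. \<forall>N i. i < N \<longrightarrow> X N i w \<in> C N"
proof -
  have "AE w in M. X N i w \<in> C N" if "i < N" for N i
  proof -
    have N: "0 < N" using that by simp
    have "AE x in law N. x \<in> C N"
      using cube_borel[OF N] emeasure_cube[OF N] by (intro AE_uniform_measureI) auto
    then show ?thesis
      unfolding points_uniform[OF that, symmetric] by (rule AE_distrD[OF X_measurable[OF that]])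
  qed
  then show ?thesis by (simp add: AE_all_countable)
qed

text \<open>The root is the side length of the cube. The value is the volume of the shell added by
  enlarging the cube by \<open>r\<close> on every side, relative to the volume of the cube.\<close>

definition boundary_fraction :: "nat \<Rightarrow> real" where
  "boundary_fraction N = (1 + 2 * r / root DIM('a) (real N / lam)) ^ DIM('a) - 1"

lemma boundary_fraction_tendsto: "boundary_fraction \<longlonglongrightarrow> 0"
proof -
  have "LIM N sequentially. root DIM('a) (real N / lam) :> at_top"
    unfolding filterlim_at_top
  proof
    fix Z :: real
    have "\<forall>\<^sub>F N in sequentially. lam * max Z 0 ^ DIM('a) \<le> real N"
      by (rule eventually_sequentiallyI[of "nat \<lceil>lam * max Z 0 ^ DIM('a)\<rceil>"]) linarith
    then show "\<forall>\<^sub>F N in sequentially. Z \<le> root DIM('a) (real N / lam)"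
    proof eventually_elim
      case (elim N)
      then have "max Z 0 ^ DIM('a) \<le> real N / lam" using lam_pos by (simp add: field_simps)
      then have "root DIM('a) (max Z 0 ^ DIM('a)) \<le> root DIM('a) (real N / lam)" by simp
      then show ?case by (simp add: real_root_power_cancel)
    qed
  qed
  then have "(\<lambda>N. 2 * r / root DIM('a) (real N / lam)) \<longlonglongrightarrow> 0"
    by (intro tendsto_divide_0[OF tendsto_const] filterlim_at_top_imp_at_infinity)
  then have "(\<lambda>N. (1 + 2 * r / root DIM('a) (real N / lam)) ^ DIM('a) - 1) \<longlonglongrightarrow> (1 + 0) ^ DIM('a) - 1"
    by (intro tendsto_intros)
  then show ?thesis by (simp add: boundary_fraction_def[abs_def])
qed

text \<open>All centres lie in the cube, so what the explored region has outside it stays in the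
  shell of width \<open>r\<close>. Inside the cube its share is \<open>1 - vol\<close>, since the
  law is uniform.\<close>

lemma explored_volume_approx:
  assumes N: "0 < N" and w: "w \<in> space M" "\<And>i. i < N \<Longrightarrow> X N i w \<in> C N"
  shows "\<bar>(\<Sum>i = 1..n. measure lborel (new_region r N (\<lambda>k. X N k w) (\<lambda>k. J N k w) i)) / measure lborel (C N)
     - (1 - vol N n w)\<bar> \<le> boundary_fraction N"
proof -
  interpret L: point_law "law N" by (rule point_law_law[OF N])
  define G where "G = {y. \<not> free r N (pos N w) (cho N w) n y}"
  have G [measurable]: "G \<in> sets borel" using free_measurable[of r N "pos N w" "cho N w" n] by (simp add: G_def pred_def)
  have [measurable]: "C N \<in> sets borel" by (rule cube_borel[OF N])
  have "{y. \<not> free r N (\<lambda>k. X N k w) (\<lambda>k. J N k w) n y} = G"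
    unfolding G_def using cho_less[OF N w(1)] free_cong[of N "\<lambda>k. X N k w" "pos N w" n "\<lambda>k. J N k w" "cho N w" r]
    by (auto simp: pos_def cho_def)
  then have sum: "(\<Sum>i = 1..n. measure lborel (new_region r N (\<lambda>k. X N k w) (\<lambda>k. J N k w) i)) = measure lborel G"
    by (simp only: sum_new_region)
  obtain a s where s: "0 < s" and C: "C N = cbox a (a + s *\<^sub>R One)" using cube[OF N] by (auto simp: is_cube_def)
  define D where "D = cbox (a - r *\<^sub>R One) (a + (s + r) *\<^sub>R One)"
  note cb = cube_boundary[OF s less_imp_le[OF r_pos], of a]
  have "G \<subseteq> (\<Union>c\<in>C N. cball c r)"
    unfolding G_def using w(2) cho_less[OF N w(1)] by (intro not_free_subset) (auto simp: pos_def)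
  then have GD: "G \<subseteq> D" using cb(1) by (simp add: C D_def)
  have CD: "C N \<subseteq> D" using r_pos s by (auto simp: C D_def subset_box inner_add_left inner_diff_left)
  have Dfin: "D \<in> fmeasurable lborel" unfolding D_def by simp
  have fin: "G \<in> fmeasurable lborel" "C N \<in> fmeasurable lborel"
    using Dfin GD CD by (auto intro: fmeasurableI2)
  have "1 - vol N n w = measure (law N) G"
    using L.prob_neg[of "\<lambda>y. free r N (pos N w) (cho N w) n y"] by (simp add: free_volume_def G_def)
  also have "\<dots> = measure lborel (C N \<inter> G) / measure lborel (C N)"
    using N lam_pos by (simp add: measure_law[OF N G] volume[OF N])
  finally have v: "1 - vol N n w = measure lborel (C N \<inter> G) / measure lborel (C N)" .
  have "G - C N = G - C N \<inter> G" by blast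
  moreover have "measure lborel (G - C N \<inter> G) = measure lborel G - measure lborel (C N \<inter> G)"
    using fin by (intro measurable_measure_Diff) auto
  ultimately have "measure lborel G = measure lborel (C N \<inter> G) + measure lborel (G - C N)" by simp
  then have e: "measure lborel G / measure lborel (C N) - (1 - vol N n w) = measure lborel (G - C N) / measure lborel (C N)"
    unfolding v by (simp add: add_divide_distrib)
  have "measure lborel (G - C N) \<le> measure lborel (D - C N)"
    using GD fin Dfin by (intro measure_mono_fmeasurable) auto
  also have "\<dots> = measure lborel D - measure lborel (C N)"
    using CD fin Dfin by (intro measurable_measure_Diff) auto
  finally have "measure lborel (G - C N) / measure lborel (C N) \<le> (measure lborel D - measure lborel (C N)) / measure lborel (C N)"
    by (intro divide_right_mono) auto
  also have "\<dots> = ((s + 2 * r) / s) ^ DIM('a) - 1"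
    using cb(2,3) s unfolding C D_def by (simp add: diff_divide_distrib power_divide)
  also have "(s + 2 * r) / s = 1 + 2 * r / root DIM('a) (real N / lam)"
  proof -
    have "s ^ DIM('a) = real N / lam" using cb(3) volume[OF N] by (simp add: C)
    then have "root DIM('a) (real N / lam) = s" using s real_root_power_cancel[of "DIM('a)" s] by simp
    then show ?thesis using s by (simp add: field_simps)
  qed
  finally have "measure lborel (G - C N) / measure lborel (C N) \<le> boundary_fraction N" by (simp add: boundary_fraction_def)
  then show ?thesis unfolding sum e by simp
qed

text \<open>A location farther than \<open>r\<close> from every sample point stays uncovered
  whatever is chosen. By independence it has this property with probability at least
  \<open>(1 - ball_rate / N) ^ N\<close>; the assumption \<open>large\<close> keeps the base
  nonnegative.\<close>

lemma expected_vol_ge: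
  assumes N: "0 < N" and large: "ball_rate \<le> real N"
  shows "(1 - ball_rate / real N) ^ N \<le> expectation (vol N n)"
proof -
  interpret L: point_law "law N" by (rule point_law_law[OF N])
  interpret S: prob_space "L.sample N" by (rule L.prob_space_sample)
  interpret P: pair_prob_space "L.sample N" "law N" by unfold_locales
  interpret PP: product_sigma_finite "\<lambda>_::nat. law N" by unfold_locales
  let ?S = "configs N :: (nat \<Rightarrow> 'a) measure"
  define f where "f x y = (of_bool (\<forall>k\<in>{..<N}. r < dist y (x k)) :: real)" for x :: "nat \<Rightarrow> 'a" and y
  define W where "W x = measure (law N) {y. \<forall>k\<in>{..<N}. r < dist y (x k)}" for x :: "nat \<Rightarrow> 'a"
  have pm: "Measurable.pred (?S \<Otimes>\<^sub>M borel) (\<lambda>p. \<forall>k\<in>{..<N}. r < dist (snd p) (fst p k))"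
    by measurable
  have pmx: "Measurable.pred borel (\<lambda>y. \<forall>k\<in>{..<N}. r < dist y (x k))" for x :: "nat \<Rightarrow> 'a"
    by measurable
  have Wm: "W \<in> borel_measurable ?S" unfolding W_def by (rule L.measure_Collect_measurable[OF pm])
  have fm: "(\<lambda>p. f (fst p) (snd p)) \<in> borel_measurable (L.sample N \<Otimes>\<^sub>M law N)"
    unfolding f_def using pm by measurable
  have "(1 - ball_rate / real N) ^ N = (\<integral>y. (1 - ball_rate / real N) ^ N \<partial>law N)"
    by (simp add: L.prob_space[unfolded L.space_eq])
  also have "\<dots> \<le> (\<integral>y. \<integral>x. f x y \<partial>L.sample N \<partial>law N)"
  proof (rule integral_mono)
    show "integrable (law N) (\<lambda>y. \<integral>x. f x y \<partial>L.sample N)"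
      using P.integrable_snd[of f] L.integrable_bounded_sample[OF fm, of 1] by (simp add: f_def case_prod_beta')
    fix y
    have "(\<integral>x. f x y \<partial>L.sample N) = (\<integral>x. indicator (PiE {..<N} (\<lambda>_. - cball y r)) x \<partial>L.sample N)"
      by (intro Bochner_Integration.integral_cong refl)
         (auto simp: f_def indicator_def space_PiM PiE_iff not_le)
    also have "\<dots> = measure (L.sample N) (PiE {..<N} (\<lambda>_. - cball y r))"
      by (simp add: sets_PiM_I_finite)
    also have "\<dots> = (\<Prod>k<N. measure (law N) (- cball y r))"
      unfolding measure_def by (subst PP.emeasure_PiM) (auto simp: L.emeasure_eq_measure prod_ennreal ennreal_power)
    also have "\<dots> = (1 - measure (law N) (cball y r)) ^ N"
      using L.prob_compl[of "cball y r"] by (simp add: Compl_eq_Diff_UNIV)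
    finally show "(1 - ball_rate / real N) ^ N \<le> (\<integral>x. f x y \<partial>L.sample N)"
      using law_cball_le[OF N, of y] large N by (simp add: power_mono)
  qed simp
  also have "\<dots> = (\<integral>x. \<integral>y. f x y \<partial>law N \<partial>L.sample N)"
    using P.Fubini_integral[of f] L.integrable_bounded_sample[OF fm, of 1] by (simp add: f_def case_prod_beta')
  also have "\<dots> = (\<integral>x. W x \<partial>L.sample N)"
    unfolding f_def W_def by (simp add: L.integral_of_bool[OF pmx])
  also have "\<dots> = expectation (\<lambda>w. W (pos N w))"
    by (rule expectation_pos[OF N Wm, symmetric])
  also have "\<dots> \<le> expectation (vol N n)"
  proof (rule integral_mono)
    show "integrable M (\<lambda>w. W (pos N w))"
      using measurable_compose[OF pos_measurable[OF N] Wm]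
      by (intro integrable_const_bound[where B=1]) (auto simp: W_def)
    show "integrable M (vol N n)"
      using process_measurable(3)[OF N] L.free_volume_bounds by (intro integrable_const_bound[where B=1]) auto
    fix w assume w: "w \<in> space M"
    have "free r N (pos N w) (cho N w) n y" if "\<forall>k\<in>{..<N}. r < dist y (pos N w k)" for y
      using that cho_less[OF N w] by (induction n) auto
    moreover have "{y. free r N (pos N w) (cho N w) n y} \<in> sets (law N)"
      using free_measurable[of r N "pos N w" "cho N w" n] by (simp add: pred_def)
    ultimately show "W (pos N w) \<le> vol N n w"
      unfolding W_def free_volume_def by (intro L.finite_measure_mono) auto
  qed
  finally show ?thesis .
qed

end

section \<open>Passage to the limit\<close>

lemma (in rsa_exploration) AE_num_tendsto:
  assumes "0 \<le> t" and "converges_AE_L1 M (explored_fraction r X J t) c"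
  shows "AE w in M. (\<lambda>N. num N (nat \<lfloor>t * real N\<rfloor>) w / real N) \<longlonglongrightarrow> 1 - c"
proof -
  have "AE w in M. (\<lambda>N. explored_fraction r X J t N w) \<longlonglongrightarrow> c"
    using assms(2) by (simp add: converges_AE_L1_def)
  then show ?thesis
  proof (rule AE_mp, intro AE_I2 impI)
    fix w assume w: "w \<in> space M" and "(\<lambda>N. explored_fraction r X J t N w) \<longlonglongrightarrow> c"
    then have "(\<lambda>N. 1 - explored_fraction r X J t N w) \<longlonglongrightarrow> 1 - c" by (intro tendsto_intros)
    moreover have "\<forall>\<^sub>F N in sequentially. 1 - explored_fraction r X J t N w = num N (nat \<lfloor>t * real N\<rfloor>) w / real N"
      using eventually_gt_at_top[of 0]
    proof eventually_elim
      case (elim N)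
      have "card (unexplored r N (\<lambda>k. X N k w) (\<lambda>k. J N k w) (nat \<lfloor>t * real N\<rfloor>)) +
          num_explored r N (\<lambda>k. X N k w) (\<lambda>k. J N k w) (nat \<lfloor>t * real N\<rfloor>) = N"
        using cho_less[OF elim w] by (intro card_unexplored) (auto simp: cho_def)
      then have "num N (nat \<lfloor>t * real N\<rfloor>) w + real (num_explored r N (\<lambda>k. X N k w) (\<lambda>k. J N k w) (nat \<lfloor>t * real N\<rfloor>)) = real N"
        unfolding unexplored_pos_cho[OF elim w] by (simp flip: of_nat_add)
      then show ?case using elim by (simp add: explored_fraction_def field_simps)
    qed
    ultimately show "(\<lambda>N. num N (nat \<lfloor>t * real N\<rfloor>) w / real N) \<longlonglongrightarrow> 1 - c"
      by (rule Lim_transform_eventually)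
  qed
qed

lemma (in rsa_exploration) AE_vol_tendsto:
  assumes "converges_AE_L1 M (explored_volume_fraction r C X J t) c"
  shows "AE w in M. (\<lambda>N. vol N (nat \<lfloor>t * real N\<rfloor>) w) \<longlonglongrightarrow> 1 - c"
proof -
  have "AE w in M. (\<lambda>N. explored_volume_fraction r C X J t N w) \<longlonglongrightarrow> c"
    using assms by (simp add: converges_AE_L1_def)
  with AE_points_in_cube show ?thesis
  proof (rule AE_mp[OF AE_conjI], intro AE_I2 impI, elim conjE)
    fix w assume w: "w \<in> space M" and C: "\<forall>N i. i < N \<longrightarrow> X N i w \<in> C N"
      and lim: "(\<lambda>N. explored_volume_fraction r C X J t N w) \<longlonglongrightarrow> c"
    let ?d = "\<lambda>N. explored_volume_fraction r C X J t N w - (1 - vol N (nat \<lfloor>t * real N\<rfloor>) w)"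
    have "?d \<longlonglongrightarrow> 0"
    proof (rule Lim_null_comparison[OF _ boundary_fraction_tendsto])
      show "\<forall>\<^sub>F N in sequentially. norm (?d N) \<le> boundary_fraction N"
        using eventually_gt_at_top[of 0]
        by eventually_elim (use explored_volume_approx[OF _ w] C in \<open>simp add: explored_volume_fraction_def\<close>)
    qed
    from tendsto_diff[OF tendsto_add[OF tendsto_const[of 1] this] lim]
    show "(\<lambda>N. vol N (nat \<lfloor>t * real N\<rfloor>) w) \<longlonglongrightarrow> 1 - c" by simp
  qed
qed

section \<open>Integrated inequalities for the limit functions\<close>

locale rsa_limit = rsa_exploration M lam r C X J
  for M :: "'w measure" and lam r :: real and C :: "nat \<Rightarrow> 'a::euclidean_space set"
    and X :: "nat \<Rightarrow> nat \<Rightarrow> 'w \<Rightarrow> 'a" and J :: "nat \<Rightarrow> nat \<Rightarrow> 'w \<Rightarrow> nat" +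
  fixes z \<eta> :: "real \<Rightarrow> real"
  assumes z_range: "\<And>t. 0 \<le> t \<Longrightarrow> z t \<in> {0..1}"
    and eta_range: "\<And>t. 0 \<le> t \<Longrightarrow> \<eta> t \<in> {0..1}"
    and z_limit: "\<And>t. 0 \<le> t \<Longrightarrow> converges_AE_L1 M (explored_fraction r X J t) (z t)"
    and eta_limit: "\<And>t. 0 \<le> t \<Longrightarrow> converges_AE_L1 M (explored_volume_fraction r C X J t) (\<eta> t)"
begin

definition step :: "real \<Rightarrow> nat \<Rightarrow> nat" where
  "step t N = nat \<lfloor>t * real N\<rfloor>"

lemma step_mono: "s \<le> t \<Longrightarrow> step s N \<le> step t N"
  unfolding step_def by (intro nat_mono floor_mono mult_right_mono) auto

lemma step_tendsto: "0 \<le> t \<Longrightarrow> (\<lambda>N. real (step t N) / real N) \<longlonglongrightarrow> t"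
  unfolding step_def by (rule tendsto_nat_floor_div)

lemma num_tendsto: "0 \<le> t \<Longrightarrow> AE w in M. (\<lambda>N. num N (step t N) w / real N) \<longlonglongrightarrow> 1 - z t"
  unfolding step_def by (intro AE_num_tendsto z_limit)

lemma vol_tendsto: "0 \<le> t \<Longrightarrow> AE w in M. (\<lambda>N. vol N (step t N) w) \<longlonglongrightarrow> 1 - \<eta> t"
  unfolding step_def by (intro AE_vol_tendsto eta_limit)

lemma vol_bounds: "0 < N \<Longrightarrow> 0 \<le> vol N n w" "0 < N \<Longrightarrow> vol N n w \<le> 1"
  using point_law.free_volume_bounds[OF point_law_law] by auto

lemma pvol_bounds: "0 < N \<Longrightarrow> 0 \<le> pvol N n w" "0 < N \<Longrightarrow> pvol N n w \<le> ball_rate / real N"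
  using point_law.free_pair_volume_bounds[OF point_law_law law_cball_le] by auto

lemma vol_antimono: "0 < N \<Longrightarrow> m \<le> n \<Longrightarrow> vol N n w \<le> vol N m w"
  using point_law.free_volume_antimono[OF point_law_law] by auto

lemma num_antimono: "m \<le> n \<Longrightarrow> num N n w \<le> num N m w"
  using card_mono[OF finite_unexplored unexplored_antimono] by auto

lemma integrable_pvol: "0 < N \<Longrightarrow> integrable M (pvol N n)"
  using process_measurable(4) pvol_bounds by (intro integrable_const_bound[where B="ball_rate / real N"]) auto

lemma integrable_vol: "0 < N \<Longrightarrow> integrable M (vol N n)"
  using process_measurable(3) vol_bounds by (intro integrable_const_bound[where B=1]) auto

lemma expectation_vol_tendsto: "0 \<le> t \<Longrightarrow> (\<lambda>N. expectation (vol N (step t N))) \<longlonglongrightarrow> 1 - \<eta> t"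
  using process_measurable(3) vol_bounds by (intro expectation_tendsto[where B=1] vol_tendsto) auto

lemma eta_le: "0 \<le> t \<Longrightarrow> \<eta> t \<le> 1 - exp (- ball_rate)"
proof -
  assume t: "0 \<le> t"
  have "(\<lambda>N. (1 + (- ball_rate) / real N) ^ N) \<longlonglongrightarrow> exp (- ball_rate)"
    by (rule tendsto_exp_limit_sequentially)
  moreover have "\<forall>\<^sub>F N in sequentially. (1 + (- ball_rate) / real N) ^ N \<le> expectation (vol N (step t N))"
  proof (rule eventually_sequentiallyI[of "Suc (nat \<lceil>ball_rate\<rceil>)"])
    fix N assume "Suc (nat \<lceil>ball_rate\<rceil>) \<le> N"
    then have "0 < N" "ball_rate \<le> real N" by linarith+
    then show "(1 + (- ball_rate) / real N) ^ N \<le> expectation (vol N (step t N))"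
      using expected_vol_ge by simp
  qed
  ultimately have "exp (- ball_rate) \<le> 1 - \<eta> t"
    using expectation_vol_tendsto[OF t] by (intro tendsto_le[OF sequentially_bot])
  then show ?thesis by simp
qed

text \<open>At most one ball is added per step, and it covers at most \<open>ball_rate / N\<close>
  of the cube; about \<open>(t - s) N\<close> steps fall between the two times.\<close>

lemma eta_increment:
  assumes st: "0 \<le> s" "s \<le> t"
  shows "0 \<le> \<eta> t - \<eta> s" "\<eta> t - \<eta> s \<le> ball_rate * (t - s)"
proof -
  have t: "0 \<le> t" using st by simp
  have lim: "(\<lambda>N. expectation (vol N (step s N)) - expectation (vol N (step t N))) \<longlonglongrightarrow> (1 - \<eta> s) - (1 - \<eta> t)"
    by (intro tendsto_diff expectation_vol_tendsto st t)
  have "\<forall>\<^sub>F N in sequentially. 0 \<le> expectation (vol N (step s N)) - expectation (vol N (step t N))"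
    using eventually_gt_at_top[of 0]
    by eventually_elim (use vol_antimono step_mono[OF st(2)] in \<open>auto intro!: integral_mono integrable_vol\<close>)
  from tendsto_le[OF sequentially_bot lim tendsto_const this] show "0 \<le> \<eta> t - \<eta> s" by simp
  have lim2: "(\<lambda>N. ball_rate * (real (step t N) / real N - real (step s N) / real N)) \<longlonglongrightarrow> ball_rate * (t - s)"
    by (intro tendsto_intros step_tendsto st t)
  have "\<forall>\<^sub>F N in sequentially. expectation (vol N (step s N)) - expectation (vol N (step t N)) \<le>
      ball_rate * (real (step t N) / real N - real (step s N) / real N)"
    using eventually_gt_at_top[of 0]
  proof eventually_elim
    case (elim N)
    interpret L: point_law "law N" by (rule point_law_law[OF elim])
    have step: "vol N n w - vol N (Suc n) w \<le> ball_rate / real N" for n w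
      using L.free_ball_volume_le[OF law_cball_le[OF elim], where N=N and x="pos N w" and j="cho N w" and n=n
          and c="pos N w (cho N w (Suc n))"]
        ball_rate_nonneg vol_Suc[OF elim, where n=n and w=w]
      by (cases "unex N n w = {}") simp_all
    have "vol N m w - vol N (m + k) w \<le> real k * (ball_rate / real N)" for m k w
    proof (induction k)
      case (Suc k)
      then show ?case using step[of w "m + k"] by (simp add: distrib_right add_divide_distrib)
    qed simp
    from this[of _ "step s N" "step t N - step s N"]
    have "vol N (step s N) w \<le> vol N (step t N) w + real (step t N - step s N) * (ball_rate / real N)" for w
      using step_mono[OF st(2), of N] by (simp add: algebra_simps)
    then have "expectation (vol N (step s N)) \<le> expectation (\<lambda>w. vol N (step t N) w + real (step t N - step s N) * (ball_rate / real N))"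
      by (intro integral_mono integrable_vol[OF elim] Bochner_Integration.integrable_add integrable_const)
    then show ?case using integrable_vol[OF elim] step_mono[OF st(2), of N]
      by (simp add: prob_space of_nat_diff algebra_simps diff_divide_distrib)
  qed
  from tendsto_le[OF sequentially_bot lim2 lim this] show "\<eta> t - \<eta> s \<le> ball_rate * (t - s)" by simp
qed

lemma active_sum_bounds: "0 \<le> (\<Sum>l=m..<n. act N l w)" "(\<Sum>l=m..<n. act N l w) \<le> real (n - m)"
  using sum_bounded_above[of "{m..<n}" "\<lambda>l. act N l w" 1] by (auto intro!: sum_nonneg)

lemma active_sum_measurable: "0 < N \<Longrightarrow> (\<lambda>w. \<Sum>l=m..<n. act N l w) \<in> borel_measurable M"
  using process_measurable(1) by (intro borel_measurable_sum)

text \<open>Asymptotically all of the first \<open>t N\<close> steps still find an unexplored point.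
  This turns the number of active steps in an interval into elapsed time.\<close>

definition active_until :: "real \<Rightarrow> bool" where
  "active_until t \<longleftrightarrow> (AE w in M. (\<lambda>N. (\<Sum>l<step t N. act N l w) / real N) \<longlonglongrightarrow> t)"

lemma active_interval_tendsto:
  assumes "s \<le> t" "active_until s" "active_until t"
  shows "AE w in M. (\<lambda>N. (\<Sum>l=step s N..<step t N. act N l w) / real N) \<longlonglongrightarrow> t - s"
  using assms(2,3) unfolding active_until_def
proof eventually_elim
  case (elim w)
  have "(\<Sum>l=step s N..<step t N. act N l w) / real N = (\<Sum>l<step t N. act N l w) / real N - (\<Sum>l<step s N. act N l w) / real N" for N
  proof -
    have "{..<step t N} = {..<step s N} \<union> {step s N..<step t N}" using step_mono[OF assms(1), of N] by auto
    then have "(\<Sum>l<step t N. act N l w) = (\<Sum>l\<in>{..<step s N} \<union> {step s N..<step t N}. act N l w)"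
      by (rule sum.cong) (rule refl)
    also have "\<dots> = (\<Sum>l<step s N. act N l w) + (\<Sum>l=step s N..<step t N. act N l w)"
      by (intro sum.union_disjoint) auto
    finally show ?thesis by (simp only: diff_divide_distrib[symmetric]) simp
  qed
  then show ?case using tendsto_diff[OF elim(2,1)] by (simp only:)
qed

lemma num_div_bounds: "0 \<le> num N n w / real N" "num N n w / real N \<le> 1"
  using num_le[where N=N and n=n and w=w] by (auto simp: divide_le_eq_1)

lemma active_fraction_bounds:
  assumes "0 \<le> t"
  shows "\<bar>(\<Sum>l=step s N..<step t N. act N l w) / real N\<bar> \<le> t"
proof (cases "N = 0")
  case False
  have "real (step t N) \<le> t * real N" using assms by (simp add: step_def)
  moreover have "real (step t N - step s N) \<le> real (step t N)" by simp
  ultimately have "(\<Sum>l=step s N..<step t N. act N l w) \<le> t * real N"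
    using active_sum_bounds(2)[where N=N and m="step s N" and n="step t N" and w=w] by linarith
  then show ?thesis using active_sum_bounds(1)[where N=N and m="step s N" and n="step t N" and w=w] False
    by (simp add: pos_divide_le_eq)
qed (use assms in simp)

lemma num_diff_bound: "\<bar>num N m w / real N - num N n w / real N\<bar> \<le> 1"
  using num_div_bounds[where N=N and n=m and w=w] num_div_bounds[where N=N and n=n and w=w] by linarith

lemma vol_diff_bound: "0 < N \<Longrightarrow> \<bar>vol N m w - vol N n w\<bar> \<le> 1"
  using vol_bounds[where N=N and n=m and w=w] vol_bounds[where N=N and n=n and w=w] by linarith

lemma vol_diff_tendsto:
  assumes "0 \<le> s" "0 \<le> t"
  shows "AE w in M. (\<lambda>N. vol N (step s N) w - vol N (step t N) w) \<longlonglongrightarrow> \<eta> t - \<eta> s"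
  using vol_tendsto[OF assms(1)] vol_tendsto[OF assms(2)]
proof eventually_elim
  case (elim w)
  from tendsto_diff[OF elim] show ?case by simp
qed

lemma num_measurable: "0 < N \<Longrightarrow> (\<lambda>w. num N n w / real N) \<in> borel_measurable M"
  by (intro borel_measurable_divide process_measurable(2) borel_measurable_const)

text \<open>\<open>A\<close> is left general because it is used both with the fraction of active
  steps and, where nothing is known about activity, with zero.\<close>

lemma expectation_vol_num_tendsto:
  assumes st: "0 \<le> s" "0 \<le> t" and k: "0 \<le> k" and ae: "AE w in M. (\<lambda>N. A N w) \<longlonglongrightarrow> a"
    and A: "\<And>N. 0 < N \<Longrightarrow> A N \<in> borel_measurable M" "\<And>N w. 0 < N \<Longrightarrow> \<bar>A N w\<bar> \<le> B"
  shows "(\<lambda>N. expectation (\<lambda>w. vol N (step k N) w * (num N (step s N) w / real N - num N (step t N) w / real N - A N w)))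
    \<longlonglongrightarrow> (1 - \<eta> k) * (z t - z s - a)"
proof (rule expectation_mult_tendsto[OF vol_tendsto[OF k], where A=1 and B="1 + B"])
  show "AE w in M. (\<lambda>N. num N (step s N) w / real N - num N (step t N) w / real N - A N w) \<longlonglongrightarrow> z t - z s - a"
    using num_tendsto[OF st(1)] num_tendsto[OF st(2)] ae
  proof eventually_elim
    case (elim w)
    from tendsto_diff[OF tendsto_diff[OF elim(1,2)] elim(3)] show ?case by simp
  qed
  fix N w assume N: "(0::nat) < N"
  show "\<bar>vol N (step k N) w\<bar> \<le> 1" using vol_bounds[OF N] by simp
  show "\<bar>num N (step s N) w / real N - num N (step t N) w / real N - A N w\<bar> \<le> 1 + B"
    using A(2)[OF N, of w] num_diff_bound[where N=N and m="step s N" and n="step t N" and w=w] by linarith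
qed (intro process_measurable(3) borel_measurable_diff num_measurable A(1); assumption)+

lemma expectation_num_vol_tendsto:
  assumes st: "0 \<le> s" "0 \<le> t" and k: "0 \<le> k"
  shows "(\<lambda>N. expectation (\<lambda>w. (num N (step k N) w / real N - inverse (real N)) * (vol N (step s N) w - vol N (step t N) w)))
    \<longlonglongrightarrow> (1 - z k) * (\<eta> t - \<eta> s)"
proof (rule expectation_mult_tendsto[OF _ vol_diff_tendsto[OF st], where A=1 and B=1])
  \<comment> \<open>The term \<open>inverse (real N)\<close> is the \<open>- 1\<close> from the
    chosen point after division by \<open>N\<close>; it disappears in the limit.\<close>
  show "AE w in M. (\<lambda>N. num N (step k N) w / real N - inverse (real N)) \<longlonglongrightarrow> 1 - z k"
    using num_tendsto[OF k]
  proof eventually_elim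
    case (elim w)
    from tendsto_diff[OF elim lim_inverse_n] show ?case by simp
  qed
  fix N w assume N: "(0::nat) < N"
  have "0 \<le> inverse (real N)" "inverse (real N) \<le> 1" using N by (auto simp: inverse_le_1_iff)
  then show "\<bar>num N (step k N) w / real N - inverse (real N)\<bar> \<le> 1"
    using num_div_bounds[where N=N and n="step k N" and w=w] by linarith
qed (intro vol_diff_bound process_measurable(3) borel_measurable_diff num_measurable borel_measurable_const; assumption)+

lemma scaled_expectations:
  fixes N :: nat
  assumes "0 < N"
  shows "expectation (\<lambda>w. vol N k w * (num N m w / real N - num N n w / real N - (\<Sum>l=m..<n. act N l w) / real N)) =
      expectation (\<lambda>w. vol N k w * (num N m w - num N n w - (\<Sum>l=m..<n. act N l w))) / real N"
    and "expectation (\<lambda>w. (num N k w / real N - inverse (real N)) * (vol N m w - vol N n w)) =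
      expectation (\<lambda>w. (num N k w - 1) * (vol N m w - vol N n w)) / real N"
  by (simp_all only: divide_collect integral_divide_zero)

lemma z_upper:
  assumes st: "0 \<le> s" "s \<le> t" and sat: "active_until s" "active_until t"
  shows "(1 - \<eta> t) * (z t - z s - (t - s)) \<le> (1 - z s) * (\<eta> t - \<eta> s)"
proof -
  have t: "0 \<le> t" using st by simp
  have l: "(\<lambda>N. expectation (\<lambda>w. vol N (step t N) w * (num N (step s N) w / real N - num N (step t N) w / real N - (\<Sum>l=step s N..<step t N. act N l w) / real N)))
    \<longlonglongrightarrow> (1 - \<eta> t) * (z t - z s - (t - s))"
    by (rule expectation_vol_num_tendsto[OF st(1) t t active_interval_tendsto[OF st(2) sat] _ active_fraction_bounds[OF t]])
      (intro borel_measurable_divide active_sum_measurable borel_measurable_const)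
  show ?thesis
    by (rule tendsto_le[OF sequentially_bot expectation_num_vol_tendsto[OF st(1) t st(1)] l], rule eventually_sequentiallyI[of 1])
      (use process_inequalities(3)[OF _ step_mono[OF st(2)]] in \<open>auto simp only: scaled_expectations intro!: divide_right_mono\<close>)
qed

lemma z_lower:
  assumes st: "0 \<le> s" "s \<le> t" and sat: "active_until s" "active_until t"
  shows "(1 - z t) * (\<eta> t - \<eta> s) \<le> (1 - \<eta> s) * (z t - z s - (t - s))"
proof -
  have t: "0 \<le> t" using st by simp
  have l: "(\<lambda>N. expectation (\<lambda>w. vol N (step s N) w * (num N (step s N) w / real N - num N (step t N) w / real N - (\<Sum>l=step s N..<step t N. act N l w) / real N)))
    \<longlonglongrightarrow> (1 - \<eta> s) * (z t - z s - (t - s))"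
    by (rule expectation_vol_num_tendsto[OF st(1) t st(1) active_interval_tendsto[OF st(2) sat] _ active_fraction_bounds[OF t]])
      (intro borel_measurable_divide active_sum_measurable borel_measurable_const)
  show ?thesis
    by (rule tendsto_le[OF sequentially_bot l expectation_num_vol_tendsto[OF st(1) t t]], rule eventually_sequentiallyI[of 1])
      (use process_inequalities(4)[OF _ step_mono[OF st(2)]] in \<open>auto simp only: scaled_expectations intro!: divide_right_mono\<close>)
qed

text \<open>Activity is not assumed here: the number of active steps is only estimated by the number
  of all steps, which costs at most \<open>t - s\<close> in the limit. The bound gives the Lipschitz
  property of \<open>z\<close> and applies at any time with \<open>z t = 1\<close>, which the
  positivity of \<open>T_star\<close> requires.\<close>

lemma z_increment:
  assumes st: "0 \<le> s" "s \<le> t"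
  shows "0 \<le> z t - z s" "(1 - \<eta> t) * (z t - z s) \<le> (\<eta> t - \<eta> s) + (t - s)"
proof -
  have t: "0 \<le> t" using st by simp
  have "AE w in M. z s \<le> z t"
    using num_tendsto[OF st(1)] num_tendsto[OF t]
  proof eventually_elim
    case (elim w)
    have "1 - z t \<le> 1 - z s"
      by (rule tendsto_le[OF sequentially_bot elim], rule always_eventually)
        (use num_antimono step_mono[OF st(2)] in \<open>auto intro!: divide_right_mono\<close>)
    then show ?case by simp
  qed
  then show "0 \<le> z t - z s" by simp
  let ?d = "\<lambda>N. real (step t N) / real N - real (step s N) / real N"
  have "(\<lambda>N. expectation (\<lambda>w. vol N (step t N) w * (num N (step s N) w / real N - num N (step t N) w / real N - 0)) - ?d N)
    \<longlonglongrightarrow> (1 - \<eta> t) * (z t - z s - 0) - (t - s)"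
    by (intro tendsto_diff step_tendsto st t expectation_vol_num_tendsto[where B=0]) auto
  moreover have "\<forall>\<^sub>F N in sequentially. expectation (\<lambda>w. vol N (step t N) w * (num N (step s N) w / real N - num N (step t N) w / real N - 0)) - ?d N \<le>
    expectation (\<lambda>w. (num N (step s N) w / real N - inverse (real N)) * (vol N (step s N) w - vol N (step t N) w))"
    using eventually_gt_at_top[of 0]
  proof eventually_elim
    case (elim N)
    let ?A = "\<lambda>w. \<Sum>l=step s N..<step t N. act N l w"
    let ?f = "\<lambda>w. vol N (step t N) w * (num N (step s N) w / real N - num N (step t N) w / real N - 0)"
    let ?g = "\<lambda>w. vol N (step t N) w * (num N (step s N) w / real N - num N (step t N) w / real N - ?A w / real N)"
    have d: "?d N = real (step t N - step s N) / real N"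
      using step_mono[OF st(2), of N] by (simp add: of_nat_diff diff_divide_distrib)
    have fi: "integrable M ?f"
    proof (rule integrable_const_bound[where B="1 * 1"])
      have "\<bar>?f w\<bar> \<le> 1 * 1" for w
        using vol_bounds[OF elim] num_diff_bound by (intro abs_mult_le) auto
      then show "AE w in M. norm (?f w) \<le> 1 * 1" by simp
    qed (intro borel_measurable_times borel_measurable_diff borel_measurable_divide process_measurable(2,3)[OF elim] borel_measurable_const)
    have gi: "integrable M ?g"
    proof (rule integrable_const_bound[where B="1 * (1 + t)"])
      have "\<bar>num N (step s N) w / real N - num N (step t N) w / real N - ?A w / real N\<bar> \<le> 1 + t" for w
        using num_diff_bound[where N=N and m="step s N" and n="step t N" and w=w] active_fraction_bounds[OF t, where s=s and N=N and w=w] by linarith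
      then have "\<bar>?g w\<bar> \<le> 1 * (1 + t)" for w
        using vol_bounds[OF elim] by (intro abs_mult_le) auto
      then show "AE w in M. norm (?g w) \<le> 1 * (1 + t)" by simp
    qed (intro borel_measurable_times borel_measurable_diff borel_measurable_divide process_measurable(2,3)[OF elim] active_sum_measurable[OF elim] borel_measurable_const)
    have "?f w - ?d N \<le> ?g w" for w
    proof -
      have "?A w / real N \<le> ?d N" unfolding d
        using active_sum_bounds(2)[where N=N and m="step s N" and n="step t N" and w=w] by (intro divide_right_mono) auto
      moreover have "vol N (step t N) w * (?A w / real N) \<le> 1 * (?A w / real N)"
        using vol_bounds[OF elim] active_sum_bounds(1)[where N=N and m="step s N" and n="step t N" and w=w]
        by (intro mult_right_mono) auto
      ultimately show ?thesis by (simp add: right_diff_distrib)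
    qed
    then have "expectation (\<lambda>w. ?f w - ?d N) \<le> expectation ?g"
      using fi gi by (intro integral_mono) auto
    moreover have "expectation (\<lambda>w. ?f w - ?d N) = expectation ?f - ?d N"
      by (subst Bochner_Integration.integral_diff[OF fi]) (simp_all add: prob_space)
    moreover have "expectation ?g \<le> expectation (\<lambda>w. (num N (step s N) w / real N - inverse (real N)) * (vol N (step s N) w - vol N (step t N) w))"
      unfolding scaled_expectations[OF elim]
      using process_inequalities(3)[OF elim step_mono[OF st(2)]] by (intro divide_right_mono) auto
    ultimately show ?case by simp
  qed
  ultimately have "(1 - \<eta> t) * (z t - z s - 0) - (t - s) \<le> (1 - z s) * (\<eta> t - \<eta> s)"
    using expectation_num_vol_tendsto[OF st(1) t st(1)] by (intro tendsto_le[OF sequentially_bot])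
  moreover have "(1 - z s) * (\<eta> t - \<eta> s) \<le> 1 * (\<eta> t - \<eta> s)"
    using z_range[OF st(1)] eta_increment(1)[OF st] by (intro mult_right_mono) auto
  ultimately show "(1 - \<eta> t) * (z t - z s) \<le> (\<eta> t - \<eta> s) + (t - s)" by simp
qed

text \<open>The pair volume is of order \<open>1 / N\<close>, as one ball covers a share of that
  order; the factor \<open>N\<close> brings it to order 1.\<close>

definition rate_seq :: "real \<Rightarrow> nat \<Rightarrow> real" where
  "rate_seq t N = real N * expectation (pvol N (step t N))"

text \<open>Convergence of \<open>rate_seq\<close> is never needed: the inequalities below hold for the lower limit.\<close>

definition rate :: "real \<Rightarrow> real" where
  "rate t = real_of_ereal (liminf (\<lambda>N. ereal (rate_seq t N)))"

lemma rate_seq_bounds: "0 \<le> rate_seq t N" "rate_seq t N \<le> ball_rate"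
proof -
  have "0 \<le> rate_seq t N \<and> rate_seq t N \<le> ball_rate"
  proof (cases "N = 0")
    case False
    then have N: "0 < N" by simp
    have "expectation (pvol N (step t N)) \<le> expectation (\<lambda>_. ball_rate / real N)"
      using pvol_bounds[OF N] by (intro integral_mono integrable_pvol N) auto
    moreover have "0 \<le> expectation (pvol N (step t N))"
      using pvol_bounds[OF N] by (intro integral_nonneg_AE) auto
    ultimately show ?thesis using N by (simp add: rate_seq_def prob_space field_simps)
  qed (simp add: rate_seq_def ball_rate_nonneg)
  then show "0 \<le> rate_seq t N" "rate_seq t N \<le> ball_rate" by auto
qed

lemma rate_subseq: "\<exists>\<phi>. strict_mono \<phi> \<and> (\<lambda>n. rate_seq t (\<phi> n)) \<longlonglongrightarrow> rate t"
  unfolding rate_def by (rule bounded_seq_liminf(1)) (rule rate_seq_bounds)+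

lemma rate_le:
  assumes "strict_mono \<psi>" "w \<longlonglongrightarrow> c" "\<And>n. 0 < n \<Longrightarrow> rate_seq t (\<psi> n) \<le> w n"
  shows "rate t \<le> c"
  unfolding rate_def by (rule bounded_seq_liminf(2)[OF _ _ assms(1,2)]) (rule rate_seq_bounds assms(3) | assumption)+

text \<open>Each comparison passes to a subsequence along which the sequence on the larger side
  attains its lower limit. The pointwise inequality between the two sequences then bounds the other
  lower limit.\<close>

lemma rate_increment:
  assumes st: "0 \<le> s" "s \<le> t"
  shows "rate t \<le> rate s" "rate s \<le> rate t + 2 * ball_rate * (\<eta> t - \<eta> s)"
proof -
  have t: "0 \<le> t" using st by simp
  have le: "rate_seq t N \<le> rate_seq s N" if N: "0 < N" for N
  proof -
    have "expectation (pvol N (step t N)) \<le> expectation (pvol N (step s N))"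
      using point_law.free_pair_volume_antimono[OF point_law_law[OF N] step_mono[OF st(2)]]
      by (intro integral_mono integrable_pvol N)
    then show ?thesis by (simp add: rate_seq_def mult_left_mono)
  qed
  obtain \<phi> where \<phi>: "strict_mono \<phi>" "(\<lambda>n. rate_seq s (\<phi> n)) \<longlonglongrightarrow> rate s" using rate_subseq by blast
  have pos: "0 < \<psi> n" if "strict_mono \<psi>" "0 < n" for \<psi> :: "nat \<Rightarrow> nat" and n
    using seq_suble[OF that(1), of n] that(2) by simp
  show "rate t \<le> rate s" by (rule rate_le[OF \<phi>]) (use le pos[OF \<phi>(1)] in blast)
  obtain \<psi> where \<psi>: "strict_mono \<psi>" "(\<lambda>n. rate_seq t (\<psi> n)) \<longlonglongrightarrow> rate t" using rate_subseq by blast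
  define D where "D N = expectation (vol N (step s N)) - expectation (vol N (step t N))" for N
  have "D \<longlonglongrightarrow> (1 - \<eta> s) - (1 - \<eta> t)"
    unfolding D_def by (intro tendsto_diff expectation_vol_tendsto st t)
  then have D: "(\<lambda>n. D (\<psi> n)) \<longlonglongrightarrow> (1 - \<eta> s) - (1 - \<eta> t)"
    using LIMSEQ_subseq_LIMSEQ[OF _ \<psi>(1)] by (simp add: o_def)
  have le2: "rate_seq s N \<le> rate_seq t N + 2 * ball_rate * D N" if N: "0 < N" for N
  proof -
    have "expectation (pvol N (step s N)) \<le> expectation (\<lambda>w. pvol N (step t N) w + 2 * (ball_rate / real N) * (vol N (step s N) w - vol N (step t N) w))"
      using point_law.free_pair_volume_lipschitz[OF point_law_law[OF N] law_cball_le[OF N] step_mono[OF st(2)]]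
      by (intro integral_mono integrable_pvol N Bochner_Integration.integrable_add Bochner_Integration.integrable_diff integrable_mult_right integrable_vol)
    also have "\<dots> = expectation (pvol N (step t N)) + 2 * (ball_rate / real N) * D N"
      using integrable_pvol[OF N] integrable_vol[OF N] by (simp add: D_def)
    finally have "real N * expectation (pvol N (step s N)) \<le> real N * (expectation (pvol N (step t N)) + 2 * (ball_rate / real N) * D N)"
      by (intro mult_left_mono) auto
    then show ?thesis using N by (simp add: rate_seq_def distrib_left)
  qed
  have "(\<lambda>n. rate_seq t (\<psi> n) + 2 * ball_rate * D (\<psi> n)) \<longlonglongrightarrow> rate t + 2 * ball_rate * ((1 - \<eta> s) - (1 - \<eta> t))"
    by (intro tendsto_intros \<psi>(2) D)
  from rate_le[OF \<psi>(1) this] le2 pos[OF \<psi>(1)]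
  have "rate s \<le> rate t + 2 * ball_rate * ((1 - \<eta> s) - (1 - \<eta> t))" by blast
  then show "rate s \<le> rate t + 2 * ball_rate * (\<eta> t - \<eta> s)" by simp
qed

lemma expectation_vol_vol_tendsto:
  assumes "0 \<le> k" "0 \<le> s" "0 \<le> t"
  shows "(\<lambda>N. expectation (\<lambda>w. vol N (step k N) w * (vol N (step s N) w - vol N (step t N) w)))
    \<longlonglongrightarrow> (1 - \<eta> k) * (\<eta> t - \<eta> s)"
  using vol_bounds
  by (intro expectation_mult_tendsto[OF vol_tendsto[OF assms(1)] vol_diff_tendsto[OF assms(2,3)], where A=1 and B=1]
    vol_diff_bound process_measurable(3) borel_measurable_diff) auto

text \<open>The left side and the elapsed time converge along every subsequence, so one along which
  \<open>rate_seq s\<close> tends to \<open>rate s\<close> can be taken.\<close>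

lemma eta_upper:
  assumes st: "0 \<le> s" "s \<le> t"
  shows "(1 - \<eta> t) * (\<eta> t - \<eta> s) \<le> (t - s) * rate s"
proof -
  have t: "0 \<le> t" using st by simp
  obtain \<phi> where \<phi>: "strict_mono \<phi>" "(\<lambda>n. rate_seq s (\<phi> n)) \<longlonglongrightarrow> rate s" using rate_subseq by blast
  let ?d = "\<lambda>N. real (step t N) / real N - real (step s N) / real N"
  let ?e = "\<lambda>N. expectation (\<lambda>w. vol N (step t N) w * (vol N (step s N) w - vol N (step t N) w))"
  have "?d \<longlonglongrightarrow> t - s" by (intro tendsto_intros step_tendsto st t)
  then have d: "(\<lambda>n. ?d (\<phi> n)) \<longlonglongrightarrow> t - s" using LIMSEQ_subseq_LIMSEQ[OF _ \<phi>(1)] by (simp add: o_def)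
  have e: "(\<lambda>n. ?e (\<phi> n)) \<longlonglongrightarrow> (1 - \<eta> t) * (\<eta> t - \<eta> s)"
    using LIMSEQ_subseq_LIMSEQ[OF expectation_vol_vol_tendsto[OF t st(1) t] \<phi>(1)] by (simp add: o_def)
  have le: "?e N \<le> ?d N * rate_seq s N" if N: "0 < N" for N
  proof -
    have "?d N = real (step t N - step s N) / real N"
      using step_mono[OF st(2), of N] by (simp add: of_nat_diff diff_divide_distrib)
    then show ?thesis using process_inequalities(1)[OF N step_mono[OF st(2)]] N by (simp add: rate_seq_def)
  qed
  have "\<forall>\<^sub>F n in sequentially. ?e (\<phi> n) \<le> ?d (\<phi> n) * rate_seq s (\<phi> n)"
  proof (rule eventually_sequentiallyI[of 1])
    fix n :: nat assume "1 \<le> n"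
    then show "?e (\<phi> n) \<le> ?d (\<phi> n) * rate_seq s (\<phi> n)" using seq_suble[OF \<phi>(1), of n] by (intro le) simp
  qed
  then show ?thesis using tendsto_le[OF sequentially_bot tendsto_mult[OF d \<phi>(2)] e] by simp
qed

text \<open>Here the random number of active steps multiplies the pair volume, for which no
  deterministic limit is available. The fraction of active steps is therefore replaced by
  \<open>t - s\<close> first; the error is at most \<open>ball_rate\<close> times the mean deviation
  \<open>?h\<close>, which tends to zero.\<close>

lemma eta_lower:
  assumes st: "0 \<le> s" "s \<le> t" and sat: "active_until s" "active_until t"
  shows "(t - s) * rate t \<le> (1 - \<eta> s) * (\<eta> t - \<eta> s)"
proof -
  have t: "0 \<le> t" using st by simp
  obtain \<phi> where \<phi>: "strict_mono \<phi>" "(\<lambda>n. rate_seq t (\<phi> n)) \<longlonglongrightarrow> rate t" using rate_subseq by blast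
  let ?A = "\<lambda>N w. (\<Sum>l=step s N..<step t N. act N l w) / real N"
  let ?h = "\<lambda>N. expectation (\<lambda>w. \<bar>?A N w - (t - s)\<bar>)"
  let ?e = "\<lambda>N. expectation (\<lambda>w. vol N (step s N) w * (vol N (step s N) w - vol N (step t N) w))"
  have Am: "?A N \<in> borel_measurable M" if "0 < N" for N
    by (intro borel_measurable_divide active_sum_measurable that borel_measurable_const)
  have hm: "(\<lambda>w. \<bar>?A N w - (t - s)\<bar>) \<in> borel_measurable M" if "0 < N" for N
    by (intro borel_measurable_abs borel_measurable_diff Am that borel_measurable_const)
  have hb: "\<bar>\<bar>?A N w - (t - s)\<bar>\<bar> \<le> 2 * t" for N w
    using active_fraction_bounds[OF t, where s=s and N=N and w=w] st by linarith
  have "?h \<longlonglongrightarrow> 0"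
  proof (rule expectation_tendsto[OF hm hb])
    show "AE w in M. (\<lambda>N. \<bar>?A N w - (t - s)\<bar>) \<longlonglongrightarrow> 0"
      using active_interval_tendsto[OF st(2) sat]
      by eventually_elim (simp add: tendsto_rabs_zero_iff LIM_zero)
  qed
  then have h: "(\<lambda>n. ?h (\<phi> n)) \<longlonglongrightarrow> 0" using LIMSEQ_subseq_LIMSEQ[OF _ \<phi>(1)] by (simp add: o_def)
  have e: "(\<lambda>n. ?e (\<phi> n)) \<longlonglongrightarrow> (1 - \<eta> s) * (\<eta> t - \<eta> s)"
    using LIMSEQ_subseq_LIMSEQ[OF expectation_vol_vol_tendsto[OF st(1) st(1) t] \<phi>(1)] by (simp add: o_def)
  have le: "(t - s) * rate_seq t N - ball_rate * ?h N \<le> ?e N" if N: "0 < N" for N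
  proof -
    let ?q = "\<lambda>w. real N * pvol N (step t N) w"
    have q: "0 \<le> ?q w" "?q w \<le> ball_rate" for w using pvol_bounds[OF N, where n="step t N" and w=w] N by (auto simp: field_simps)
    have pi: "integrable M (pvol N (step t N))" by (rule integrable_pvol[OF N])
    have qi: "integrable M ?q" by (rule integrable_mult_right) (rule pi)
    have hi: "integrable M (\<lambda>w. \<bar>?A N w - (t - s)\<bar>)"
      using hb hm[OF N] by (intro integrable_const_bound[where B="2 * t"]) auto
    have Aqi: "integrable M (\<lambda>w. ?A N w * ?q w)"
    proof (rule integrable_const_bound[where B="t * ball_rate"])
      have "\<bar>?A N w * ?q w\<bar> \<le> t * ball_rate" for w
        using active_fraction_bounds[OF t, where s=s and N=N and w=w] q[of w] by (intro abs_mult_le) auto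
      then show "AE w in M. norm (?A N w * ?q w) \<le> t * ball_rate" by simp
    qed (use Am[OF N] borel_measurable_integrable[OF qi] in measurable)
    have mult_le: "d * x - b * \<bar>a - d\<bar> \<le> a * x" if "0 \<le> x" "x \<le> b" for a b d x :: real
    proof -
      have "(d - a) * x \<le> \<bar>a - d\<bar> * b" using that by (intro mult_mono) auto
      then show ?thesis by (simp add: algebra_simps)
    qed
    have "(t - s) * ?q w - ball_rate * \<bar>?A N w - (t - s)\<bar> \<le> ?A N w * ?q w" for w
      by (rule mult_le[OF q])
    then have "expectation (\<lambda>w. (t - s) * ?q w - ball_rate * \<bar>?A N w - (t - s)\<bar>) \<le> expectation (\<lambda>w. ?A N w * ?q w)"
      by (intro integral_mono Bochner_Integration.integrable_diff Aqi integrable_mult_right hi pi)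
    also have "expectation (\<lambda>w. (t - s) * ?q w - ball_rate * \<bar>?A N w - (t - s)\<bar>) = (t - s) * rate_seq t N - ball_rate * ?h N"
      using qi hi by (subst Bochner_Integration.integral_diff) (auto simp: rate_seq_def)
    also have "(\<lambda>w. ?A N w * ?q w) = (\<lambda>w. (\<Sum>l=step s N..<step t N. act N l w) * pvol N (step t N) w)"
      using N by (simp add: fun_eq_iff)
    also have "expectation \<dots> \<le> ?e N" by (rule process_inequalities(2)[OF N step_mono[OF st(2)]])
    finally show ?thesis .
  qed
  have "\<forall>\<^sub>F n in sequentially. (t - s) * rate_seq t (\<phi> n) - ball_rate * ?h (\<phi> n) \<le> ?e (\<phi> n)"
  proof (rule eventually_sequentiallyI[of 1])
    fix n :: nat assume "1 \<le> n"
    then show "(t - s) * rate_seq t (\<phi> n) - ball_rate * ?h (\<phi> n) \<le> ?e (\<phi> n)"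
      using seq_suble[OF \<phi>(1), of n] by (intro le) simp
  qed
  moreover have "(\<lambda>n. (t - s) * rate_seq t (\<phi> n) - ball_rate * ?h (\<phi> n)) \<longlonglongrightarrow> (t - s) * rate t - ball_rate * 0"
    by (intro tendsto_intros \<phi>(2) h)
  ultimately show ?thesis using tendsto_le[OF sequentially_bot e] by simp
qed

text \<open>If \<open>z s < 1\<close>, a positive fraction of points is unexplored at step
  \<open>s N\<close> for large \<open>N\<close>, so all earlier steps are active. Letting
  \<open>s\<close> increase to \<open>t\<close> gives the lower bound. Since only
  \<open>s < t\<close> occurs, \<open>t = T_star z\<close> is covered.\<close>

lemma active_untilI:
  assumes t: "0 \<le> t" and z: "\<And>s. 0 \<le> s \<Longrightarrow> s < t \<Longrightarrow> z s < 1"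
  shows "active_until t"
proof (cases "t = 0")
  case True
  then show ?thesis by (simp add: active_until_def step_def)
next
  case False
  \<comment> \<open>A countable sequence increasing to \<open>t\<close>, so that the exceptional
    null sets can be combined.\<close>
  define s where "s k = t - t / real (Suc k)" for k
  have s: "0 \<le> s k" "s k < t" for k using t False by (auto simp: s_def field_simps)
  have "(\<lambda>k. t / real (Suc k)) \<longlonglongrightarrow> 0"
    by (rule LIMSEQ_Suc[of "\<lambda>k. t / real k"]) (rule lim_const_over_n)
  from tendsto_diff[OF tendsto_const this, of t] have s_lim: "s \<longlonglongrightarrow> t" by (simp add: s_def[abs_def])
  have "AE w in M. \<forall>k. (\<lambda>N. num N (step (s k) N) w / real N) \<longlonglongrightarrow> 1 - z (s k)"
    using num_tendsto[OF s(1)] by (simp add: AE_all_countable)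
  then show ?thesis unfolding active_until_def
  proof eventually_elim
    case (elim w)
    let ?L = "\<lambda>N. (\<Sum>l<step t N. act N l w) / real N"
    show "?L \<longlonglongrightarrow> t"
    proof (rule order_tendstoI)
      fix a assume "t < a"
      then have "\<forall>\<^sub>F N in sequentially. real (step t N) / real N < a"
        using order_tendstoD(2)[OF step_tendsto[OF t]] by blast
      then show "\<forall>\<^sub>F N in sequentially. ?L N < a"
      proof eventually_elim
        case (elim N)
        have "?L N \<le> real (step t N) / real N"
          using sum_bounded_above[of "{..<step t N}" "\<lambda>l. act N l w" 1] by (intro divide_right_mono) auto
        then show ?case using elim by simp
      qed
    next
      fix a assume "a < t"
      then obtain k where k: "a < s k"
        using order_tendstoD(1)[OF s_lim] by (meson eventually_sequentially order_refl)
      have "0 < 1 - z (s k)" using z[OF s] by simp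
      then have "\<forall>\<^sub>F N in sequentially. 0 < num N (step (s k) N) w / real N"
        using order_tendstoD(1) elim by blast
      moreover have "\<forall>\<^sub>F N in sequentially. a < real (step (s k) N) / real N"
        by (rule order_tendstoD(1)[OF step_tendsto[OF s(1)] k])
      ultimately show "\<forall>\<^sub>F N in sequentially. a < ?L N"
      proof eventually_elim
        case (elim N)
        have "unex N (step (s k) N) w \<noteq> {}" using elim(1) by auto
        then have "act N l w = 1" if "l < step (s k) N" for l
          using unexplored_antimono[of l "step (s k) N" r N "pos N w" "cho N w"] that by auto
        then have "real (step (s k) N) = (\<Sum>l<step (s k) N. act N l w)" by simp
        also have "\<dots> \<le> (\<Sum>l<step t N. act N l w)"
          using step_mono[OF less_imp_le[OF s(2)], of k N] by (intro sum_mono2) auto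
        finally have "real (step (s k) N) / real N \<le> ?L N" by (intro divide_right_mono) auto
        then show ?case using elim(2) by simp
      qed
    qed
  qed
qed

section \<open>Boundary values and positivity of \<open>T_star\<close>\<close>

lemma z_0: "z 0 = 0"
proof -
  have "AE w in M. z 0 = 0"
    using num_tendsto[of 0, OF order_refl]
  proof eventually_elim
    case (elim w)
    have "(\<lambda>N. num N (step 0 N) w / real N) \<longlonglongrightarrow> 1"
      by (rule tendsto_eventually, rule eventually_sequentiallyI[of 1]) (simp add: step_def)
    then have "1 - z 0 = 1" using elim LIMSEQ_unique by blast
    then show ?case by simp
  qed
  then show ?thesis by simp
qed

lemma eta_0: "\<eta> 0 = 0"
proof -
  have "(\<lambda>N. expectation (vol N (step 0 N))) \<longlonglongrightarrow> 1"
  proof (rule tendsto_eventually, rule eventually_sequentiallyI[of 1])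
    fix N :: nat assume "1 \<le> N"
    then interpret L: point_law "law N" by (intro point_law_law) simp
    show "expectation (vol N (step 0 N)) = 1"
      by (simp add: step_def free_volume_def L.prob_space[unfolded L.space_eq] prob_space)
  qed
  then have "1 - \<eta> 0 = 1" using expectation_vol_tendsto[of 0] LIMSEQ_unique by blast
  then show ?thesis by simp
qed

text \<open>Every active step uses up at least the chosen point, so the exploration is over after
  \<open>N\<close> steps. Hence the set whose infimum is \<open>T_star\<close> is nonempty.\<close>

lemma z_1: "z 1 = 1"
proof -
  have "AE w in M. \<forall>N. 0 < N \<longrightarrow> (\<forall>n. unex N n w \<noteq> {} \<longrightarrow> cho N w (Suc n) \<in> unex N n w)"
    using AE_choice_unexplored by (simp add: AE_all_countable)
  moreover have "AE w in M. (\<lambda>N. num N (step 1 N) w / real N) \<longlonglongrightarrow> 1 - z 1"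
    by (rule num_tendsto) simp
  ultimately have "AE w in M. z 1 = 1"
  proof eventually_elim
    case (elim w)
    have "num N (step 1 N) w = 0" if N: "0 < N" for N
    proof -
      have "num N n w = 0 \<or> num N n w + real n \<le> real N" for n
      proof (induction n)
        case (Suc n)
        have s: "act N n w * nbr N n w = num N n w - num N (Suc n) w - act N n w"
          using elim(1) N by (intro num_Suc) blast
        show ?case
        proof (cases "unex N n w = {}")
          case True
          then show ?thesis by (simp add: unexplored_Suc)
        next
          case False
          then have "num N n w \<noteq> 0" by simp
          moreover have "0 \<le> nbr N n w" by simp
          ultimately show ?thesis using Suc s False by simp
        qed
      qed simp
      from this[of N] show ?thesis by (auto simp: step_def)
    qed
    then have "(\<lambda>N. num N (step 1 N) w / real N) \<longlonglongrightarrow> 0"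
      by (intro tendsto_eventually eventually_sequentiallyI[of 1]) simp
    then have "1 - z 1 = 0" using elim(2) LIMSEQ_unique by blast
    then show ?case by simp
  qed
  then show ?thesis by simp
qed

text \<open>If \<open>z t = 1\<close>, the increment bounds on \<open>[0, t]\<close> give \<open>c
  \<le> 1 - \<eta> t \<le> \<eta> t + t \<le> (1 + ball_rate) * t\<close>. All such times are thus
  at least \<open>c / (1 + ball_rate)\<close>.\<close>

lemma T_star_pos: "0 < T_star z"
proof -
  define c where "c = exp (- ball_rate)"
  have c: "0 < c" by (simp add: c_def)
  have "c / (1 + ball_rate) \<le> t" if t: "0 < t" "z t = 1" for t
  proof -
    have "c \<le> 1 - \<eta> t" using eta_le[of t] t(1) by (simp add: c_def)
    moreover have "1 - \<eta> t \<le> \<eta> t + t" using z_increment(2)[of 0 t] t z_0 eta_0 by simp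
    moreover have "\<eta> t \<le> ball_rate * t" using eta_increment(2)[of 0 t] t eta_0 by simp
    ultimately have "c \<le> t * (1 + ball_rate)" by (simp add: algebra_simps)
    then show ?thesis using ball_rate_nonneg by (simp add: pos_divide_le_eq)
  qed
  then have "c / (1 + ball_rate) \<le> T_star z"
    unfolding T_star_def using z_1 by (intro cInf_greatest) (auto intro: exI[of _ 1])
  moreover have "0 < c / (1 + ball_rate)" using c ball_rate_nonneg by simp
  ultimately show ?thesis by simp
qed

lemma z_less_1: "0 \<le> t \<Longrightarrow> t < T_star z \<Longrightarrow> z t < 1"
proof -
  assume t: "0 \<le> t" "t < T_star z"
  have "z t \<noteq> 1"
  proof
    assume "z t = 1"
    then have "t \<in> {t. 0 < t \<and> z t = 1}" using t z_0 by (cases "t = 0") auto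
    then have "T_star z \<le> t" unfolding T_star_def by (intro cInf_lower bdd_belowI[of _ 0]) auto
    then show False using t by simp
  qed
  then show "z t < 1" using z_range[OF t(1)] by simp
qed

lemma differential_equations:
  "0 < T_star z \<and>
    (\<forall>t\<in>{0..T_star z}. \<eta> t < 1 \<and>
      (\<exists>dz d\<eta>.
         (z has_real_derivative dz) (at t within {0..T_star z}) \<and>
         (\<eta> has_real_derivative d\<eta>) (at t within {0..T_star z}) \<and>
         dz = 1 + (1 - z t) * (d\<eta> / (1 - \<eta> t)) \<and>
         dz = 1 + d\<eta> * exp_minus (\<integral>\<^sup>+s\<in>{0..t}. ennreal (1 / (1 - z s)) \<partial>lborel)))"
proof (intro conjI T_star_pos ballI)
  define c where "c = exp (- ball_rate)"
  \<comment> \<open>Large enough for three Lipschitz constants: \<open>ball_rate\<close> for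
    \<open>\<eta>\<close>, \<open>(1 + ball_rate) / c\<close> for \<open>z\<close>, where
    \<open>c\<close> is the lower bound of \<open>1 - \<eta>\<close>, and
    \<open>2 * ball_rate\<close> for \<open>rate\<close> in terms of \<open>\<eta>\<close>.\<close>
  define K where "K = (1 + ball_rate) / c + 2 * ball_rate"
  have c: "0 < c" by (simp add: c_def)
  have b: "0 \<le> ball_rate" by (rule ball_rate_nonneg)
  have K: "0 \<le> K" "ball_rate \<le> K" "2 * ball_rate \<le> K" "(1 + ball_rate) / c \<le> K" using b c by (auto simp: K_def)
  have sat: "active_until t" if "0 \<le> t" "t \<le> T_star z" for t
    using that z_less_1 by (intro active_untilI) auto
  fix t assume t: "t \<in> {0..T_star z}"
  show "\<eta> t < 1" using eta_le[of t] t c by (simp add: c_def) (smt (verit) exp_gt_zero)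
  show "\<exists>dz d\<eta>.
         (z has_real_derivative dz) (at t within {0..T_star z}) \<and>
         (\<eta> has_real_derivative d\<eta>) (at t within {0..T_star z}) \<and>
         dz = 1 + (1 - z t) * (d\<eta> / (1 - \<eta> t)) \<and>
         dz = 1 + d\<eta> * exp_minus (\<integral>\<^sup>+s\<in>{0..t}. ennreal (1 / (1 - z s)) \<partial>lborel)"
  proof (rule adsorption_derivatives[where T="T_star z" and K=K and c=c and R=rate])
    show "z (T_star z) \<le> 1" using z_range[of "T_star z"] T_star_pos by simp
    show "\<eta> s \<le> 1 - c" if "0 \<le> s" for s using eta_le[OF that] by (simp add: c_def)
    fix s t assume st: "0 \<le> s" "s \<le> t" "t \<le> T_star z"
    have sat': "active_until s" "active_until t" using st by (auto intro!: sat)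
    have e: "0 \<le> \<eta> t - \<eta> s" "\<eta> t - \<eta> s \<le> ball_rate * (t - s)" by (rule eta_increment[OF st(1,2)])+
    have "ball_rate * (t - s) \<le> K * (t - s)" using K(2) st by (intro mult_right_mono) auto
    then show "0 \<le> \<eta> t - \<eta> s \<and> \<eta> t - \<eta> s \<le> K * (t - s)" using e by simp
    have zi: "0 \<le> z t - z s" "(1 - \<eta> t) * (z t - z s) \<le> (\<eta> t - \<eta> s) + (t - s)" by (rule z_increment[OF st(1,2)])+
    have "c * (z t - z s) \<le> (1 - \<eta> t) * (z t - z s)"
      using eta_le[of t] st zi(1) by (intro mult_right_mono) (auto simp: c_def)
    also have "\<dots> \<le> (1 + ball_rate) * (t - s)" using zi(2) e(2) by (simp add: distrib_right)
    finally have "z t - z s \<le> (1 + ball_rate) / c * (t - s)" using c by (simp add: field_simps)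
    also have "\<dots> \<le> K * (t - s)" using K(4) st by (intro mult_right_mono) auto
    finally show "0 \<le> z t - z s \<and> z t - z s \<le> K * (t - s)" using zi(1) by simp
    have "2 * ball_rate * (\<eta> t - \<eta> s) \<le> K * (\<eta> t - \<eta> s)" using K(3) e(1) by (intro mult_right_mono) auto
    then show "rate t \<le> rate s \<and> rate s \<le> rate t + K * (\<eta> t - \<eta> s)" using rate_increment[OF st(1,2)] by simp
    show "(1 - \<eta> t) * (\<eta> t - \<eta> s) \<le> (t - s) * rate s" by (rule eta_upper[OF st(1,2)])
    show "(t - s) * rate t \<le> (1 - \<eta> s) * (\<eta> t - \<eta> s)" by (rule eta_lower[OF st(1,2) sat'])
    show "(1 - \<eta> t) * (z t - z s - (t - s)) \<le> (1 - z s) * (\<eta> t - \<eta> s)" by (rule z_upper[OF st(1,2) sat'])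
    show "(1 - z t) * (\<eta> t - \<eta> s) \<le> (1 - \<eta> s) * (z t - z s - (t - s))" by (rule z_lower[OF st(1,2) sat'])
  qed (use T_star_pos K(1) c z_0 eta_0 z_less_1 t in auto)
qed

end

theorem proposition3p2:
  fixes M :: "'w measure"
    and lam r :: real
    and C :: "nat \<Rightarrow> 'a::euclidean_space set"
    and X :: "nat \<Rightarrow> nat \<Rightarrow> 'w \<Rightarrow> 'a"
    and J :: "nat \<Rightarrow> nat \<Rightarrow> 'w \<Rightarrow> nat"
    and z \<eta> :: "real \<Rightarrow> real"
  assumes model: "rsa_exploration M lam r C X J"
    and z_range: "\<And>t. 0 \<le> t \<Longrightarrow> z t \<in> {0..1}"
    and eta_range: "\<And>t. 0 \<le> t \<Longrightarrow> \<eta> t \<in> {0..1}"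
    and z_limit: "\<And>t. 0 \<le> t \<Longrightarrow> converges_AE_L1 M (explored_fraction r X J t) (z t)"
    and eta_limit: "\<And>t. 0 \<le> t \<Longrightarrow> converges_AE_L1 M (explored_volume_fraction r C X J t) (\<eta> t)"
  shows "0 < T_star z \<and>
    (\<forall>t\<in>{0..T_star z}. \<eta> t < 1 \<and>
      (\<exists>dz d\<eta>.
         (z has_real_derivative dz) (at t within {0..T_star z}) \<and>
         (\<eta> has_real_derivative d\<eta>) (at t within {0..T_star z}) \<and>
         dz = 1 + (1 - z t) * (d\<eta> / (1 - \<eta> t)) \<and>
         dz = 1 + d\<eta> * exp_minus (\<integral>\<^sup>+s\<in>{0..t}. ennreal (1 / (1 - z s)) \<partial>lborel)))"
proof -
  interpret rsa_exploration M lam r C X J by (rule model)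
  interpret rsa_limit M lam r C X J z \<eta>
    by unfold_locales (rule z_range eta_range z_limit eta_limit; assumption)+
  show ?thesis by (rule differential_equations)
qed

end
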